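(* For $\alpha,\beta\in[0,1]$ put $$F(\alpha)=\Big\{x\in[0,1)\colon\liminf_{n\to\infty}\frac{R_n(x)}{n}=\alpha\Big\},\qquad G(\beta)=\Big\{x\in[0,1)\colon\limsup_{n\to\infty}\frac{R_n(x)}{n}=\beta\Big\}.$$ For all $\alpha,\beta\in[0,1]$ with $\alpha\le\beta$, $$\dim_H\big(F(\alpha)\cap G(\beta)\big)=\begin{cases}1,&\text{if }\beta=0,\\ s\Big(\frac{\beta^2(1-\alpha)}{\beta-\alpha},\frac{\sqrt5+1}{2}\Big),&\text{if }0\le\alpha\le\frac{\beta}{1+\beta}<\beta\le1,\\ 0,&\text{otherwise.}\end{cases}$$
   Context: $\dim_H$ denotes Hausdorff dimension. Each irrational $x\in[0,1)$ has a unique infinite continued fraction expansion $x=[a_1(x),a_2(x),\ldots]$ with $a_n(x)\in\mathbb{N}=\{1,2,\ldots\}$. The $n$-th maximal run-length function is $$R_n(x)=\max\{l\ge1\colon a_{j+1}(x)=\cdots=a_{j+l}(x)\text{ for some }0\le j\le n-l\}.$$ In the definitions of $F(\alpha)$ and $G(\beta)$ only irrational $x$ are considered. For positive integers $a_1,\ldots,a_n$, $q_n(a_1,\ldots,a_n)$ is the denominator of the convergent $[a_1,\ldots,a_n]$, given by $q_{-1}=0$, $q_0=1$, $q_k=a_kq_{k-1}+q_{k-2}$. Put $\tau=\frac{\sqrt5+1}{2}$. For $0<\gamma<1$, $s(\gamma,\tau)$ is the limit (known to exist) $$s(\gamma,\tau)=\lim_{n\to\infty}\inf\Big\{\rho\ge0\colon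 \sum_{a_1,\ldots,a_n\in\mathbb{N}}\Big(\frac{1}{\tau^{\frac{n\gamma}{1-\gamma}}\,q_n(a_1,\ldots,a_n)}\Big)^{2\rho}\le1\Big\},$$ and one sets $s(0,\tau)=1$, $s(1,\tau)=\frac12$. *)

theory Defs
  imports "HOL-Analysis.Analysis"
begin

section \<open>Hausdorff dimension\<close>

text \<open>
  The gauge $|U|^s$ of a set $U$. Since \<^term>\<open>0 powr 0 = (0::real)\<close>, the exponent $0$ is treated
  separately, so that the $0$-dimensional Hausdorff measure is counting measure.
\<close>

definition diam_pow :: "real \<Rightarrow> 'a::metric_space set \<Rightarrow> ennreal" where
  "diam_pow s U = (if U = {} then 0 else if s = 0 then 1 else ennreal (diameter U powr s))"

text \<open>
  Boundedness is required explicitly because \<^const>\<open>diameter\<close> is unspecified on unbounded sets.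
\<close>

definition hausdorff_premeasure :: "real \<Rightarrow> real \<Rightarrow> 'a::metric_space set \<Rightarrow> ennreal" where
  "hausdorff_premeasure s \<delta> A =
     (INF U \<in> {U :: nat \<Rightarrow> 'a set. A \<subseteq> (\<Union>i. U i) \<and> (\<forall>i. bounded (U i) \<and> diameter (U i) \<le> \<delta>)}.
        \<Sum>i. diam_pow s (U i))"

definition hausdorff_measure :: "real \<Rightarrow> 'a::metric_space set \<Rightarrow> ennreal" where
  "hausdorff_measure s A = (SUP \<delta>\<in>{0<..}. hausdorff_premeasure s \<delta> A)"

definition hausdorff_dim :: "'a::metric_space set \<Rightarrow> ereal" where
  "hausdorff_dim A = Inf (ereal ` {s. 0 \<le> s \<and> hausdorff_measure s A = 0})"


section \<open>Continued fractions\<close>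

fun cf_value :: "nat list \<Rightarrow> real" where
  "cf_value [] = 0"
| "cf_value (a # as) = 1 / (real a + cf_value as)"

text \<open>
  A sequence of partial quotients is a function on \<^typ>\<open>nat\<close> whose entries of index at least $1$
  matter. The condition \<^prop>\<open>a 0 = (0::nat)\<close> only makes the function unique; it is the integer
  part of $x \in [0,1)$.
\<close>

definition cf_expansion :: "(nat \<Rightarrow> nat) \<Rightarrow> real \<Rightarrow> bool" where
  "cf_expansion a x \<longleftrightarrow> a 0 = 0 \<and> (\<forall>n\<ge>1. a n \<ge> 1) \<and>
     (\<lambda>n. cf_value (map a [1..<Suc n])) \<longlonglongrightarrow> x"

text \<open>Only meaningful for irrational $x \in [0,1)$, where the expansion exists and is unique.\<close>

definition cf_digit :: "real \<Rightarrow> nat \<Rightarrow> nat" where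
  "cf_digit x = (THE a. cf_expansion a x)"

text \<open>The denominators $q_n(a_1,\ldots,a_n)$, with the value $q_{-1} = 0$ already inserted.\<close>

fun cf_denom :: "(nat \<Rightarrow> nat) \<Rightarrow> nat \<Rightarrow> nat" where
  "cf_denom a 0 = 1"
| "cf_denom a (Suc 0) = a 1"
| "cf_denom a (Suc (Suc k)) = a (Suc (Suc k)) * cf_denom a (Suc k) + cf_denom a k"


section \<open>Run lengths\<close>

text \<open>For $n = 0$ the set is empty and the value is irrelevant.\<close>

definition run_length :: "nat \<Rightarrow> real \<Rightarrow> nat" where
  "run_length n x =
     Max {l. 1 \<le> l \<and> (\<exists>j. j + l \<le> n \<and> (\<forall>i\<in>{1..l}. cf_digit x (j + i) = cf_digit x (j + 1)))}"

definition F :: "real \<Rightarrow> real set" where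
  "F \<alpha> = {x\<in>{0..<1}. x \<notin> \<rat> \<and> liminf (\<lambda>n. ereal (real (run_length n x) / real n)) = ereal \<alpha>}"

definition G :: "real \<Rightarrow> real set" where
  "G \<beta> = {x\<in>{0..<1}. x \<notin> \<rat> \<and> limsup (\<lambda>n. ereal (real (run_length n x) / real n)) = ereal \<beta>}"


section \<open>The dimension function $s(\gamma,\tau)$\<close>

text \<open>
  Tuples $(a_1,\ldots,a_n)$ of positive integers are extensional functions on $\{1,\ldots,n\}$. The
  sum is taken in \<^typ>\<open>ennreal\<close>, so a divergent sum is $\infty$.
\<close>

definition pre_s :: "nat \<Rightarrow> real \<Rightarrow> real \<Rightarrow> real" where
  "pre_s n \<gamma> \<tau> = Inf {\<rho>. 0 \<le> \<rho> \<and>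
     (\<Sum>\<^sub>\<infinity> a \<in> {1..n} \<rightarrow>\<^sub>E {1..}.
        ennreal ((1 / (\<tau> powr (real n * \<gamma> / (1 - \<gamma>)) * real (cf_denom a n))) powr (2 * \<rho>))) \<le> 1}"

definition s_dim :: "real \<Rightarrow> real \<Rightarrow> real" where
  "s_dim \<gamma> \<tau> = (if \<gamma> = 0 then 1 else if \<gamma> = 1 then 1/2 else lim (\<lambda>n. pre_s n \<gamma> \<tau>))"

end

theory Submission
  imports Defs "HOL-Probability.Infinite_Product_Measure"
begin

text \<open>
  Upper bound. Write $R_n$ for the longest run among the first $n$ digits. If a run starts after
  position $j$, then $R_{j + R_j} = R_j$, so the lower limit forces
  $R_j \ge \frac{\alpha}{1 - \alpha} j$ up to small errors, while the upper limit forces a run of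
  length $l$ to start after position $\frac{1 - \beta}{\beta} l$. Going back from a time $n$ with
  $R_n \approx \beta n$, one finds boundedly many disjoint runs whose total length is close to
  $\beta n \sum_i (\frac{\alpha (1 - \beta)}{(1 - \alpha) \beta})^i = \gamma n$. A run of length $l$
  contributes at most a constant times $\tau^{-2 \rho l}$ to the sum of $q^{-2 \rho}$, and there are
  only polynomially many positions for a bounded number of runs; hence the dimension is at most the
  infimum in the definition of $s(\gamma, \tau)$, for every single $n \ge 1$.

  Lower bound. Take digit sequences in which gaps, filled freely with words from a finite alphabet,
  alternate with runs of ones whose lengths realise $\alpha$ and $\beta$, and give a word $w$ mass
  proportional to $q(w)^{-2 \rho}$. If infinitely many of these infima exceed $\rho$, then the free gaps
  outweigh the runs and the mass of every interval is at most a constant times its length to the power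
  $\rho$. Both bounds together also show that the limit defining $s(\gamma, \tau)$ exists. For
  $\gamma = 1$ the divergence of $\sum_a a^{-2 \rho}$ for $\rho \le 1/2$ provides the alphabets, and for
  $\beta = 0$ the fact that cylinders of a given rank have total length $1$.
\<close>

section \<open>Continued fractions\<close>

text \<open>The exponent n\<gamma>/(1-\<gamma>) in \<open>pre_s\<close> is a balance: with a share
  \<gamma> of the digits in runs, n free digits come with n\<gamma>/(1-\<gamma>) run digits, each
  costing a factor \<tau>^(-2\<rho>). The golden ratio enters because ones make q grow slowest; a
  run of a larger digit c only adds a factor of order c^(-2\<rho>), summable since every admissible
  \<rho> exceeds 1/2. The obstacle for the upper bound is that \<alpha> forces runs on all scales.
  Only K of them are counted, and K grows until their share comes close to \<beta> / (1 -
  \<alpha>(1-\<beta>)/((1-\<alpha>)\<beta>)) = \<gamma>. In the construction the runs have nearly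
  share \<gamma> within each late stage, see \<open>ratio_identity\<close>. For \<alpha> = 0,
  \<alpha> = \<beta>/(1+\<beta>), \<beta> = 0 or \<beta> = 1 no fixed positive stage parameters
  realise the limits, so they vary with an index i that is raised slowly. Infinite sums over words
  are replaced by bounds over all finite sets of words.\<close>

text \<open>
  \<open>cfmap w X\<close> is $[w_1, \ldots, w_n + X]$ and \<open>cfden w X\<close> the denominator of this Moebius map, so
  that \<open>cont w\<close> is $q_n(w_1, \ldots, w_n)$ and \<open>cfden w 1\<close> is $q_n + q_{n-1}$.
\<close>

fun cfmap :: "nat list \<Rightarrow> real \<Rightarrow> real" where
  "cfmap [] X = X"
| "cfmap (a # w) X = 1 / (real a + cfmap w X)"

fun cfden :: "nat list \<Rightarrow> real \<Rightarrow> real" where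
  "cfden [] X = 1"
| "cfden (a # w) X = (real a + cfmap w X) * cfden w X"

definition cont :: "nat list \<Rightarrow> real" where
  "cont w = cfden w 0"

lemma cfmap_zero: "cfmap w 0 = cf_value w"
  by (induction w) auto

lemma cfmap_append: "cfmap (u @ v) X = cfmap u (cfmap v X)"
  by (induction u) auto

lemma cfden_append: "cfden (u @ v) X = cfden u (cfmap v X) * cfden v X"
  by (induction u) (auto simp: cfmap_append)

lemma cfmap_range: "0 \<notin> set w \<Longrightarrow> 0 \<le> X \<Longrightarrow> X \<le> 1 \<Longrightarrow> 0 \<le> cfmap w X \<and> cfmap w X \<le> 1"
proof (induction w)
  case (Cons a w)
  then have "real a \<ge> 1" "0 \<le> cfmap w X" by auto
  then show ?case by (auto simp: divide_simps)
qed auto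

lemma cfmap_nonneg: "0 \<notin> set w \<Longrightarrow> 0 \<le> X \<Longrightarrow> 0 \<le> cfmap w X"
  by (induction w) auto

text \<open>\<open>cont w + q' * X\<close> is the classical q_n + q_(n-1) X. Induction is on the
  last digit because appending \<open>a\<close> turns the pair (q_n, q_(n-1)) into (a q_n + q_(n-1),
  q_n). The bound \<open>q' \<le> cont w\<close> is the source of the factor 2 in
  \<open>cfden_bounds\<close>.\<close>

lemma cfden_affine:
  "0 \<notin> set w \<Longrightarrow> \<exists>q'. 0 \<le> q' \<and> q' \<le> cont w \<and> 1 \<le> cont w \<and> (\<forall>X\<ge>0. cfden w X = cont w + q' * X)"
proof (induction w rule: rev_induct)
  case Nil
  then show ?case by (intro exI[of _ 0]) (auto simp: cont_def)
next
  case (snoc a w)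
  then obtain q' where q: "0 \<le> q'" "q' \<le> cont w" "1 \<le> cont w"
    "\<And>X. X \<ge> 0 \<Longrightarrow> cfden w X = cont w + q' * X" by auto
  have a: "real a \<ge> 1" using snoc.prems by (cases a) auto
  have *: "cfden (w @ [a]) X = (a * cont w + q') + cont w * X" if "X \<ge> 0" for X
    using q(4)[of "1 / (real a + X)"] that a by (simp add: cfden_append field_simps)
  have c: "cont (w @ [a]) = a * cont w + q'" using *[of 0] by (simp add: cont_def)
  have "cont w \<le> real a * cont w" using mult_right_mono[of 1 "real a" "cont w"] a q(3) by simp
  then have "0 \<le> cont w" "cont w \<le> cont (w @ [a])" "1 \<le> cont (w @ [a])"
    using c q by linarith+
  then show ?case using * c by (intro exI[of _ "cont w"]) auto
qed

lemma cont_ge_1: "0 \<notin> set w \<Longrightarrow> 1 \<le> cont w"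
  using cfden_affine by blast

lemma cfden_bounds:
  assumes "0 \<notin> set w" "0 \<le> X" "X \<le> 1"
  shows "cont w \<le> cfden w X" "cfden w X \<le> 2 * cont w"
proof -
  obtain q' where q: "0 \<le> q'" "q' \<le> cont w" "cfden w X = cont w + q' * X"
    using cfden_affine[OF assms(1)] assms(2) by blast
  have "q' * X \<le> cont w" using q assms mult_mono[of q' "cont w" X 1] by auto
  then show "cont w \<le> cfden w X" "cfden w X \<le> 2 * cont w" using q assms by auto
qed

text \<open>Since \<open>cont (u @ v)\<close> is \<open>cfden u\<close> at a point of [0,1] times
  \<open>cont v\<close>, only the distortion of \<open>cfden u\<close> over [0,1] matters. This
  quasi-multiplicativity replaces independence: the lower estimate splits sums over words into
  products, the upper one feeds the mass distribution.\<close>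

lemma cont_append_bounds:
  assumes "0 \<notin> set u" "0 \<notin> set v"
  shows "cont u * cont v \<le> cont (u @ v)" "cont (u @ v) \<le> 2 * cont u * cont v"
proof -
  have "0 \<le> cfmap v 0 \<and> cfmap v 0 \<le> 1" using cfmap_range[OF assms(2)] by simp
  then have "cont u \<le> cfden u (cfmap v 0)" "cfden u (cfmap v 0) \<le> 2 * cont u"
    using cfden_bounds[OF assms(1)] by auto
  moreover have "cont v \<ge> 0" using cont_ge_1[OF assms(2)] by simp
  moreover have "cont (u @ v) = cfden u (cfmap v 0) * cont v" by (simp add: cont_def cfden_append)
  ultimately show "cont u * cont v \<le> cont (u @ v)" "cont (u @ v) \<le> 2 * cont u * cont v"
    by (auto intro: mult_right_mono)
qed

lemma cont_Nil [simp]: "cont [] = 1" by (simp add: cont_def)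
lemma cont_single [simp]: "cont [a] = real a" by (simp add: cont_def)

lemma cont_Cons: "cont (a # w) = (real a + cf_value w) * cont w"
  by (simp add: cont_def cfmap_zero)

lemma cont_Cons_Cons:
  assumes "b \<noteq> 0" "0 \<notin> set w"
  shows "cont (a # b # w) = real a * cont (b # w) + cont w"
proof -
  have "real b + cf_value w > 0"
    using cfmap_nonneg[OF assms(2), of 0] assms(1) by (simp add: cfmap_zero add_pos_nonneg)
  then show ?thesis by (simp add: cont_Cons field_simps)
qed

text \<open>The recursion of \<open>cf_denom\<close> works at the right end of a word, whereas
  \<open>cfden\<close> unfolds at the left. Evaluating the affine formula at X = 1/(a + 1/b)
  reconciles the two.\<close>

lemma cont_snoc_snoc:
  assumes "0 \<notin> set w" "a \<noteq> 0" "b \<noteq> 0"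
  shows "cont (w @ [a, b]) = real b * cont (w @ [a]) + cont w"
proof -
  obtain q' where q: "\<And>X. X \<ge> 0 \<Longrightarrow> cfden w X = cont w + q' * X"
    using cfden_affine[OF assms(1)] by blast
  have 1: "cont (w @ [a]) = a * cont w + q'"
    using q[of "1/real a"] assms(2) by (simp add: cont_def cfden_append field_simps)
  have p: "real a + 1 / real b > 0" using assms by (simp add: add_pos_pos)
  have "cont (w @ [a,b]) = (cont w + q' / (real a + 1 / real b)) * ((real a + 1/real b) * real b)"
    using q[of "1/(real a + 1/ real b)"] p by (simp add: cont_def cfden_append)
  also have "\<dots> = cont w * (real a * real b + 1) + q' * real b"
  proof -
    have "q' / (real a + 1 / real b) * ((real a + 1/real b) * real b) = q' * real b"
      using p by simp
    moreover have "(real a + 1/real b) * real b = real a * real b + 1"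
      using assms(3) by (simp add: field_simps)
    ultimately show ?thesis unfolding distrib_right by simp
  qed
  finally show ?thesis using 1 by (simp add: algebra_simps)
qed

text \<open>Each step X -> 1/(a + X) is a Moebius map of determinant -1, so the difference quotient
  is exactly the inverse product of the two denominators.\<close>

lemma cfmap_diff:
  assumes "0 \<notin> set w" "0 \<le> X" "0 \<le> Y"
  shows "\<bar>cfmap w X - cfmap w Y\<bar> = \<bar>X - Y\<bar> / (cfden w X * cfden w Y)"
  using assms
proof (induction w)
  case (Cons a w)
  define x y where "x = real a + cfmap w X" and "y = real a + cfmap w Y"
  have p: "x > 0" "y > 0" using Cons.prems cfmap_nonneg[of w]
    by (auto simp: x_def y_def add_pos_nonneg)
  have "cfmap (a # w) X - cfmap (a # w) Y = (cfmap w Y - cfmap w X) / (x * y)"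
    using p by (simp add: x_def[symmetric] y_def[symmetric] field_simps) (simp add: x_def y_def)
  then have "\<bar>cfmap (a # w) X - cfmap (a # w) Y\<bar> = \<bar>cfmap w X - cfmap w Y\<bar> / (x * y)"
    using p by (simp add: abs_divide abs_mult abs_minus_commute)
  also have "\<dots> = \<bar>X - Y\<bar> / (cfden w X * cfden w Y) / (x * y)"
    using Cons by simp
  also have "\<dots> = \<bar>X - Y\<bar> / (cfden (a # w) X * cfden (a # w) Y)"
    by (simp add: x_def y_def field_simps)
  finally show ?case .
qed auto

lemma cfmap_diff_le:
  assumes "0 \<notin> set w" "0 \<le> X" "X \<le> 1" "0 \<le> Y" "Y \<le> 1"
  shows "\<bar>cfmap w X - cfmap w Y\<bar> \<le> 1 / (cont w)\<^sup>2"
proof -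
  have "cont w * cont w \<le> cfden w X * cfden w Y"
    using cfden_bounds[OF assms(1,2,3)] cfden_bounds[OF assms(1,4,5)] cont_ge_1[OF assms(1)]
    by (intro mult_mono) linarith+
  moreover have "\<bar>X - Y\<bar> \<le> 1" using assms by auto
  ultimately have "\<bar>X - Y\<bar> / (cfden w X * cfden w Y) \<le> 1 / (cont w * cont w)"
    using cont_ge_1[OF assms(1)] by (intro frac_le) auto
  then show ?thesis using cfmap_diff[OF assms(1,2,4)] by (simp add: power2_eq_square)
qed

lemma cfmap_diff_ge:
  assumes "0 \<notin> set w" "0 \<le> X" "X \<le> 1" "0 \<le> Y" "Y \<le> 1"
  shows "\<bar>cfmap w X - cfmap w Y\<bar> \<ge> \<bar>X - Y\<bar> / (4 * (cont w)\<^sup>2)"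
proof -
  have "cfden w X * cfden w Y \<le> (2 * cont w) * (2 * cont w)"
    using cfden_bounds[OF assms(1,2,3)] cfden_bounds[OF assms(1,4,5)] cont_ge_1[OF assms(1)]
    by (intro mult_mono) linarith+
  moreover have "cfden w X * cfden w Y > 0"
    using cfden_bounds(1)[OF assms(1,2,3)] cfden_bounds(1)[OF assms(1,4,5)] cont_ge_1[OF assms(1)]
    by (intro mult_pos_pos) linarith+
  ultimately have "\<bar>X - Y\<bar> / (cfden w X * cfden w Y) \<ge> \<bar>X - Y\<bar> / (4 * (cont w)\<^sup>2)"
    by (intro divide_left_mono) (auto simp: power2_eq_square)
  then show ?thesis using cfmap_diff[OF assms(1,2,4)] by simp
qed

section \<open>Growth of continuants compared with powers of the golden ratio\<close>

definition golden :: real where "golden = (sqrt 5 + 1) / 2"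

lemma golden_sq: "golden\<^sup>2 = golden + 1"
  by (simp add: golden_def power2_eq_square field_simps)

lemma golden_rec: "golden ^ Suc (Suc n) = golden ^ Suc n + golden ^ n"
proof -
  have "golden ^ Suc (Suc n) = golden ^ n * golden\<^sup>2" by (simp add: power2_eq_square)
  then show ?thesis unfolding golden_sq by (simp add: algebra_simps)
qed

lemma golden_gt_1: "golden > 1"
proof -
  have "sqrt 5 > sqrt 1" by (subst real_sqrt_less_iff) auto
  then show ?thesis by (simp add: golden_def)
qed

lemma golden_pos [simp]: "golden > 0" using golden_gt_1 by simp

text \<open>The worst case is the word of ones, whose \<open>cont\<close> is a Fibonacci number. The
  extra factor \<open>golden\<close> covers the start: the word [1] has \<open>cont\<close> 1 <
  \<tau>.\<close>

lemma cont_ge_golden: "0 \<notin> set w \<Longrightarrow> golden * cont w \<ge> golden ^ length w"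
proof (induction w rule: induct_list012)
  case 1
  then show ?case using golden_gt_1 by simp
next
  case (2 a)
  then show ?case using golden_gt_1 by simp
next
  case (3 a b w)
  have "cont (b # w) \<le> real a * cont (b # w)"
    using 3 cont_ge_1[of "b # w"] by (auto simp: mult_le_cancel_right1)
  then have "golden * cont (a # b # w) \<ge> golden * cont (b # w) + golden * cont w"
    using cont_Cons_Cons[of b w a] 3 golden_gt_1 by (auto simp: algebra_simps)
  moreover have "golden * cont (b # w) \<ge> golden ^ Suc (length w)" "golden * cont w \<ge> golden ^ length w"
    using 3 by auto
  moreover have "golden ^ length (a # b # w) = golden ^ Suc (length w) + golden ^ length w"
    using golden_rec[of "length w"] by simp
  ultimately show ?case by linarith
qed

lemma cont_ones_le: "cont (replicate n 1) \<le> golden ^ n"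
proof -
  have "cont (replicate n 1) \<le> golden ^ n \<and> cont (replicate (Suc n) 1) \<le> golden ^ Suc n"
  proof (induction n)
    case 0
    then show ?case using golden_gt_1 by simp
  next
    case (Suc n)
    have "cont (replicate (Suc (Suc n)) 1) = cont (replicate (Suc n) 1) + cont (replicate n 1)"
      using cont_Cons_Cons[of 1 "replicate n 1" 1] by simp
    then show ?case using Suc golden_rec[of n] by linarith
  qed
  then show ?thesis by simp
qed

lemma cont_Cons_ge: "0 \<notin> set w \<Longrightarrow> real a * cont w \<le> cont (a # w)"
  using cfmap_nonneg[of w 0] cont_ge_1[of w] by (simp add: cont_Cons cfmap_zero mult_right_mono)

text \<open>One copy of the digit is split off and only the rest is compared with \<tau>, so the
  factor \<open>c\<close> survives and makes the bound summable over the digit of the run. Of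
  \<open>golden\<^sup>2\<close>, one factor pays for the lost letter, the other comes from
  \<open>cont_ge_golden\<close>.\<close>

lemma cont_replicate_ge:
  assumes "c \<noteq> 0" "l \<ge> 1"
  shows "golden\<^sup>2 * cont (replicate l c) \<ge> real c * golden ^ l"
proof -
  obtain k where l: "l = Suc k" using assms by (cases l) auto
  have "golden * cont (replicate k c) \<ge> golden ^ k" using cont_ge_golden[of "replicate k c"] assms by auto
  then have "real c * golden ^ l \<le> real c * (golden * (golden * cont (replicate k c)))"
    unfolding l power_Suc by (intro mult_left_mono) (auto simp: less_imp_le)
  also have "\<dots> = golden\<^sup>2 * (real c * cont (replicate k c))" by (simp add: power2_eq_square)
  also have "\<dots> \<le> golden\<^sup>2 * cont (replicate l c)"
    unfolding l replicate_Suc using cont_Cons_ge[of "replicate k c" c] assms by (intro mult_left_mono) auto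
  finally show ?thesis .
qed

lemma cont_le_power:
  assumes "0 \<notin> set w" "\<forall>a\<in>set w. a \<le> B"
  shows "cont w \<le> (real B + 1) ^ length w"
  using assms
proof (induction w)
  case (Cons a w)
  have "real a + cf_value w \<le> real B + 1"
    using Cons.prems cfmap_range[of w 0] by (auto simp: cfmap_zero intro: add_mono)
  then show ?case using Cons cont_ge_1[of w] by (auto simp: cont_Cons intro: mult_mono)
qed auto

section \<open>Infinite expansions: convergence, uniqueness, irrationality, existence\<close>

definition pre :: "(nat \<Rightarrow> nat) \<Rightarrow> nat \<Rightarrow> nat list" where
  "pre b n = map b [0..<n]"

lemma length_pre [simp]: "length (pre b n) = n" by (simp add: pre_def)
lemma nth_pre [simp]: "i < n \<Longrightarrow> pre b n ! i = b i" by (simp add: pre_def)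
lemma pre_0 [simp]: "pre b 0 = []" by (simp add: pre_def)
lemma pre_Suc: "pre b (Suc n) = pre b n @ [b n]" by (simp add: pre_def)
lemma pre_add: "pre b (m + n) = pre b m @ pre (\<lambda>i. b (m + i)) n"
  by (rule nth_equalityI) (auto simp: nth_append)
lemma pre_Suc': "pre b (Suc n) = b 0 # pre (\<lambda>i. b (Suc i)) n"
  using pre_add[of b 1 n] by (simp add: pre_Suc)
text \<open>\<open>cf_expansion\<close> indexes digits from 1. The sequences \<open>b\<close> below
  are indexed from 0, so \<open>b i\<close> is the partial quotient a_(i+1).\<close>

lemma map_Suc_pre: "map a [1..<Suc n] = pre (\<lambda>i. a (Suc i)) n"
  by (rule nth_equalityI) (auto simp del: upt_Suc)

definition posseq :: "(nat \<Rightarrow> nat) \<Rightarrow> bool" where "posseq b \<longleftrightarrow> (\<forall>i. b i \<noteq> 0)"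

lemma posseq_pre: "posseq b \<Longrightarrow> 0 \<notin> set (pre b n)"
  unfolding posseq_def pre_def by (metis (no_types, lifting) imageE list.set_map)
lemma posseq_shift: "posseq b \<Longrightarrow> posseq (\<lambda>i. b (n + i))"
  by (auto simp: posseq_def)

lemma cf_denom_eq_cont: "(\<And>i. 1 \<le> i \<Longrightarrow> i \<le> n \<Longrightarrow> a i \<noteq> 0) \<Longrightarrow> real (cf_denom a n) = cont (map a [1..<Suc n])"
proof (induction n rule: induct_nat_012)
  case (ge2 n)
  have "map a [1..<Suc (Suc (Suc n))] = map a [1..<Suc n] @ [a (Suc n), a (Suc (Suc n))]" by simp
  moreover have "cont (map a [1..<Suc n] @ [a (Suc n), a (Suc (Suc n))]) =
    real (a (Suc (Suc n))) * cont (map a [1..<Suc n] @ [a (Suc n)]) + cont (map a [1..<Suc n])"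
    using ge2.prems by (intro cont_snoc_snoc) (auto simp: image_iff less_Suc_eq_le simp del: upt_Suc)
  ultimately show ?case using ge2 by simp
qed auto

definition cf_lim :: "(nat \<Rightarrow> nat) \<Rightarrow> real" where
  "cf_lim b = lim (\<lambda>n. cf_value (pre b n))"

lemma inv_cont_tendsto_0: "(\<lambda>n. golden\<^sup>2 / (golden^2) ^ n) \<longlonglongrightarrow> 0"
proof -
  have "(\<lambda>n. golden\<^sup>2 * (1 / golden^2) ^ n) \<longlonglongrightarrow> golden\<^sup>2 * 0"
    using golden_gt_1 by (intro tendsto_mult tendsto_const LIMSEQ_realpow_zero) auto
  then show ?thesis by (simp add: power_one_over divide_simps)
qed

text \<open>The left side bounds the diameter of the cylinder of \<open>w\<close>, the right side
  depends only on its length. This uniform decay gives convergence of expansions, fine covers and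
  small path cylinders.\<close>

lemma inv_cont_sq_le: "0 \<notin> set w \<Longrightarrow> 1 / (cont w)\<^sup>2 \<le> golden\<^sup>2 / (golden\<^sup>2) ^ length w"
proof -
  assume "0 \<notin> set w"
  from cont_ge_golden[OF this] have "(golden ^ length w)\<^sup>2 \<le> (golden * cont w)\<^sup>2"
    by (intro power_mono) (auto simp: less_imp_le)
  then have "(golden\<^sup>2) ^ length w \<le> golden\<^sup>2 * (cont w)\<^sup>2"
    by (metis power_mult_distrib power_mult mult.commute)
  moreover have "(golden\<^sup>2) ^ length w > 0" by (intro zero_less_power golden_pos)
  moreover have "(cont w)\<^sup>2 > 0" using cont_ge_1[OF \<open>0 \<notin> set w\<close>] by auto
  ultimately show ?thesis by (simp add: pos_le_divide_eq pos_divide_le_eq mult.commute)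
qed

lemma cf_value_range: "0 \<notin> set w \<Longrightarrow> 0 \<le> cf_value w \<and> cf_value w \<le> 1"
  using cfmap_range[of w 0] by (simp add: cfmap_zero)

lemma cf_value_pre_convergent:
  assumes "posseq b"
  shows "(\<lambda>n. cf_value (pre b n)) \<longlonglongrightarrow> cf_lim b"
proof -
  have "Cauchy (\<lambda>n. cf_value (pre b n))"
  proof (rule metric_CauchyI)
    fix e :: real assume "e > 0"
    then have "\<forall>\<^sub>F n in sequentially. golden\<^sup>2 / (golden^2) ^ n < e / 2"
      by (intro order_tendstoD(2)[OF inv_cont_tendsto_0] half_gt_zero)
    then obtain M where M: "golden\<^sup>2 / (golden^2) ^ M < e / 2"
      using eventually_happens'[OF sequentially_bot] by blast
    have *: "dist (cf_value (pre b n)) (cf_value (pre b M)) < e / 2" if le: "n \<ge> M" for n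
    proof -
      obtain k where k: "n = M + k" using le_Suc_ex[OF le] by blast
      have r: "0 \<le> cf_value (pre (\<lambda>i. b (M + i)) k)" "cf_value (pre (\<lambda>i. b (M + i)) k) \<le> 1"
        using cf_value_range[OF posseq_pre[OF posseq_shift[OF assms]]] by auto
      have "cf_value (pre b n) = cfmap (pre b M) (cf_value (pre (\<lambda>i. b (M + i)) k))"
        unfolding k pre_add cfmap_zero[symmetric] cfmap_append ..
      then have "dist (cf_value (pre b n)) (cf_value (pre b M)) \<le> 1 / (cont (pre b M))\<^sup>2"
        using cfmap_diff_le[OF posseq_pre[OF assms] r, where Y = 0] unfolding dist_real_def cfmap_zero by simp
      also have "\<dots> \<le> golden\<^sup>2 / (golden^2) ^ M"
        using inv_cont_sq_le[OF posseq_pre[OF assms], of M] unfolding length_pre .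
      finally show ?thesis using M by linarith
    qed
    show "\<exists>M. \<forall>m\<ge>M. \<forall>n\<ge>M. dist (cf_value (pre b m)) (cf_value (pre b n)) < e"
      using * by (intro exI[of _ M] allI impI, rule dist_triangle_half_l) blast+
  qed
  then show ?thesis unfolding cf_lim_def using Cauchy_convergent_iff convergent_LIMSEQ_iff by blast
qed

lemma cf_lim_eqI: "posseq b \<Longrightarrow> (\<lambda>n. cf_value (pre b n)) \<longlonglongrightarrow> x \<Longrightarrow> cf_lim b = x"
  using LIMSEQ_unique cf_value_pre_convergent by blast

lemma cf_lim_range_closed:
  assumes "posseq b" shows "0 \<le> cf_lim b" "cf_lim b \<le> 1"
  using cf_value_range[OF posseq_pre[OF assms]]
  by (auto intro: LIMSEQ_le_const[OF cf_value_pre_convergent[OF assms]]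
      LIMSEQ_le_const2[OF cf_value_pre_convergent[OF assms]])

lemma cf_lim_Suc:
  assumes "posseq b"
  shows "cf_lim b = 1 / (real (b 0) + cf_lim (\<lambda>i. b (Suc i)))"
proof (rule cf_lim_eqI[OF assms])
  have p: "posseq (\<lambda>i. b (Suc i))" using posseq_shift[OF assms, of 1] by simp
  have "b 0 \<noteq> 0" using assms by (auto simp: posseq_def)
  then have "real (b 0) + cf_lim (\<lambda>i. b (Suc i)) \<noteq> 0" using cf_lim_range_closed(1)[OF p] by linarith
  then have "(\<lambda>n. 1 / (real (b 0) + cf_value (pre (\<lambda>i. b (Suc i)) n))) \<longlonglongrightarrow> 1 / (real (b 0) + cf_lim (\<lambda>i. b (Suc i)))"
    by (intro tendsto_intros cf_value_pre_convergent[OF p])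
  then have "(\<lambda>n. cf_value (pre b (Suc n))) \<longlonglongrightarrow> 1 / (real (b 0) + cf_lim (\<lambda>i. b (Suc i)))"
    by (simp add: pre_Suc')
  then show "(\<lambda>n. cf_value (pre b n)) \<longlonglongrightarrow> 1 / (real (b 0) + cf_lim (\<lambda>i. b (Suc i)))"
    by (rule LIMSEQ_imp_Suc)
qed

lemma cf_lim_pos: assumes "posseq b" shows "0 < cf_lim b"
proof -
  have "posseq (\<lambda>i. b (Suc i))" using posseq_shift[OF assms, of 1] by simp
  moreover have "b 0 \<noteq> 0" using assms by (auto simp: posseq_def)
  ultimately have "real (b 0) + cf_lim (\<lambda>i. b (Suc i)) > 0" using cf_lim_range_closed(1) by (simp add: add_pos_nonneg)
  then show ?thesis using cf_lim_Suc[OF assms] by simp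
qed

lemma cf_lim_less_1: assumes "posseq b" shows "cf_lim b < 1"
proof -
  have "posseq (\<lambda>i. b (Suc i))" using posseq_shift[OF assms, of 1] by simp
  moreover have "real (b 0) \<ge> 1" using assms by (auto simp: posseq_def Suc_le_eq)
  ultimately have "real (b 0) + cf_lim (\<lambda>i. b (Suc i)) > 1" using cf_lim_pos by (metis add_less_le_mono add.commute add_0)
  then show ?thesis using cf_lim_Suc[OF assms] by simp
qed

lemma cf_lim_shift: "posseq b \<Longrightarrow> cf_lim b = cfmap (pre b n) (cf_lim (\<lambda>i. b (n + i)))"
proof (induction n arbitrary: b)
  case (Suc n)
  have p: "posseq (\<lambda>i. b (Suc i))" using posseq_shift[OF Suc.prems, of 1] by simp
  show ?case using Suc.IH[OF p] cf_lim_Suc[OF Suc.prems] by (simp add: pre_Suc')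
qed auto

lemma cf_lim_digit:
  assumes "posseq b"
  shows "b 0 = nat \<lfloor>1 / cf_lim b\<rfloor>" "cf_lim (\<lambda>i. b (Suc i)) = 1 / cf_lim b - real (b 0)"
proof -
  have p: "posseq (\<lambda>i. b (Suc i))" using posseq_shift[OF assms, of 1] by simp
  have e: "1 / cf_lim b = real (b 0) + cf_lim (\<lambda>i. b (Suc i))" using cf_lim_Suc[OF assms] by simp
  show "cf_lim (\<lambda>i. b (Suc i)) = 1 / cf_lim b - real (b 0)" using e by simp
  have "\<lfloor>1 / cf_lim b\<rfloor> = int (b 0)" unfolding e using cf_lim_pos[OF p] cf_lim_less_1[OF p] by linarith
  then show "b 0 = nat \<lfloor>1 / cf_lim b\<rfloor>" by simp
qed

lemma cf_lim_inj:
  assumes "posseq b" "posseq c" "cf_lim b = cf_lim c"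
  shows "b = c"
proof
  fix n show "b n = c n"
    using assms
  proof (induction n arbitrary: b c)
    case 0
    then show ?case using cf_lim_digit(1)[of b] cf_lim_digit(1)[of c] by simp
  next
    case (Suc n)
    have p: "posseq (\<lambda>i. b (Suc i))" "posseq (\<lambda>i. c (Suc i))"
      using posseq_shift[OF Suc.prems(1), of 1] posseq_shift[OF Suc.prems(2), of 1] by auto
    have "b 0 = c 0" using Suc.prems cf_lim_digit(1)[of b] cf_lim_digit(1)[of c] by simp
    then have "cf_lim (\<lambda>i. b (Suc i)) = cf_lim (\<lambda>i. c (Suc i))"
      using cf_lim_digit(2)[OF Suc.prems(1)] cf_lim_digit(2)[OF Suc.prems(2)] Suc.prems(3) by simp
    then show ?case using Suc.IH[OF p] by simp
  qed
qed

text \<open>Infinite descent, i.e. the Euclidean algorithm: if q x = p is an integer with x in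
  (0,1), then the shifted expansion 1/x - b_0 has the denominator p < q.\<close>

lemma cf_lim_irrational:
  assumes "posseq b" shows "cf_lim b \<notin> \<rat>"
proof
  assume "cf_lim b \<in> \<rat>"
  then obtain p q where "q \<noteq> 0" "\<bar>cf_lim b\<bar> = real p / real q" by (rule Rats_abs_nat_div_natE)
  then have "q > 0" "real q * cf_lim b \<in> \<int>" using cf_lim_pos[OF assms] by auto
  then show False using assms
  proof (induction q arbitrary: b rule: less_induct)
    case (less q)
    have s: "posseq (\<lambda>i. b (Suc i))" using posseq_shift[OF less.prems(3), of 1] by simp
    obtain p where p: "real q * cf_lim b = of_int p" using less.prems(2) by (auto elim: Ints_cases)
    have x: "0 < cf_lim b" "cf_lim b < 1" using cf_lim_pos cf_lim_less_1 less.prems(3) by auto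
    have "0 < real_of_int p" "real_of_int p < real q" using p x less.prems(1) by (auto simp flip: p)
    then have pp: "0 < p" "p < int q" by linarith+
    have "real (nat p) * cf_lim (\<lambda>i. b (Suc i)) = of_int p * (1 / cf_lim b - real (b 0))"
      using pp cf_lim_digit(2)[OF less.prems(3)] by simp
    also have "\<dots> = real q - of_int p * real (b 0)" using x by (simp add: right_diff_distrib flip: p)
    also have "\<dots> = of_int (int q - p * int (b 0))" by simp
    finally have "real (nat p) * cf_lim (\<lambda>i. b (Suc i)) \<in> \<int>" by (metis Ints_of_int)
    moreover have "nat p < q" "0 < nat p" using pp by linarith+
    ultimately show False using less.IH[of "nat p" "\<lambda>i. b (Suc i)"] s by blast
  qed
qed

definition gauss :: "real \<Rightarrow> real" where "gauss x = frac (1 / x)"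

lemma gauss_irrational: assumes "0 < x" "x < 1" "x \<notin> \<rat>"
  shows "0 < gauss x" "gauss x < 1" "gauss x \<notin> \<rat>" "nat \<lfloor>1 / x\<rfloor> \<noteq> 0" "x = 1 / (real (nat \<lfloor>1 / x\<rfloor>) + gauss x)"
proof -
  have 1: "1 / x > 1" using assms by simp
  then have "\<lfloor>1 / x\<rfloor> \<ge> 1" by linarith
  then show "nat \<lfloor>1 / x\<rfloor> \<noteq> 0" by simp
  have e: "gauss x = 1 / x - real (nat \<lfloor>1 / x\<rfloor>)"
    using of_nat_nat[of "\<lfloor>1 / x\<rfloor>"] \<open>\<lfloor>1 / x\<rfloor> \<ge> 1\<close> unfolding gauss_def frac_def by linarith
  then show "x = 1 / (real (nat \<lfloor>1 / x\<rfloor>) + gauss x)" using assms by simp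
  show r: "gauss x \<notin> \<rat>"
  proof
    assume "gauss x \<in> \<rat>"
    then have "1 / (real (nat \<lfloor>1 / x\<rfloor>) + gauss x) \<in> \<rat>" by (intro Rats_divide Rats_add) auto
    then show False using assms \<open>x = 1 / (real (nat \<lfloor>1 / x\<rfloor>) + gauss x)\<close> by simp
  qed
  have "gauss x \<noteq> 0" using r by auto
  then show "0 < gauss x" "gauss x < 1" using frac_ge_0[of "1/x"] frac_lt_1[of "1/x"] unfolding gauss_def by auto
qed

lemma cf_lim_exists:
  assumes "0 < x" "x < 1" "x \<notin> \<rat>"
  obtains b where "posseq b" "cf_lim b = x"
proof -
  define g where "g n = (gauss ^^ n) x" for n
  define b where "b n = nat \<lfloor>1 / g n\<rfloor>" for n
  have g: "0 < g n \<and> g n < 1 \<and> g n \<notin> \<rat>" for n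
    by (induction n) (use assms gauss_irrational in \<open>auto simp: g_def\<close>)
  have pb: "posseq b" unfolding posseq_def b_def using gauss_irrational(4) g by blast
  have x: "x = cfmap (pre b n) (g n)" for n
  proof (induction n)
    case (Suc n)
    have "g n = cfmap [b n] (g (Suc n))" using gauss_irrational(5)[of "g n"] g[of n] by (simp add: b_def g_def)
    then show ?case using Suc by (simp add: pre_Suc cfmap_append)
  qed (simp add: g_def)
  have "\<bar>cf_value (pre b n) - x\<bar> \<le> golden\<^sup>2 / (golden^2) ^ n" for n
  proof -
    have "\<bar>cf_value (pre b n) - x\<bar> \<le> 1 / (cont (pre b n))\<^sup>2"
      using cfmap_diff_le[OF posseq_pre[OF pb], of 0 "g n" n] g[of n] x[of n] by (simp add: cfmap_zero)
    also have "\<dots> \<le> golden\<^sup>2 / (golden^2) ^ n"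
      using inv_cont_sq_le[OF posseq_pre[OF pb], of n] unfolding length_pre .
    finally show ?thesis .
  qed
  then have "\<forall>\<^sub>F n in sequentially. norm (cf_value (pre b n) - x) \<le> golden\<^sup>2 / (golden^2) ^ n"
    unfolding real_norm_def by (rule always_eventually[OF allI])
  then have "(\<lambda>n. cf_value (pre b n) - x) \<longlonglongrightarrow> 0"
    by (rule Lim_null_comparison[OF _ inv_cont_tendsto_0])
  then have "cf_lim b = x" by (rule cf_lim_eqI[OF pb LIM_zero_cancel])
  then show ?thesis using that pb by blast
qed

lemma cf_expansion_iff:
  "cf_expansion a x \<longleftrightarrow> a 0 = 0 \<and> posseq (\<lambda>i. a (Suc i)) \<and> cf_lim (\<lambda>i. a (Suc i)) = x"
proof -
  have "(\<forall>n\<ge>1. a n \<ge> 1) \<longleftrightarrow> posseq (\<lambda>i. a (Suc i))"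
  proof (intro iffI allI impI)
    fix n :: nat assume "posseq (\<lambda>i. a (Suc i))" "1 \<le> n"
    then show "1 \<le> a n" by (cases n) (auto simp: posseq_def Suc_le_eq)
  next
    assume *: "\<forall>n\<ge>1. 1 \<le> a n"
    show "posseq (\<lambda>i. a (Suc i))" unfolding posseq_def
    proof
      fix i show "a (Suc i) \<noteq> 0" using *[rule_format, of "Suc i"] by simp
    qed
  qed
  then show ?thesis unfolding cf_expansion_def map_Suc_pre
    using cf_lim_eqI cf_value_pre_convergent by blast
qed

lemma cf_digit_cf_lim: assumes "posseq b" shows "cf_digit (cf_lim b) (Suc i) = b i"
proof -
  define a where "a n = (case n of 0 \<Rightarrow> 0 | Suc i \<Rightarrow> b i)" for n
  have b: "(\<lambda>i. a (Suc i)) = b" by (simp add: a_def)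
  have "cf_expansion a (cf_lim b)" unfolding cf_expansion_iff b using assms by (simp add: a_def)
  moreover have "a' = a" if "cf_expansion a' (cf_lim b)" for a'
  proof
    fix n
    have "(\<lambda>i. a' (Suc i)) = b" "a' 0 = 0" using that cf_lim_inj[OF _ assms] unfolding cf_expansion_iff by auto
    then show "a' n = a n" by (cases n) (auto simp: a_def fun_eq_iff)
  qed
  ultimately have "cf_digit (cf_lim b) = a" unfolding cf_digit_def by (rule the_equality)
  then show ?thesis by (simp add: a_def)
qed

section \<open>Hausdorff dimension\<close>

lemma hausdorff_premeasure_le:
  assumes "A \<subseteq> (\<Union>i. U i)" "\<And>i. bounded (U i)" "\<And>i. diameter (U i) \<le> \<delta>"
  shows "hausdorff_premeasure s \<delta> A \<le> (\<Sum>i. diam_pow s (U i))"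
  unfolding hausdorff_premeasure_def using assms by (intro INF_lower) auto

lemma hausdorff_dim_le:
  assumes "0 \<le> \<rho>" "\<And>s. s > \<rho> \<Longrightarrow> hausdorff_measure s A = 0"
  shows "hausdorff_dim A \<le> ereal \<rho>"
proof (rule ereal_le_epsilon2)
  fix e :: real assume "e > 0"
  then have "hausdorff_dim A \<le> ereal (\<rho> + e)"
    unfolding hausdorff_dim_def using assms by (intro Inf_lower imageI) auto
  then show "hausdorff_dim A \<le> ereal \<rho> + ereal e" by simp
qed

lemma hausdorff_dim_nonneg: "0 \<le> hausdorff_dim A"
  unfolding hausdorff_dim_def by (rule Inf_greatest) auto

lemma hausdorff_measure_eq_0I:
  assumes "\<And>\<delta> e. \<delta> > 0 \<Longrightarrow> e > 0 \<Longrightarrow> hausdorff_premeasure s \<delta> A \<le> ennreal e"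
  shows "hausdorff_measure s A = 0"
proof -
  have "hausdorff_premeasure s \<delta> A \<le> 0" if d: "\<delta> > 0" for \<delta>
  proof (rule ennreal_le_epsilon)
    fix e :: real assume "0 < e"
    then show "hausdorff_premeasure s \<delta> A \<le> 0 + ennreal e" using assms[OF d] by simp
  qed
  then have "hausdorff_measure s A \<le> 0" unfolding hausdorff_measure_def by (intro SUP_least) auto
  then show ?thesis by simp
qed

text \<open>Covers are indexed by a countable type so that words can serve as indices;
  \<open>to_nat\<close> embeds them into a sequence padded with empty sets, whose gauge is 0.
  Bounding finite partial sums in \<open>real\<close> avoids any question of summability.\<close>

lemma hausdorff_measure_eq_0_coverI:
  fixes I :: "'i::countable \<Rightarrow> 'a::metric_space set"
  assumes s: "s > 0"
    and cov: "\<And>\<delta> e. \<delta> > 0 \<Longrightarrow> e > 0 \<Longrightarrow> \<exists>X. A \<subseteq> (\<Union>w\<in>X. I w) \<and>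
      (\<forall>w\<in>X. bounded (I w) \<and> diameter (I w) \<le> \<delta>) \<and>
      (\<forall>S\<subseteq>X. finite S \<longrightarrow> (\<Sum>w\<in>S. diameter (I w) powr s) \<le> e)"
  shows "hausdorff_measure s A = 0"
proof (rule hausdorff_measure_eq_0I)
  fix \<delta> e :: real assume d: "\<delta> > 0" "e > 0"
  obtain X where X: "A \<subseteq> (\<Union>w\<in>X. I w)" "\<And>w. w \<in> X \<Longrightarrow> bounded (I w) \<and> diameter (I w) \<le> \<delta>"
    "\<And>S. S \<subseteq> X \<Longrightarrow> finite S \<Longrightarrow> (\<Sum>w\<in>S. diameter (I w) powr s) \<le> e"
    using cov[OF d] by blast
  define U where "U i = (if i \<in> to_nat ` X then I (from_nat i) else {})" for i
  have "hausdorff_premeasure s \<delta> A \<le> (\<Sum>i. diam_pow s (U i))"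
  proof (rule hausdorff_premeasure_le)
    show "A \<subseteq> (\<Union>i. U i)"
    proof
      fix x assume "x \<in> A"
      then obtain w where w: "w \<in> X" "x \<in> I w" using X(1) by blast
      then have "x \<in> U (to_nat w)" by (simp add: U_def)
      then show "x \<in> (\<Union>i. U i)" by blast
    qed
    show "bounded (U i)" "diameter (U i) \<le> \<delta>" for i
      using X(2) d by (auto simp: U_def)
  qed
  also have "\<dots> \<le> ennreal e"
  proof (rule suminf_le_const[OF summableI])
    fix n
    define S where "S = {w\<in>X. to_nat w < n}"
    have "finite (to_nat ` S)" by (rule finite_subset[of _ "{..<n}"]) (auto simp: S_def)
    then have fS: "finite S" using finite_imageD inj_on_subset[OF inj_to_nat] by blast
    have "(\<Sum>i<n. diam_pow s (U i)) = (\<Sum>i\<in>to_nat ` S. diam_pow s (U i))"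
      by (rule sum.mono_neutral_right) (auto simp: S_def U_def diam_pow_def image_iff)
    also have "\<dots> = (\<Sum>w\<in>S. diam_pow s (I w))"
      by (subst sum.reindex) (auto simp: U_def S_def intro!: inj_on_subset[OF inj_to_nat] sum.cong)
    also have "\<dots> \<le> (\<Sum>w\<in>S. ennreal (diameter (I w) powr s))"
      using s by (intro sum_mono) (auto simp: diam_pow_def)
    also have "\<dots> = ennreal (\<Sum>w\<in>S. diameter (I w) powr s)" by (rule sum_ennreal) auto
    also have "\<dots> \<le> ennreal e" using X(3)[of S] fS by (intro ennreal_leI) (auto simp: S_def)
    finally show "(\<Sum>i<n. diam_pow s (U i)) \<le> ennreal e" .
  qed
  finally show "hausdorff_premeasure s \<delta> A \<le> ennreal e" .
qed

lemma hausdorff_dim_countable: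
  assumes "countable A" shows "hausdorff_dim A = 0"
proof -
  have "hausdorff_measure s A = 0" if s: "s > 0" for s
  proof (rule hausdorff_measure_eq_0_coverI[where I = "\<lambda>i. {from_nat_into A i}"])
    fix \<delta> e :: real assume "\<delta> > 0" "e > 0"
    then show "\<exists>X. A \<subseteq> (\<Union>i\<in>X. {from_nat_into A i}) \<and>
      (\<forall>w\<in>X. bounded {from_nat_into A w} \<and> diameter {from_nat_into A w} \<le> \<delta>) \<and>
      (\<forall>S\<subseteq>X. finite S \<longrightarrow> (\<Sum>w\<in>S. diameter {from_nat_into A w} powr s) \<le> e)"
      using subset_range_from_nat_into[OF assms] by (intro exI[of _ UNIV]) auto
  qed (rule s)
  then have "hausdorff_dim A \<le> ereal 0" by (intro hausdorff_dim_le) auto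
  then show ?thesis using hausdorff_dim_nonneg[of A] by (simp add: zero_ereal_def)
qed

text \<open>For sets of diameter at most 1 the gauge decreases in the exponent, so a lower bound at
  \<open>\<rho>\<close> passes to every smaller \<open>s\<close>. Scale 1 suffices because the
  measure is the supremum over all scales.\<close>

lemma hausdorff_dim_ge:
  assumes "\<rho> \<ge> 0" "c > 0"
    and "\<And>U. A \<subseteq> (\<Union>i. U i) \<Longrightarrow> (\<And>i. bounded (U i) \<and> diameter (U i) \<le> 1) \<Longrightarrow> c \<le> (\<Sum>i. diam_pow \<rho> (U i))"
  shows "ereal \<rho> \<le> hausdorff_dim A"
  unfolding hausdorff_dim_def
proof (rule Inf_greatest, safe)
  fix s :: real assume s: "0 \<le> s" "hausdorff_measure s A = 0"
  show "ereal \<rho> \<le> ereal s"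
  proof (rule ccontr)
    assume "\<not> ereal \<rho> \<le> ereal s"
    then have l: "s < \<rho>" by simp
    have "diam_pow \<rho> U \<le> diam_pow s U" if U: "bounded U" "diameter U \<le> 1" for U :: "'a set"
    proof -
      have d: "0 \<le> diameter U" using diameter_ge_0[OF U(1)] .
      have "diameter U powr \<rho> \<le> diameter U powr s"
        using powr_mono'[of s \<rho> "diameter U"] d U l by auto
      moreover have "diameter U powr \<rho> \<le> 1" using U d l s by (intro powr_le1) auto
      ultimately show ?thesis using l s by (auto simp: diam_pow_def intro!: ennreal_leI)
    qed
    then have "(\<Sum>i. diam_pow \<rho> (U i)) \<le> (\<Sum>i. diam_pow s (U i))"
      if "\<And>i. bounded (U i) \<and> diameter (U i) \<le> 1" for U :: "nat \<Rightarrow> 'a set"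
      using that by (intro suminf_le summableI) auto
    then have le: "(\<Sum>i. diam_pow \<rho> (U i)) \<le> (\<Sum>i. diam_pow s (U i))"
      if "\<forall>i. bounded (U i) \<and> diameter (U i) \<le> 1" for U :: "nat \<Rightarrow> 'a set"
      using that by blast
    have "c \<le> hausdorff_premeasure s 1 A"
      unfolding hausdorff_premeasure_def
    proof (rule INF_greatest, safe)
      fix U :: "nat \<Rightarrow> 'a set" assume U: "A \<subseteq> (\<Union>i. U i)" "\<forall>i. bounded (U i) \<and> diameter (U i) \<le> 1"
      have "c \<le> (\<Sum>i. diam_pow \<rho> (U i))" using assms(3)[OF U(1)] U(2) by blast
      then show "c \<le> (\<Sum>i. diam_pow s (U i))" using le[OF U(2)] by (rule order_trans)
    qed
    also have "\<dots> \<le> hausdorff_measure s A" unfolding hausdorff_measure_def by (rule SUP_upper) auto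
    finally show False using s assms(2) by simp
  qed
qed

lemma hausdorff_dim_unit_interval_le:
  assumes "A \<subseteq> {0..1::real}" shows "hausdorff_dim A \<le> 1"
proof -
  define J where "J = (\<lambda>(n::nat, k::nat). {real k / real n .. (real k + 1) / real n})"
  have "hausdorff_measure s A = 0" if s: "s > 1" for s
  proof (rule hausdorff_measure_eq_0_coverI[where I = J])
    fix \<delta> e :: real assume d: "\<delta> > 0" "e > 0"
    have t1: "(\<lambda>n. inverse (real n)) \<longlonglongrightarrow> 0" by (rule lim_inverse_n)
    have t2: "(\<lambda>n. real n powr (1 - s)) \<longlonglongrightarrow> 0"
      using s by (intro tendsto_neg_powr filterlim_real_sequentially) auto
    have "\<forall>\<^sub>F n in sequentially. inverse (real n) < \<delta> \<and> real n powr (1 - s) < e / 2 \<and> n > 0"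
      using d by (intro eventually_conj eventually_gt_at_top order_tendstoD(2)[OF t1] order_tendstoD(2)[OF t2]) auto
    then obtain n where n: "inverse (real n) < \<delta>" "real n powr (1 - s) < e / 2" "n > 0"
      using eventually_happens'[OF sequentially_bot] by blast
    define X where "X = {n} \<times> {..n}"
    have dm: "diameter (J w) = inverse (real n)" if "w \<in> X" for w
      using that n by (auto simp: X_def J_def diameter_closed_interval divide_simps)
    have bd: "bounded (J w)" for w by (cases w) (auto simp: J_def)
    have "A \<subseteq> (\<Union>w\<in>X. J w)"
    proof
      fix x assume "x \<in> A"
      then have x: "0 \<le> x" "x \<le> 1" using assms by auto
      define k where "k = nat \<lfloor>x * real n\<rfloor>"
      have k: "real k = of_int \<lfloor>x * real n\<rfloor>" using x by (simp add: k_def)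
      have "x * real n \<le> real n" using x mult_right_mono[of x 1 "real n"] by simp
      then have kn: "real k \<le> x * real n" "x * real n \<le> real k + 1" "real k \<le> real n" unfolding k by linarith+
      then show "x \<in> (\<Union>w\<in>X. J w)" using n(3)
        by (intro UN_I[of "(n, k)"]) (auto simp: X_def J_def pos_divide_le_eq pos_le_divide_eq)
    qed
    moreover have "(\<Sum>w\<in>S. diameter (J w) powr s) \<le> e" if "S \<subseteq> X" for S
    proof -
      have "(\<Sum>w\<in>S. diameter (J w) powr s) = (\<Sum>w\<in>S. inverse (real n) powr s)"
        using that dm by (intro sum.cong) auto
      also have "\<dots> \<le> (\<Sum>w\<in>X. inverse (real n) powr s)"
        using that by (intro sum_mono2) (auto simp: X_def)
      also have "\<dots> = (real n + 1) * inverse (real n) powr s" using n by (simp add: X_def)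
      also have "\<dots> \<le> 2 * real n * inverse (real n) powr s" using n by (intro mult_right_mono) auto
      also have "\<dots> = 2 * real n powr (1 - s)"
      proof -
        have "inverse (real n) powr s = real n powr (- s)" using n by (simp add: powr_minus inverse_powr)
        then show ?thesis using n by (simp add: powr_diff powr_minus field_simps)
      qed
      finally show ?thesis using n by linarith
    qed
    ultimately show "\<exists>X. A \<subseteq> (\<Union>w\<in>X. J w) \<and> (\<forall>w\<in>X. bounded (J w) \<and> diameter (J w) \<le> \<delta>) \<and>
      (\<forall>S\<subseteq>X. finite S \<longrightarrow> (\<Sum>w\<in>S. diameter (J w) powr s) \<le> e)"
      using bd dm n(1) by (intro exI[of _ X]) auto
  qed (use s in auto)
  then have "hausdorff_dim A \<le> ereal 1" by (intro hausdorff_dim_le) auto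
  then show ?thesis by (simp add: one_ereal_def)
qed

section \<open>Words containing long runs\<close>

lemma golden_nonzero [simp]: "golden \<noteq> 0" and golden_nonneg [simp]: "0 \<le> golden"
  using golden_pos by linarith+

definition words :: "nat \<Rightarrow> nat list set" where
  "words n = {w. length w = n \<and> 0 \<notin> set w}"

definition wsum :: "real \<Rightarrow> nat list set \<Rightarrow> real" where
  "wsum \<rho> S = (\<Sum>w\<in>S. cont w powr (- 2 * \<rho>))"

text \<open>The blocks need not be maximal and may use different digits. The rightmost block is the
  outermost constructor, because both the counting and the search for runs proceed by stripping the
  last block and passing to the prefix before it.\<close>

inductive runs :: "nat \<Rightarrow> nat \<Rightarrow> nat list \<Rightarrow> bool" where
  runs_0: "runs 0 0 w"
| runs_Suc: "runs K L u \<Longrightarrow> l \<ge> 1 \<Longrightarrow> runs (Suc K) (L + l) (u @ replicate l c @ v)"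

lemma runs_length: "runs K L w \<Longrightarrow> L \<le> length w"
  by (induction rule: runs.induct) auto

lemma sum_le_prod_sums:
  fixes h :: "'a \<Rightarrow> real"
  assumes "finite S" "inj_on (\<lambda>w. (f w, g w)) S"
    "\<And>w. w \<in> S \<Longrightarrow> h w \<le> a (f w) * b (g w)" "\<And>x. a x \<ge> 0" "\<And>x. b x \<ge> 0"
  shows "sum h S \<le> sum a (f ` S) * sum b (g ` S)"
proof -
  have "sum h S \<le> (\<Sum>w\<in>S. a (f w) * b (g w))" using assms by (intro sum_mono) auto
  also have "\<dots> = (\<Sum>(x, y)\<in>(\<lambda>w. (f w, g w)) ` S. a x * b y)"
    by (subst sum.reindex[OF assms(2)]) auto
  also have "\<dots> \<le> (\<Sum>(x, y)\<in>f ` S \<times> g ` S. a x * b y)"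
    using assms by (intro sum_mono2) auto
  also have "\<dots> = sum a (f ` S) * sum b (g ` S)"
    by (simp add: sum_product sum.cartesian_product)
  finally show ?thesis .
qed

lemma wsum_mono: "finite T \<Longrightarrow> S \<subseteq> T \<Longrightarrow> wsum \<rho> S \<le> wsum \<rho> T"
  unfolding wsum_def by (rule sum_mono2) auto

lemma wsum_nonneg: "0 \<le> wsum \<rho> S"
  unfolding wsum_def by (rule sum_nonneg) auto

lemma cont_append_powr:
  assumes "0 \<notin> set u" "0 \<notin> set v" "0 \<le> \<rho>"
  shows "cont (u @ v) powr (- 2 * \<rho>) \<le> cont u powr (- 2 * \<rho>) * cont v powr (- 2 * \<rho>)"
proof -
  have p: "0 < cont u" "0 < cont v" using cont_ge_1[OF assms(1)] cont_ge_1[OF assms(2)] by auto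
  have "cont (u @ v) powr (- 2 * \<rho>) \<le> (cont u * cont v) powr (- 2 * \<rho>)"
    using cont_append_bounds(1)[OF assms(1,2)] p assms(3) by (intro powr_mono2') auto
  then show ?thesis using p by (simp add: powr_mult)
qed

lemma take_words: "w \<in> words n \<Longrightarrow> m \<le> n \<Longrightarrow> take m w \<in> words m"
  by (auto simp: words_def dest: in_set_takeD)
lemma drop_words: "w \<in> words n \<Longrightarrow> drop m w \<in> words (n - m)"
  by (auto simp: words_def dest: in_set_dropD)

lemma wsum_split:
  assumes "finite S" "S \<subseteq> words n" "m \<le> n" "0 \<le> \<rho>"
  shows "wsum \<rho> S \<le> wsum \<rho> (take m ` S) * wsum \<rho> (drop m ` S)"
  unfolding wsum_def
proof (rule sum_le_prod_sums[OF assms(1)])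
  show "inj_on (\<lambda>w. (take m w, drop m w)) S"
    by (rule inj_onI) (metis append_take_drop_id prod.inject)
  fix w assume "w \<in> S"
  then have "0 \<notin> set (take m w)" "0 \<notin> set (drop m w)"
    using assms(2) by (auto simp: words_def dest: in_set_takeD in_set_dropD)
  from cont_append_powr[OF this assms(4)]
  show "cont w powr (- 2 * \<rho>) \<le> cont (take m w) powr (- 2 * \<rho>) * cont (drop m w) powr (- 2 * \<rho>)" by simp
qed auto

lemma sum_powr_bounded:
  fixes \<rho> :: real
  assumes "\<rho> > 1 / 2"
  obtains Z where "Z \<ge> 1" "\<And>S :: nat set. finite S \<Longrightarrow> (\<Sum>c\<in>S. real c powr (- 2 * \<rho>)) \<le> Z"
proof -
  have s: "summable (\<lambda>n. real n powr (- 2 * \<rho>))" using assms by (subst summable_real_powr_iff) auto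
  have "(\<Sum>c\<in>S. real c powr (- 2 * \<rho>)) \<le> max 1 (\<Sum>n. real n powr (- 2 * \<rho>))" if "finite S" for S :: "nat set"
    using sum_le_suminf[OF s that] by auto
  then show ?thesis using that[of "max 1 (\<Sum>n. real n powr (- 2 * \<rho>))"] by auto
qed

lemma words_1: "w \<in> words 1 \<Longrightarrow> w = [hd w] \<and> hd w \<noteq> 0"
  by (cases w) (auto simp: words_def)

lemma wsum_letters:
  assumes \<rho>: "\<rho> > 1 / 2"
  obtains Z where "Z \<ge> 1" "\<And>S. finite S \<Longrightarrow> S \<subseteq> words 1 \<Longrightarrow> wsum \<rho> S \<le> Z"
proof -
  obtain Z where Z: "Z \<ge> 1" "\<And>S :: nat set. finite S \<Longrightarrow> (\<Sum>c\<in>S. real c powr (- 2 * \<rho>)) \<le> Z"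
    using sum_powr_bounded[OF \<rho>] by blast
  have one: "wsum \<rho> S \<le> Z" if S: "finite S" "S \<subseteq> words 1" for S
  proof -
    have "wsum \<rho> S = (\<Sum>w\<in>S. real (hd w) powr (- 2 * \<rho>))"
      unfolding wsum_def using words_1 S(2) by (intro sum.cong refl) (metis cont_single subsetD)
    also have "\<dots> = (\<Sum>c\<in>hd ` S. real c powr (- 2 * \<rho>))"
      by (subst sum.reindex) (auto intro!: inj_onI, metis words_1 S(2) subsetD)
    finally show ?thesis using Z(2)[of "hd ` S"] S by simp
  qed
  then show ?thesis using that[OF Z(1)] by blast
qed

text \<open>Cutting a block of length n off the front costs a factor of at most
  \<open>\<theta> ^ n\<close> each time. The rest of length below n costs at most the constant
  \<open>Z ^ n\<close>; this is why a single n decides the growth rate.\<close>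

lemma wsum_growth:
  assumes \<rho>: "\<rho> > 1 / 2" and n: "n \<ge> 1" and \<theta>: "\<theta> \<ge> 1"
    and H: "\<And>S. finite S \<Longrightarrow> S \<subseteq> words n \<Longrightarrow> wsum \<rho> S \<le> \<theta> ^ n"
  obtains D where "D \<ge> 1" "\<And>m S. finite S \<Longrightarrow> S \<subseteq> words m \<Longrightarrow> wsum \<rho> S \<le> D * \<theta> ^ m"
proof -
  obtain Z where Z: "Z \<ge> 1" and one: "\<And>S. finite S \<Longrightarrow> S \<subseteq> words 1 \<Longrightarrow> wsum \<rho> S \<le> Z"
    using wsum_letters[OF \<rho>] by blast
  have pw: "wsum \<rho> S \<le> Z ^ m" if "finite S" "S \<subseteq> words m" for m S
    using that
  proof (induction m arbitrary: S)
    case 0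
    then have "S \<subseteq> {[]}" by (auto simp: words_def)
    then have "wsum \<rho> S \<le> wsum \<rho> {[]}" by (intro wsum_mono) auto
    then show ?case by (simp add: wsum_def)
  next
    case (Suc m)
    have "take 1 ` S \<subseteq> words 1" "drop 1 ` S \<subseteq> words m"
      using Suc.prems(2) take_words[of _ "Suc m" 1] drop_words[of _ "Suc m" 1] by auto
    then have "wsum \<rho> (take 1 ` S) \<le> Z" "wsum \<rho> (drop 1 ` S) \<le> Z ^ m"
      using one Suc by auto
    then have "wsum \<rho> (take 1 ` S) * wsum \<rho> (drop 1 ` S) \<le> Z * Z ^ m"
      using Z wsum_nonneg by (intro mult_mono) auto
    then show ?case using wsum_split[OF Suc.prems, of 1 \<rho>] \<rho> by simp
  qed
  have "wsum \<rho> S \<le> Z ^ n * \<theta> ^ m" if "finite S" "S \<subseteq> words m" for m S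
    using that
  proof (induction m arbitrary: S rule: less_induct)
    case (less m)
    show ?case
    proof (cases "m < n")
      case True
      have "wsum \<rho> S \<le> Z ^ m" using pw less.prems by blast
      also have "\<dots> \<le> Z ^ n" using Z True by (intro power_increasing) auto
      also have "\<dots> \<le> Z ^ n * \<theta> ^ m" using Z \<theta> by (simp add: mult_le_cancel_left1)
      finally show ?thesis .
    next
      case False
      then have "take n ` S \<subseteq> words n" "drop n ` S \<subseteq> words (m - n)"
        using less.prems(2) take_words drop_words by (auto simp: subset_iff)
      then have "wsum \<rho> (take n ` S) \<le> \<theta> ^ n" "wsum \<rho> (drop n ` S) \<le> Z ^ n * \<theta> ^ (m - n)"
        using H less.IH[of "m - n"] less.prems(1) n False by auto
      then have "wsum \<rho> (take n ` S) * wsum \<rho> (drop n ` S) \<le> \<theta> ^ n * (Z ^ n * \<theta> ^ (m - n))"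
        using \<theta> wsum_nonneg by (intro mult_mono) auto
      also have "\<dots> = Z ^ n * (\<theta> ^ n * \<theta> ^ (m - n))" by (simp only: mult_ac)
      also have "\<theta> ^ n * \<theta> ^ (m - n) = \<theta> ^ m" using False by (simp flip: power_add)
      finally show ?thesis using wsum_split[OF less.prems, of n \<rho>] \<rho> False by simp
    qed
  qed
  then show ?thesis using that[of "Z ^ n"] Z by auto
qed

text \<open>Here \<rho> > 1/2 pays off: summing over the digit of a run costs only a constant, from
  the convergent series of c^(-2\<rho>), so arbitrary runs decay like runs of ones.\<close>

lemma run_sum_le:
  assumes "\<rho> > 1 / 2"
  obtains Z where "Z \<ge> 1" "\<And>S l. finite S \<Longrightarrow> 0 \<notin> S \<Longrightarrow> l \<ge> 1 \<Longrightarrow>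
    (\<Sum>c\<in>S. cont (replicate l c) powr (- 2 * \<rho>)) \<le> Z * golden powr (- 2 * \<rho> * real l)"
proof -
  obtain Z where Z: "Z \<ge> 1" "\<And>S :: nat set. finite S \<Longrightarrow> (\<Sum>c\<in>S. real c powr (- 2 * \<rho>)) \<le> Z"
    using sum_powr_bounded[OF assms] by blast
  define G where "G = (golden powr -2) powr (- 2 * \<rho>)"
  have G: "G = golden powr (4 * \<rho>)" by (simp add: G_def powr_powr)
  have "(\<Sum>c\<in>S. cont (replicate l c) powr (- 2 * \<rho>)) \<le> G * Z * golden powr (- 2 * \<rho> * real l)"
    if S: "finite S" "0 \<notin> S" "l \<ge> 1" for S l
  proof -
    have "cont (replicate l c) powr (- 2 * \<rho>) \<le> real c powr (- 2 * \<rho>) * (G * golden powr (- 2 * \<rho> * real l))"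
      if c: "c \<in> S" for c
    proof -
      have c0: "c > 0" using c S by (cases c) auto
      have "golden\<^sup>2 * cont (replicate l c) \<ge> real c * golden ^ l"
        using cont_replicate_ge[of c l] c0 S by auto
      then have "real c * (golden powr real l * golden powr -2) \<le> cont (replicate l c)"
        by (simp add: powr_realpow powr_minus powr_numeral divide_inverse[symmetric] pos_divide_le_eq mult.commute)
      then have "cont (replicate l c) powr (- 2 * \<rho>) \<le> (real c * (golden powr real l * golden powr -2)) powr (- 2 * \<rho>)"
        using assms c0 by (intro powr_mono2') auto
      also have "\<dots> = real c powr (- 2 * \<rho>) * ((golden powr real l) powr (- 2 * \<rho>) * G)"
        using c0 by (simp add: powr_mult G_def)
      also have "(golden powr real l) powr (- 2 * \<rho>) = golden powr (- 2 * \<rho> * real l)"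
        by (simp add: powr_powr mult.commute mult.left_commute)
      finally show ?thesis by (simp only: mult_ac)
    qed
    then have "(\<Sum>c\<in>S. cont (replicate l c) powr (- 2 * \<rho>)) \<le> (\<Sum>c\<in>S. real c powr (- 2 * \<rho>) * (G * golden powr (- 2 * \<rho> * real l)))"
      by (rule sum_mono)
    also have "\<dots> = (\<Sum>c\<in>S. real c powr (- 2 * \<rho>)) * (G * golden powr (- 2 * \<rho> * real l))"
      by (rule sum_distrib_right[symmetric])
    also have "\<dots> \<le> Z * (G * golden powr (- 2 * \<rho> * real l))"
      using Z(2)[OF S(1)] by (intro mult_right_mono) (auto simp: G)
    finally show ?thesis by (simp only: mult_ac)
  qed
  moreover have "G \<ge> 1" unfolding G using assms golden_gt_1 by (intro ge_one_powr_ge_zero) auto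
  then have "G * Z \<ge> 1" using Z by (smt (verit) mult_left_le mult_le_cancel_left1 mult.commute)
  ultimately show ?thesis using that[of "G * Z"] by blast
qed

lemma runs_SucE:
  assumes "runs (Suc K) L w"
  obtains p l where "1 \<le> l" "l \<le> L" "p + l \<le> length w" "runs K (L - l) (take p w)"
    "w = take p w @ replicate l (w ! p) @ drop (p + l) w"
  using assms
proof (cases rule: runs.cases)
  case (runs_Suc L' u l c v)
  then show ?thesis using that[of l "length u"] by (auto simp: nth_append)
qed

text \<open>Each stripped block contributes the decay of \<open>run_sum_le\<close>, the free pieces
  contribute growth \<theta>, and position and length of a block can be chosen in at most (n+1)^2
  ways, whence the exponent 2K. The exponent of \<theta> is a real difference to avoid truncated
  subtraction.\<close>

lemma runs_wsum_le:
  assumes \<rho>: "\<rho> > 1 / 2" and \<theta>: "\<theta> \<ge> 1" and D: "D \<ge> 1"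
    and H: "\<And>m S. finite S \<Longrightarrow> S \<subseteq> words m \<Longrightarrow> wsum \<rho> S \<le> D * \<theta> ^ m"
  shows "\<exists>C\<ge>1. \<forall>n L S. finite S \<longrightarrow> S \<subseteq> words n \<longrightarrow> (\<forall>w\<in>S. runs K L w) \<longrightarrow>
    wsum \<rho> S \<le> C * (real n + 1) ^ (2 * K) * (\<theta> powr (real n - real L) * golden powr (- 2 * \<rho> * real L))"
proof (induction K)
  case 0
  have z: "wsum \<rho> S \<le> D * (real n + 1) ^ (2 * 0) * (\<theta> powr (real n - real L) * golden powr (- 2 * \<rho> * real L))"
    if S: "finite S" "S \<subseteq> words n" "\<forall>w\<in>S. runs 0 L w" for n L S
  proof (cases "S = {}")
    case True
    then show ?thesis using D by (simp add: wsum_def)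
  next
    case False
    then have "L = 0" using S(3) by (auto elim: runs.cases)
    then show ?thesis using H[OF S(1,2)] \<theta> by (simp add: powr_realpow)
  qed
  show ?case by (intro exI[of _ D] conjI allI impI, rule D, rule z)
next
  case (Suc K)
  from Suc.IH obtain C where C: "C \<ge> 1" "\<And>n L S. finite S \<Longrightarrow> S \<subseteq> words n \<Longrightarrow> (\<And>w. w \<in> S \<Longrightarrow> runs K L w) \<Longrightarrow>
    wsum \<rho> S \<le> C * (real n + 1) ^ (2 * K) * (\<theta> powr (real n - real L) * golden powr (- 2 * \<rho> * real L))"
    by (elim exE conjE) metis
  obtain Z where Z: "Z \<ge> 1" "\<And>S l. finite S \<Longrightarrow> 0 \<notin> S \<Longrightarrow> l \<ge> 1 \<Longrightarrow>
    (\<Sum>c\<in>S. cont (replicate l c) powr (- 2 * \<rho>)) \<le> Z * golden powr (- 2 * \<rho> * real l)"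
    using run_sum_le[OF \<rho>] by metis
  have z: "wsum \<rho> S \<le> (C * Z * D) * (real n + 1) ^ (2 * Suc K) * (\<theta> powr (real n - real L) * golden powr (- 2 * \<rho> * real L))"
    if S: "finite S" "S \<subseteq> words n" "\<forall>w\<in>S. runs (Suc K) L w" for n L S
  proof -
    define B where "B = C * Z * D * (real n + 1) ^ (2 * K) * (\<theta> powr (real n - real L) * golden powr (- 2 * \<rho> * real L))"
    have "\<forall>w\<in>S. \<exists>pl. 1 \<le> snd pl \<and> snd pl \<le> L \<and> fst pl + snd pl \<le> n \<and> runs K (L - snd pl) (take (fst pl) w) \<and>
      w = take (fst pl) w @ replicate (snd pl) (w ! fst pl) @ drop (fst pl + snd pl) w"
    proof
      fix w assume w: "w \<in> S"
      then have "length w = n" using S(2) by (auto simp: words_def)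
      moreover obtain p l where "1 \<le> l" "l \<le> L" "p + l \<le> length w" "runs K (L - l) (take p w)"
        "w = take p w @ replicate l (w ! p) @ drop (p + l) w" using S(3) w runs_SucE by blast
      ultimately show "\<exists>pl. 1 \<le> snd pl \<and> snd pl \<le> L \<and> fst pl + snd pl \<le> n \<and> runs K (L - snd pl) (take (fst pl) w) \<and>
        w = take (fst pl) w @ replicate (snd pl) (w ! fst pl) @ drop (fst pl + snd pl) w"
        by (intro exI[of _ "(p, l)"]) simp
    qed
    then obtain g where g: "\<And>w. w \<in> S \<Longrightarrow> 1 \<le> snd (g w) \<and> snd (g w) \<le> L \<and> fst (g w) + snd (g w) \<le> n \<and>
      runs K (L - snd (g w)) (take (fst (g w)) w) \<and>
      w = take (fst (g w)) w @ replicate (snd (g w)) (w ! fst (g w)) @ drop (fst (g w) + snd (g w)) w"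
      by metis
    define P where "P = {..n} \<times> {..n}"
    have gP: "g ` S \<subseteq> P"
    proof
      fix y assume "y \<in> g ` S"
      then obtain w where w: "w \<in> S" "y = g w" by blast
      have "fst (g w) + snd (g w) \<le> n" using g[OF w(1)] by (elim conjE)
      then show "y \<in> P" unfolding P_def w(2) by (simp add: mem_Times_iff)
    qed
    have block: "wsum \<rho> {w\<in>S. g w = pl} \<le> B" for pl
    proof (cases "{w\<in>S. g w = pl} = {}")
      case True
      have "0 \<le> B" using C(1) Z(1) D by (simp add: B_def)
      then show ?thesis unfolding True wsum_def by (simp only: sum.empty)
    next
      case False
      define p l where "p = fst pl" and "l = snd pl"
      define T where "T = {w\<in>S. g w = pl}"
      have T: "finite T" "T \<subseteq> words n" using S by (auto simp: T_def)
      have gT: "1 \<le> l \<and> l \<le> L \<and> p + l \<le> n \<and> runs K (L - l) (take p w) \<and>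
        w = take p w @ replicate l (w ! p) @ drop (p + l) w" if "w \<in> T" for w
      proof -
        have "w \<in> S" "g w = pl" using that by (auto simp: T_def)
        then show ?thesis using g[of w] unfolding p_def l_def by (simp only:)
      qed
      obtain w0 where "w0 \<in> T" using False by (auto simp: T_def)
      then have l: "1 \<le> l" "l \<le> L" "p + l \<le> n" using gT[of w0] by blast+
      have pos: "0 \<notin> set (take p w)" "w ! p \<noteq> 0" "0 \<notin> set (drop (p + l) w)" if "w \<in> T" for w
        using that T l
      proof -
        have w: "length w = n" "0 \<notin> set w" using that T(2) by (auto simp: words_def)
        then show "0 \<notin> set (take p w)" "0 \<notin> set (drop (p + l) w)" by (auto dest: in_set_takeD in_set_dropD)
        have "p < length w" using l w by linarith
        then show "w ! p \<noteq> 0" using w(2) nth_mem by metis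
      qed
      \<comment> \<open>With position p and length l fixed, a word is determined by its prefix, the
        digit at p and the tail after the block, so the sum is at most a product of three
        sums.\<close>
      have "wsum \<rho> T \<le> (\<Sum>u\<in>take p ` T. cont u powr (- 2 * \<rho>)) *
        (\<Sum>(c, v)\<in>(\<lambda>w. (w ! p, drop (p + l) w)) ` T. cont (replicate l c) powr (- 2 * \<rho>) * cont v powr (- 2 * \<rho>))"
        unfolding wsum_def
      proof (rule sum_le_prod_sums[OF T(1)])
        show "inj_on (\<lambda>w. (take p w, w ! p, drop (p + l) w)) T"
          by (rule inj_onI) (metis gT prod.inject)
        fix w assume w: "w \<in> T"
        have z: "0 \<notin> set (replicate l (w ! p))" using pos[OF w] by auto
        have "cont w powr (- 2 * \<rho>) = cont (take p w @ replicate l (w ! p) @ drop (p + l) w) powr (- 2 * \<rho>)"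
          by (rule arg_cong[where f = "\<lambda>w. cont w powr (- 2 * \<rho>)"]) (use gT[OF w] in blast)
        also have "\<dots> \<le> cont (take p w) powr (- 2 * \<rho>) * cont (replicate l (w ! p) @ drop (p + l) w) powr (- 2 * \<rho>)"
          using pos[OF w] z \<rho> by (intro cont_append_powr) auto
        also have "\<dots> \<le> cont (take p w) powr (- 2 * \<rho>) * (cont (replicate l (w ! p)) powr (- 2 * \<rho>) * cont (drop (p + l) w) powr (- 2 * \<rho>))"
          using pos[OF w] z \<rho> by (intro mult_left_mono cont_append_powr) auto
        finally show "cont w powr (- 2 * \<rho>) \<le> cont (take p w) powr (- 2 * \<rho>) *
          (case (w ! p, drop (p + l) w) of (c, v) \<Rightarrow> cont (replicate l c) powr (- 2 * \<rho>) * cont v powr (- 2 * \<rho>))" by simp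
      qed auto
      also have "\<dots> \<le> (\<Sum>u\<in>take p ` T. cont u powr (- 2 * \<rho>)) *
        ((\<Sum>c\<in>(\<lambda>w. w ! p) ` T. cont (replicate l c) powr (- 2 * \<rho>)) * (\<Sum>v\<in>drop (p + l) ` T. cont v powr (- 2 * \<rho>)))"
      proof (intro mult_left_mono sum_nonneg)
        define Q where "Q = (\<lambda>w. (w ! p, drop (p + l) w)) ` T"
        have "(\<Sum>(c, v)\<in>Q. cont (replicate l c) powr (- 2 * \<rho>) * cont v powr (- 2 * \<rho>)) \<le>
          (\<Sum>c\<in>fst ` Q. cont (replicate l c) powr (- 2 * \<rho>)) * (\<Sum>v\<in>snd ` Q. cont v powr (- 2 * \<rho>))"
          by (rule sum_le_prod_sums) (auto simp: Q_def T inj_on_def)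
        also have "fst ` Q = (\<lambda>w. w ! p) ` T" by (auto simp: Q_def image_image)
        also have "snd ` Q = drop (p + l) ` T" by (auto simp: Q_def image_image)
        finally show "(\<Sum>(c, v)\<in>(\<lambda>w. (w ! p, drop (p + l) w)) ` T. cont (replicate l c) powr (- 2 * \<rho>) * cont v powr (- 2 * \<rho>)) \<le>
          (\<Sum>c\<in>(\<lambda>w. w ! p) ` T. cont (replicate l c) powr (- 2 * \<rho>)) * (\<Sum>v\<in>drop (p + l) ` T. cont v powr (- 2 * \<rho>))"
          unfolding Q_def .
      qed auto
      also have "\<dots> \<le> (C * (real p + 1) ^ (2 * K) * (\<theta> powr (real p - real (L - l)) * golden powr (- 2 * \<rho> * real (L - l)))) *
        ((Z * golden powr (- 2 * \<rho> * real l)) * (D * \<theta> ^ (n - (p + l))))"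
      proof (intro mult_mono sum_nonneg mult_nonneg_nonneg)
        show "(\<Sum>u\<in>take p ` T. cont u powr (- 2 * \<rho>)) \<le>
           C * (real p + 1) ^ (2 * K) * (\<theta> powr (real p - real (L - l)) * golden powr (- 2 * \<rho> * real (L - l)))"
        proof -
          have "take p ` T \<subseteq> words p" using T take_words[of _ n p] l by auto
          moreover have "runs K (L - l) u" if "u \<in> take p ` T" for u using that gT by blast
          ultimately show ?thesis using C(2)[of "take p ` T" p "L - l"] T(1) unfolding wsum_def by blast
        qed
        show "(\<Sum>c\<in>(\<lambda>w. w ! p) ` T. cont (replicate l c) powr (- 2 * \<rho>)) \<le> Z * golden powr (- 2 * \<rho> * real l)"
          using Z(2)[of "(\<lambda>w. w ! p) ` T" l] T l pos(2) by fastforce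
        show "(\<Sum>v\<in>drop (p + l) ` T. cont v powr (- 2 * \<rho>)) \<le> D * \<theta> ^ (n - (p + l))"
          using H[of "drop (p + l) ` T" "n - (p + l)"] T drop_words[of _ n "p + l"] by (auto simp: wsum_def)
      qed (use C(1) Z(1) D \<theta> in auto)
      also have "\<dots> = C * Z * D * (real p + 1) ^ (2 * K) * (\<theta> powr (real n - real L) * golden powr (- 2 * \<rho> * real L))"
      proof -
        have e: "real n - real L = (real p - real (L - l)) + real (n - (p + l))" using l by (simp add: of_nat_diff)
        have "\<theta> powr (real n - real L) = \<theta> powr (real p - real (L - l)) * \<theta> ^ (n - (p + l))"
          unfolding e powr_add using \<theta> by (simp add: powr_realpow)
        moreover have "- 2 * \<rho> * real L = (- 2 * \<rho> * real (L - l)) + (- 2 * \<rho> * real l)" using l by (simp add: of_nat_diff algebra_simps)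
        then have "golden powr (- 2 * \<rho> * real L) = golden powr (- 2 * \<rho> * real (L - l)) * golden powr (- 2 * \<rho> * real l)"
          by (simp only: powr_add)
        ultimately show ?thesis by (simp only: mult_ac)
      qed
      also have "\<dots> \<le> B" unfolding B_def using l C(1) Z(1) D
        by (intro mult_right_mono mult_left_mono power_mono mult_nonneg_nonneg) auto
      finally show ?thesis unfolding T_def .
    qed
    have "wsum \<rho> S = (\<Sum>pl\<in>P. wsum \<rho> {w\<in>S. g w = pl})"
      unfolding wsum_def using sum.group[OF S(1) _ gP, of "\<lambda>w. cont w powr (- 2 * \<rho>)"] by (simp add: P_def)
    also have "\<dots> \<le> (\<Sum>pl\<in>P. B)" using block by (intro sum_mono) auto
    also have "\<dots> = (real n + 1) ^ 2 * B" by (simp add: P_def power2_eq_square algebra_simps)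
    also have "\<dots> = (C * Z * D) * (real n + 1) ^ (2 * Suc K) * (\<theta> powr (real n - real L) * golden powr (- 2 * \<rho> * real L))"
      by (simp add: B_def power2_eq_square)
    finally show ?thesis .
  qed
  have "1 * 1 * 1 \<le> C * Z * D" using C Z D by (intro mult_mono) auto
  then have CZD: "C * Z * D \<ge> 1" by simp
  show ?case by (intro exI[of _ "C * Z * D"] conjI allI impI, rule CZD, rule z)
qed

section \<open>Cylinders and covers of limsup sets\<close>

definition cyl :: "nat list \<Rightarrow> real set" where
  "cyl w = cfmap w ` {0..1}"

lemma cyl_diameter:
  assumes "0 \<notin> set w"
  shows "bounded (cyl w)" "diameter (cyl w) \<le> 1 / (cont w)\<^sup>2"
proof -
  have *: "dist x y \<le> 1 / (cont w)\<^sup>2" if "x \<in> cyl w" "y \<in> cyl w" for x y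
    using that cfmap_diff_le[OF assms] by (auto simp: cyl_def dist_real_def)
  show "bounded (cyl w)" unfolding bounded_two_points using * by blast
  have "cyl w \<noteq> {}" by (simp add: cyl_def)
  then show "diameter (cyl w) \<le> 1 / (cont w)\<^sup>2"
    unfolding diameter_def using * by (auto intro!: cSUP_least)
qed

lemma cf_lim_in_cyl: "posseq b \<Longrightarrow> cf_lim b \<in> cyl (pre b n)"
  using cf_lim_shift[of b n] cf_lim_range_closed[OF posseq_shift[of b n]] unfolding cyl_def by auto

lemma cyl_diameter_powr:
  assumes "0 \<notin> set w" "\<rho> \<ge> 0"
  shows "diameter (cyl w) powr \<rho> \<le> cont w powr (- 2 * \<rho>)"
proof -
  have p: "cont w > 0" using cont_ge_1[OF assms(1)] by simp
  have "diameter (cyl w) powr \<rho> \<le> (1 / (cont w)\<^sup>2) powr \<rho>"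
    using cyl_diameter[OF assms(1)] assms(2) diameter_ge_0 by (intro powr_mono2) auto
  also have "1 / (cont w)\<^sup>2 = cont w powr (-2)" using p by (simp add: powr_minus powr_numeral divide_inverse)
  finally show ?thesis by (simp add: powr_powr)
qed

lemma summable_poly_times_geometric:
  fixes x :: real
  assumes "0 < x" "x < 1"
  shows "summable (\<lambda>n. (real n + 1) ^ k * x ^ n)"
proof -
  \<comment> \<open>With this \<open>e\<close> the polynomial is at most a constant times exp(k e
    n), and k e is at most half of - ln x, so half of the exponential decay remains.\<close>
  define e where "e = - ln x / (2 * (real k + 1))"
  have e: "e > 0" unfolding e_def using assms ln_less_zero[of x] by (intro divide_pos_pos) auto
  define y where "y = exp (real k * e + ln x)"
  have "real k * e \<le> (real k + 1) * e" using e by (intro mult_right_mono) auto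
  also have "\<dots> = - ln x / 2" by (simp add: e_def field_simps)
  finally have "real k * e + ln x \<le> ln x / 2" by simp
  then have "real k * e + ln x < 0" using assms ln_less_zero[of x] by linarith
  then have y: "0 < y" "y < 1" by (auto simp: y_def)
  have "norm ((real n + 1) ^ k * x ^ n) \<le> exp (real k * e) / e ^ k * y ^ n" for n
  proof -
    have "e * (real n + 1) \<le> exp (e * (real n + 1))" using exp_ge_add_one_self[of "e * (real n + 1)"] by linarith
    then have "real n + 1 \<le> exp (e * (real n + 1)) / e" using e by (simp add: field_simps)
    then have "(real n + 1) ^ k \<le> (exp (e * (real n + 1)) / e) ^ k" by (intro power_mono) auto
    also have "\<dots> = exp (real k * e * (real n + 1)) / e ^ k"
      by (simp add: power_divide exp_of_nat_mult[symmetric] mult.assoc)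
    finally have 1: "(real n + 1) ^ k \<le> exp (real k * e * (real n + 1)) / e ^ k" .
    have 2: "x ^ n = exp (real n * ln x)" using assms by (simp add: exp_of_nat_mult)
    have "(real n + 1) ^ k * x ^ n \<le> exp (real k * e * (real n + 1)) / e ^ k * exp (real n * ln x)"
      unfolding 2 using 1 by (intro mult_right_mono) auto
    also have "\<dots> = exp (real k * e) / e ^ k * y ^ n"
      by (simp add: y_def exp_add exp_of_nat_mult[symmetric] algebra_simps flip: exp_add)
    finally show ?thesis using assms by simp
  qed
  moreover have "summable (\<lambda>n. exp (real k * e) / e ^ k * y ^ n)"
    using y by (intro summable_mult summable_geometric) auto
  ultimately show ?thesis by (rule summable_comparison_test'[where N = 0, rotated])
qed

definition run_limsup :: "nat \<Rightarrow> real \<Rightarrow> real set" where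
  "run_limsup K d = {cf_lim b | b. posseq b \<and> (\<exists>\<^sub>\<infinity>n. \<exists>L. d * real n \<le> real L \<and> runs K L (pre b n))}"

text \<open>Borel-Cantelli: among words of length n with at least d n digits in runs, the free part
  gains at most \<theta>^((1-d)n) and the runs lose at least \<tau>^(2\<rho>dn). The hypothesis on
  \<open>d\<close> says exactly that the loss wins, so up to a polynomial the level sums decay
  geometrically.\<close>

lemma run_limsup_null:
  assumes \<rho>: "\<rho> > 1 / 2" and \<theta>: "\<theta> \<ge> 1" and D: "D \<ge> 1"
    and H: "\<And>m S. finite S \<Longrightarrow> S \<subseteq> words m \<Longrightarrow> wsum \<rho> S \<le> D * \<theta> ^ m"
    and d: "(1 - d) * ln \<theta> < 2 * \<rho> * d * ln golden"
  shows "hausdorff_measure \<rho> (run_limsup K d) = 0"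
proof -
  have "\<exists>C\<ge>1. \<forall>n L S. finite S \<longrightarrow> S \<subseteq> words n \<longrightarrow> (\<forall>w\<in>S. runs K L w) \<longrightarrow>
    wsum \<rho> S \<le> C * (real n + 1) ^ (2 * K) * (\<theta> powr (real n - real L) * golden powr (- 2 * \<rho> * real L))"
    by (rule runs_wsum_le[OF \<rho> \<theta> D]) (rule H)
  then obtain C where C: "C \<ge> 1" "\<And>n L S. finite S \<Longrightarrow> S \<subseteq> words n \<Longrightarrow> (\<And>w. w \<in> S \<Longrightarrow> runs K L w) \<Longrightarrow>
    wsum \<rho> S \<le> C * (real n + 1) ^ (2 * K) * (\<theta> powr (real n - real L) * golden powr (- 2 * \<rho> * real L))"
    by (elim exE conjE) metis
  define x where "x = exp ((1 - d) * ln \<theta> - 2 * \<rho> * d * ln golden)"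
  have x: "0 < x" "x < 1" using d by (auto simp: x_def)
  have lg: "ln golden > 0" "ln \<theta> \<ge> 0" using golden_gt_1 \<theta> by auto
  have wt: "\<theta> powr (real n - real L) * golden powr (- 2 * \<rho> * real L) \<le> x ^ n" if "d * real n \<le> real L" for n L
  proof -
    have "\<theta> powr (real n - real L) * golden powr (- 2 * \<rho> * real L) =
      exp ((real n - real L) * ln \<theta> - 2 * \<rho> * real L * ln golden)"
      using \<theta> by (simp add: powr_def exp_diff exp_minus divide_inverse)
    also have "\<dots> \<le> exp ((real n - d * real n) * ln \<theta> - 2 * \<rho> * (d * real n) * ln golden)"
    proof -
      have "(real n - real L) * ln \<theta> \<le> (real n - d * real n) * ln \<theta>" using that lg by (intro mult_right_mono) auto
      moreover have "2 * \<rho> * (d * real n) * ln golden \<le> 2 * \<rho> * real L * ln golden"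
        using that lg \<rho> by (intro mult_right_mono mult_left_mono) auto
      ultimately show ?thesis by simp
    qed
    also have "\<dots> = x ^ n" by (simp add: x_def exp_of_nat_mult[symmetric] algebra_simps)
    finally show ?thesis .
  qed
  \<comment> \<open>The exponent 2K + 1 is one more than in \<open>runs_wsum_le\<close>, for the
    choice of L among 0, ..., n.\<close>
  define f where "f n = C * ((real n + 1) ^ (2 * K + 1) * x ^ n)" for n
  have sf: "summable f" unfolding f_def by (intro summable_mult summable_poly_times_geometric x)
  have f0: "f n \<ge> 0" for n using C(1) x by (simp add: f_def)
  define X where "X N = {w. 0 \<notin> set w \<and> N \<le> length w \<and> (\<exists>L. d * real (length w) \<le> real L \<and> runs K L w)}" for N
  have level: "wsum \<rho> S \<le> f n" if S: "finite S" "S \<subseteq> X N \<inter> words n" for S n N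
  proof -
    have "\<exists>L. L \<le> n \<and> d * real n \<le> real L \<and> runs K L w" if "w \<in> S" for w
      using S that runs_length[of K _ w] by (fastforce simp: X_def words_def)
    then obtain l where l: "\<And>w. w \<in> S \<Longrightarrow> l w \<le> n \<and> d * real n \<le> real (l w) \<and> runs K (l w) w" by metis
    have "wsum \<rho> S = (\<Sum>L\<le>n. wsum \<rho> {w\<in>S. l w = L})"
      unfolding wsum_def using l by (intro sum.group[symmetric] S) auto
    also have "\<dots> \<le> (\<Sum>L\<le>n. C * (real n + 1) ^ (2 * K) * x ^ n)"
    proof (rule sum_mono)
      fix L
      show "wsum \<rho> {w\<in>S. l w = L} \<le> C * (real n + 1) ^ (2 * K) * x ^ n"
      proof (cases "{w\<in>S. l w = L} = {}")
        case True
        have "0 \<le> C * (real n + 1) ^ (2 * K) * x ^ n" using C(1) x by simp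
        then show ?thesis unfolding True wsum_def by simp
      next
        case False
        then have "d * real n \<le> real L" using l by auto
        from wt[OF this] have "C * (real n + 1) ^ (2 * K) * (\<theta> powr (real n - real L) * golden powr (- 2 * \<rho> * real L)) \<le> C * (real n + 1) ^ (2 * K) * x ^ n"
          using C(1) by (intro mult_left_mono) auto
        moreover have "wsum \<rho> {w\<in>S. l w = L} \<le> C * (real n + 1) ^ (2 * K) * (\<theta> powr (real n - real L) * golden powr (- 2 * \<rho> * real L))"
          using S l by (intro C(2)) auto
        ultimately show ?thesis by linarith
      qed
    qed
    also have "\<dots> = f n" by (simp add: f_def algebra_simps)
    finally show ?thesis .
  qed
  have tail: "wsum \<rho> S \<le> suminf f - sum f {..<N}" if S: "finite S" "S \<subseteq> X N" for S N
  proof -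
    define M where "M = Suc (Max (insert N (length ` S)))"
    have M: "length ` S \<subseteq> {N..<M}" using S by (auto simp: X_def M_def less_Suc_eq_le intro!: Max_ge)
    have "N \<le> M" unfolding M_def using S(1) by (simp add: le_SucI)
    have "wsum \<rho> S = (\<Sum>n=N..<M. wsum \<rho> {w\<in>S. length w = n})"
      unfolding wsum_def using M S by (intro sum.group[symmetric]) auto
    also have "\<dots> \<le> (\<Sum>n=N..<M. f n)"
      using S by (intro sum_mono level[of _ N]) (auto simp: X_def words_def)
    also have "\<dots> = sum f {..<M} - sum f {..<N}"
      using sum.atLeastLessThan_concat[of 0 N M f] \<open>N \<le> M\<close> by (simp add: atLeast0LessThan)
    also have "sum f {..<M} \<le> suminf f" using f0 by (intro sum_le_suminf sf) auto
    finally show ?thesis by simp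
  qed
  show ?thesis
  proof (rule hausdorff_measure_eq_0_coverI[where I = cyl])
    show "\<rho> > 0" using \<rho> by simp
    fix \<delta> e :: real assume de: "\<delta> > 0" "e > 0"
    have "\<forall>\<^sub>F N in sequentially. sum f {..<N} > suminf f - e"
      using order_tendstoD(1)[OF summable_LIMSEQ[OF sf], of "suminf f - e"] de by simp
    moreover have "\<forall>\<^sub>F N in sequentially. golden\<^sup>2 / (golden^2) ^ N < \<delta>"
      using de(1) by (rule order_tendstoD(2)[OF inv_cont_tendsto_0])
    ultimately have "\<forall>\<^sub>F N in sequentially. sum f {..<N} > suminf f - e \<and> golden\<^sup>2 / (golden^2) ^ N < \<delta>"
      by (rule eventually_conj)
    then obtain N where N: "sum f {..<N} > suminf f - e" "golden\<^sup>2 / (golden^2) ^ N < \<delta>"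
      using eventually_happens'[OF sequentially_bot] by blast
    show "\<exists>X. run_limsup K d \<subseteq> (\<Union>w\<in>X. cyl w) \<and> (\<forall>w\<in>X. bounded (cyl w) \<and> diameter (cyl w) \<le> \<delta>) \<and>
      (\<forall>S\<subseteq>X. finite S \<longrightarrow> (\<Sum>w\<in>S. diameter (cyl w) powr \<rho>) \<le> e)"
    proof (intro exI[of _ "X N"] conjI ballI allI impI)
      show "run_limsup K d \<subseteq> (\<Union>w\<in>X N. cyl w)"
      proof
        fix y assume "y \<in> run_limsup K d"
        then obtain b where b: "y = cf_lim b" "posseq b" "\<exists>\<^sub>\<infinity>n. \<exists>L. d * real n \<le> real L \<and> runs K L (pre b n)"
          by (auto simp: run_limsup_def)
        then obtain n L where "n \<ge> N" "d * real n \<le> real L" "runs K L (pre b n)"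
          unfolding INFM_nat_le by blast
        then have "pre b n \<in> X N" using posseq_pre[OF b(2)] by (auto simp: X_def)
        then show "y \<in> (\<Union>w\<in>X N. cyl w)" using cf_lim_in_cyl[OF b(2)] b(1) by blast
      qed
    next
      fix w assume "w \<in> X N"
      then have w: "0 \<notin> set w" "N \<le> length w" by (auto simp: X_def)
      show "bounded (cyl w)" by (rule cyl_diameter(1)[OF w(1)])
      have "diameter (cyl w) \<le> 1 / (cont w)\<^sup>2" by (rule cyl_diameter(2)[OF w(1)])
      also have "\<dots> \<le> golden\<^sup>2 / (golden^2) ^ length w" by (rule inv_cont_sq_le[OF w(1)])
      also have "\<dots> \<le> golden\<^sup>2 / (golden^2) ^ N"
        using w(2) golden_gt_1 by (intro divide_left_mono power_increasing mult_pos_pos zero_less_power) auto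
      finally show "diameter (cyl w) \<le> \<delta>" using N(2) by linarith
    next
      fix S assume S: "S \<subseteq> X N" "finite S"
      have "(\<Sum>w\<in>S. diameter (cyl w) powr \<rho>) \<le> wsum \<rho> S"
        unfolding wsum_def using S \<rho> by (intro sum_mono cyl_diameter_powr) (auto simp: X_def)
      then show "(\<Sum>w\<in>S. diameter (cyl w) powr \<rho>) \<le> e" using tail[OF S(2,1)] N(1) by linarith
    qed
  qed
qed

section \<open>Run lengths of digit sequences\<close>

definition maxrun :: "(nat \<Rightarrow> nat) \<Rightarrow> nat \<Rightarrow> nat" where
  "maxrun b n = Max {l. 1 \<le> l \<and> (\<exists>j. j + l \<le> n \<and> (\<forall>i<l. b (j + i) = b j))}"

lemma run_length_cf_lim:
  assumes "posseq b" shows "run_length n (cf_lim b) = maxrun b n"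
proof -
  have "(\<forall>i\<in>{1..l}. cf_digit (cf_lim b) (j + i) = cf_digit (cf_lim b) (j + 1)) \<longleftrightarrow> (\<forall>i<l. b (j + i) = b j)" for j l
  proof -
    have "{1..l} = Suc ` {..<l}" by (auto simp: image_iff) (metis Suc_le_D Suc_le_lessD lessThan_iff)
    then show ?thesis using cf_digit_cf_lim[OF assms] by auto
  qed
  then show ?thesis unfolding run_length_def maxrun_def by simp
qed

lemma maxrun_finite:
  fixes b :: "nat \<Rightarrow> nat"
  shows "finite {l. 1 \<le> l \<and> (\<exists>j. j + l \<le> n \<and> (\<forall>i<l. b (j + i) = b j))}"
  by (rule finite_subset[of _ "{..n}"]) auto

lemma maxrun_ge: "1 \<le> l \<Longrightarrow> j + l \<le> n \<Longrightarrow> (\<And>i. i < l \<Longrightarrow> b (j + i) = b j) \<Longrightarrow> l \<le> maxrun b n"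
  unfolding maxrun_def by (intro Max_ge maxrun_finite) auto

lemma maxrun_obtain:
  assumes "1 \<le> n"
  obtains j where "j + maxrun b n \<le> n" "\<And>i. i < maxrun b n \<Longrightarrow> b (j + i) = b j" "1 \<le> maxrun b n"
proof -
  have "1 \<in> {l. 1 \<le> l \<and> (\<exists>j. j + l \<le> n \<and> (\<forall>i<l. b (j + i) = b j))}" using assms by auto
  then have "maxrun b n \<in> {l. 1 \<le> l \<and> (\<exists>j. j + l \<le> n \<and> (\<forall>i<l. b (j + i) = b j))}"
    unfolding maxrun_def by (intro Max_in maxrun_finite) blast
  then show ?thesis using that by blast
qed

lemma maxrun_leI:
  assumes "1 \<le> n" "\<And>l j. 1 \<le> l \<Longrightarrow> j + l \<le> n \<Longrightarrow> (\<And>i. i < l \<Longrightarrow> b (j + i) = b j) \<Longrightarrow> l \<le> M"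
  shows "maxrun b n \<le> M"
  using maxrun_obtain[OF assms(1), of b] assms(2) by metis

text \<open>A constant window cannot straddle j. One that starts at or after j and ends by j + R_j
  has length at most R_j, and one that ends by j is counted in R_j already.\<close>

lemma maxrun_boundary:
  assumes "1 \<le> j" "b (j - 1) \<noteq> b j"
  shows "maxrun b (j + maxrun b j) = maxrun b j"
proof (rule antisym)
  show "maxrun b (j + maxrun b j) \<le> maxrun b j"
  proof (rule maxrun_leI)
    fix l s assume l: "1 \<le> l" "s + l \<le> j + maxrun b j" "\<And>i. i < l \<Longrightarrow> b (s + i) = b s"
    consider "s \<ge> j" | "s + l \<le> j" | "s < j" "j < s + l" by linarith
    then show "l \<le> maxrun b j"
    proof cases
      case 2
      then show ?thesis using l by (intro maxrun_ge) auto
    next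
      case 3
      have "b (j - 1) = b s" using l(3)[of "j - 1 - s"] 3 by auto
      moreover have "b j = b s" using l(3)[of "j - s"] 3 by auto
      ultimately show ?thesis using assms by simp
    qed (use l in linarith)
  qed (use assms in simp)
  obtain s where "s + maxrun b j \<le> j" "\<And>i. i < maxrun b j \<Longrightarrow> b (s + i) = b s" "1 \<le> maxrun b j"
    using maxrun_obtain[OF assms(1)] by blast
  then show "maxrun b j \<le> maxrun b (j + maxrun b j)" by (intro maxrun_ge[of _ s]) auto
qed

section \<open>The two limits as four one-sided conditions on digit sequences, with quotients
  multiplied out\<close>

definition liminf_ge :: "real \<Rightarrow> (nat \<Rightarrow> nat) \<Rightarrow> bool" where
  "liminf_ge \<alpha> b \<longleftrightarrow> (\<forall>a<\<alpha>. \<forall>\<^sub>F n in sequentially. a * real n < real (maxrun b n))"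
definition limsup_le :: "real \<Rightarrow> (nat \<Rightarrow> nat) \<Rightarrow> bool" where
  "limsup_le \<beta> b \<longleftrightarrow> (\<forall>c>\<beta>. \<forall>\<^sub>F n in sequentially. real (maxrun b n) < c * real n)"
definition liminf_le :: "real \<Rightarrow> (nat \<Rightarrow> nat) \<Rightarrow> bool" where
  "liminf_le \<alpha> b \<longleftrightarrow> (\<forall>a>\<alpha>. \<exists>\<^sub>F n in sequentially. real (maxrun b n) < a * real n)"
definition limsup_ge :: "real \<Rightarrow> (nat \<Rightarrow> nat) \<Rightarrow> bool" where
  "limsup_ge \<beta> b \<longleftrightarrow> (\<forall>c<\<beta>. \<exists>\<^sub>F n in sequentially. c * real n < real (maxrun b n))"

lemma div_less_iff_seq:
  "(\<forall>\<^sub>F n in sequentially. ereal c < ereal (real (f n) / real n)) \<longleftrightarrow> (\<forall>\<^sub>F n in sequentially. c * real n < real (f n :: nat))"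
  "(\<forall>\<^sub>F n in sequentially. ereal (real (f n) / real n) < ereal c) \<longleftrightarrow> (\<forall>\<^sub>F n in sequentially. real (f n) < c * real n)"
  by (rule eventually_subst, rule eventually_mono[OF eventually_gt_at_top[of 0]], simp add: field_simps)+

lemma liminf_iff: "liminf (\<lambda>n. ereal (real (f n) / real n)) = ereal \<alpha> \<longleftrightarrow>
   (\<forall>a<\<alpha>. \<forall>\<^sub>F n in sequentially. a * real n < real (f n :: nat)) \<and> (\<forall>a>\<alpha>. \<exists>\<^sub>F n in sequentially. real (f n) < a * real n)"
proof -
  let ?X = "\<lambda>n. ereal (real (f n) / real n)"
  have 1: "ereal \<alpha> \<le> liminf ?X \<longleftrightarrow> (\<forall>a<\<alpha>. \<forall>\<^sub>F n in sequentially. a * real n < real (f n))"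
  proof
    assume L: "ereal \<alpha> \<le> liminf ?X"
    show "\<forall>a<\<alpha>. \<forall>\<^sub>F n in sequentially. a * real n < real (f n)"
    proof (intro allI impI)
      fix a assume "a < \<alpha>"
      then have "ereal a < liminf ?X" using L by (metis less_ereal.simps(1) less_le_trans)
      then show "\<forall>\<^sub>F n in sequentially. a * real n < real (f n)"
        using less_LiminfD div_less_iff_seq(1) by blast
    qed
  next
    assume L: "\<forall>a<\<alpha>. \<forall>\<^sub>F n in sequentially. a * real n < real (f n)"
    show "ereal \<alpha> \<le> liminf ?X"
    proof (rule ereal_le_epsilon2)
      fix e :: real assume "e > 0"
      then have "\<forall>\<^sub>F n in sequentially. ereal (\<alpha> - e) < ?X n" unfolding div_less_iff_seq(1) using L by simp
      then have "ereal (\<alpha> - e) \<le> liminf ?X" by (intro Liminf_bounded) (auto elim: eventually_mono)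
      then have "ereal (\<alpha> - e) + ereal e \<le> liminf ?X + ereal e" by (rule add_right_mono)
      then show "ereal \<alpha> \<le> liminf ?X + ereal e" by simp
    qed
  qed
  have 2: "liminf ?X \<le> ereal \<alpha> \<longleftrightarrow> (\<forall>a>\<alpha>. \<exists>\<^sub>F n in sequentially. real (f n) < a * real n)"
  proof
    assume L: "liminf ?X \<le> ereal \<alpha>"
    show "\<forall>a>\<alpha>. \<exists>\<^sub>F n in sequentially. real (f n) < a * real n"
    proof (intro allI impI, rule ccontr)
      fix a assume a: "a > \<alpha>" "\<not> (\<exists>\<^sub>F n in sequentially. real (f n) < a * real n)"
      then have "\<forall>\<^sub>F n in sequentially. a * real n \<le> real (f n)" by (simp add: not_frequently not_less)
      then have "\<forall>\<^sub>F n in sequentially. ereal a \<le> ?X n"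
        using eventually_gt_at_top[of 0] by eventually_elim (simp add: field_simps)
      then have "ereal a \<le> liminf ?X" by (rule Liminf_bounded)
      then show False using L a(1) by (metis less_ereal.simps(1) leD le_less_trans)
    qed
  next
    assume L: "\<forall>a>\<alpha>. \<exists>\<^sub>F n in sequentially. real (f n) < a * real n"
    show "liminf ?X \<le> ereal \<alpha>"
    proof (rule ccontr)
      assume "\<not> liminf ?X \<le> ereal \<alpha>"
      then obtain a where a: "ereal \<alpha> < ereal a" "ereal a < liminf ?X"
        using ereal_dense2 unfolding not_le by blast
      then have "\<forall>\<^sub>F n in sequentially. a * real n < real (f n)"
        using less_LiminfD div_less_iff_seq(1) by blast
      then have "\<forall>\<^sub>F n in sequentially. \<not> real (f n) < a * real n" by (rule eventually_mono) simp
      moreover have "\<exists>\<^sub>F n in sequentially. real (f n) < a * real n" using L a(1) by simp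
      ultimately show False unfolding frequently_def by blast
    qed
  qed
  show ?thesis unfolding 1[symmetric] 2[symmetric] by (subst order.eq_iff) blast
qed

lemma limsup_iff: "limsup (\<lambda>n. ereal (real (f n) / real n)) = ereal \<beta> \<longleftrightarrow>
   (\<forall>c>\<beta>. \<forall>\<^sub>F n in sequentially. real (f n :: nat) < c * real n) \<and> (\<forall>c<\<beta>. \<exists>\<^sub>F n in sequentially. c * real n < real (f n))"
proof -
  let ?X = "\<lambda>n. ereal (real (f n) / real n)"
  have 1: "limsup ?X \<le> ereal \<beta> \<longleftrightarrow> (\<forall>c>\<beta>. \<forall>\<^sub>F n in sequentially. real (f n) < c * real n)"
  proof
    assume L: "limsup ?X \<le> ereal \<beta>"
    show "\<forall>c>\<beta>. \<forall>\<^sub>F n in sequentially. real (f n) < c * real n"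
    proof (intro allI impI)
      fix c assume "c > \<beta>"
      then have "limsup ?X < ereal c" using L by (metis less_ereal.simps(1) le_less_trans)
      then show "\<forall>\<^sub>F n in sequentially. real (f n) < c * real n"
        using Limsup_lessD div_less_iff_seq(2) by blast
    qed
  next
    assume L: "\<forall>c>\<beta>. \<forall>\<^sub>F n in sequentially. real (f n) < c * real n"
    show "limsup ?X \<le> ereal \<beta>"
    proof (rule ereal_le_epsilon2)
      fix e :: real assume "e > 0"
      then have "\<forall>\<^sub>F n in sequentially. ?X n < ereal (\<beta> + e)" unfolding div_less_iff_seq(2) using L by simp
      then have "limsup ?X \<le> ereal (\<beta> + e)" by (intro Limsup_bounded) (auto elim: eventually_mono)
      then show "limsup ?X \<le> ereal \<beta> + ereal e" by simp
    qed
  qed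
  have 2: "ereal \<beta> \<le> limsup ?X \<longleftrightarrow> (\<forall>c<\<beta>. \<exists>\<^sub>F n in sequentially. c * real n < real (f n))"
  proof
    assume L: "ereal \<beta> \<le> limsup ?X"
    show "\<forall>c<\<beta>. \<exists>\<^sub>F n in sequentially. c * real n < real (f n)"
    proof (intro allI impI, rule ccontr)
      fix c assume c: "c < \<beta>" "\<not> (\<exists>\<^sub>F n in sequentially. c * real n < real (f n))"
      then have "\<forall>\<^sub>F n in sequentially. real (f n) \<le> c * real n" by (simp add: not_frequently not_less)
      then have "\<forall>\<^sub>F n in sequentially. ?X n \<le> ereal c"
        using eventually_gt_at_top[of 0] by eventually_elim (simp add: field_simps)
      then have "limsup ?X \<le> ereal c" by (rule Limsup_bounded)
      then show False using L c(1) by (metis less_ereal.simps(1) leD less_le_trans)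
    qed
  next
    assume L: "\<forall>c<\<beta>. \<exists>\<^sub>F n in sequentially. c * real n < real (f n)"
    show "ereal \<beta> \<le> limsup ?X"
    proof (rule ccontr)
      assume "\<not> ereal \<beta> \<le> limsup ?X"
      then obtain a where a: "limsup ?X < ereal a" "ereal a < ereal \<beta>"
        using ereal_dense2 unfolding not_le by blast
      then have "\<forall>\<^sub>F n in sequentially. real (f n) < a * real n"
        using Limsup_lessD div_less_iff_seq(2) by blast
      then have "\<forall>\<^sub>F n in sequentially. \<not> a * real n < real (f n)" by (rule eventually_mono) simp
      moreover have "\<exists>\<^sub>F n in sequentially. a * real n < real (f n)" using L a(2) by simp
      ultimately show False unfolding frequently_def by blast
    qed
  qed
  show ?thesis unfolding 1[symmetric] 2[symmetric] by (subst order.eq_iff) blast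
qed

lemma FG_iff: "x \<in> F \<alpha> \<inter> G \<beta> \<longleftrightarrow> (\<exists>b. posseq b \<and> x = cf_lim b \<and> liminf_ge \<alpha> b \<and> liminf_le \<alpha> b \<and> limsup_le \<beta> b \<and> limsup_ge \<beta> b)"
proof -
  have *: "cf_lim b \<in> F \<alpha> \<inter> G \<beta> \<longleftrightarrow> liminf_ge \<alpha> b \<and> liminf_le \<alpha> b \<and> limsup_le \<beta> b \<and> limsup_ge \<beta> b" if b: "posseq b" for b
  proof -
    have "cf_lim b \<in> {0..<1}" "cf_lim b \<notin> \<rat>"
      using cf_lim_less_1[OF b] cf_lim_pos[OF b] cf_lim_irrational[OF b] by auto
    then show ?thesis
      unfolding F_def G_def liminf_ge_def limsup_le_def liminf_le_def limsup_ge_def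
      using liminf_iff[of "maxrun b" \<alpha>] limsup_iff[of "maxrun b" \<beta>] by (simp add: run_length_cf_lim[OF b])
  qed
  show ?thesis
  proof
    assume x: "x \<in> F \<alpha> \<inter> G \<beta>"
    then have "0 \<le> x" "x < 1" "x \<notin> \<rat>" by (auto simp: F_def)
    then have "0 < x" "x < 1" "x \<notin> \<rat>" by (auto simp: less_le)
    then obtain b where "posseq b" "cf_lim b = x" by (rule cf_lim_exists)
    then show "\<exists>b. posseq b \<and> x = cf_lim b \<and> liminf_ge \<alpha> b \<and> liminf_le \<alpha> b \<and> limsup_le \<beta> b \<and> limsup_ge \<beta> b" using * x by blast
  qed (use * in blast)
qed

lemma FG_E:
  assumes "x \<in> F \<alpha> \<inter> G \<beta>"
  obtains b where "posseq b" "x = cf_lim b" "liminf_ge \<alpha> b" "liminf_le \<alpha> b" "limsup_le \<beta> b" "limsup_ge \<beta> b"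
  using assms unfolding FG_iff by blast

text \<open>A longest window cannot be extended to the left, hence it starts at 0 or at a change of
  digit, where \<open>maxrun_boundary\<close> applies again. The last conclusion makes the limsup
  condition usable at the end of the window instead of at \<open>n\<close>.\<close>

lemma maxrun_start:
  assumes "1 \<le> n"
  obtains j where "j + maxrun b n \<le> n" "\<And>i. i < maxrun b n \<Longrightarrow> b (j + i) = b j" "1 \<le> maxrun b n"
    "j \<ge> 1 \<Longrightarrow> b (j - 1) \<noteq> b j" "maxrun b n \<le> maxrun b (j + maxrun b n)"
proof -
  obtain j where j: "j + maxrun b n \<le> n" "\<And>i. i < maxrun b n \<Longrightarrow> b (j + i) = b j" "1 \<le> maxrun b n"
    using maxrun_obtain[OF assms] by blast
  have "b (j - 1) \<noteq> b j" if "j \<ge> 1"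
  proof
    assume e: "b (j - 1) = b j"
    have "b (j - 1 + i) = b (j - 1)" if "i < Suc (maxrun b n)" for i
    proof (cases i)
      case (Suc k)
      then show ?thesis using j(2)[of k] that e \<open>j \<ge> 1\<close> by simp
    qed simp
    then have "Suc (maxrun b n) \<le> maxrun b n" using j \<open>j \<ge> 1\<close> by (intro maxrun_ge[of _ "j - 1"]) auto
    then show False by simp
  qed
  moreover have "maxrun b n \<le> maxrun b (j + maxrun b n)" using j by (intro maxrun_ge[of _ j]) auto
  ultimately show ?thesis using that j by blast
qed

lemma pre_run_split:
  assumes "j + l \<le> n" "\<And>i. i < l \<Longrightarrow> b (j + i) = b j"
  shows "\<exists>v. pre b n = pre b j @ replicate l (b j) @ v"
proof -
  obtain k where n: "n = j + (l + k)" using assms(1) by (metis le_Suc_ex add.assoc)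
  have "pre (\<lambda>i. b (j + i)) l = replicate l (b j)"
    using assms(2) by (intro nth_equalityI) auto
  then show ?thesis unfolding n pre_add by simp
qed

text \<open>At a change of digit j, \<open>maxrun_boundary\<close> gives a (j + R_j) < R_j, that is
  R_j > a j/(1-a), while R_j < c j for every c > \<beta> and large j. These are incompatible once
  a/(1-a) > \<beta>, that is a > \<beta>/(1+\<beta>).\<close>

lemma not_eventually_constant_bound:
  assumes "liminf_ge \<alpha> b" "limsup_le \<beta> b" "0 \<le> \<beta>" "\<alpha> \<le> 1" and inf: "\<exists>\<^sub>\<infinity>j. j \<ge> 1 \<and> b (j - 1) \<noteq> b j"
  shows "\<alpha> \<le> \<beta> / (1 + \<beta>)"
proof (rule ccontr)
  assume "\<not> \<alpha> \<le> \<beta> / (1 + \<beta>)"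
  then obtain a where a: "\<beta> / (1 + \<beta>) < a" "a < \<alpha>" using dense by (meson not_le)
  have a1: "a < 1" using a assms by simp
  have "\<beta> < a * (1 + \<beta>)" using a(1) assms(3) by (simp add: pos_divide_less_eq)
  then have c: "\<beta> < a / (1 - a)" using a1 by (simp add: pos_less_divide_eq algebra_simps)
  have "\<forall>\<^sub>F n in sequentially. a * real n < real (maxrun b n)" using assms(1) a by (simp add: liminf_ge_def)
  moreover have "\<forall>\<^sub>F n in sequentially. real (maxrun b n) < a / (1 - a) * real n" using assms(2) c unfolding limsup_le_def by blast
  ultimately have "\<forall>\<^sub>F n in sequentially. a * real n < real (maxrun b n) \<and> real (maxrun b n) < a / (1 - a) * real n"
    by (rule eventually_conj)
  then obtain N where N: "\<And>n. n \<ge> N \<Longrightarrow> a * real n < real (maxrun b n)" "\<And>n. n \<ge> N \<Longrightarrow> real (maxrun b n) < a / (1 - a) * real n"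
    unfolding eventually_sequentially by blast
  obtain j where j: "j \<ge> N" "j \<ge> 1" "b (j - 1) \<noteq> b j" using inf unfolding INFM_nat_le by blast
  have "a * real (j + maxrun b j) < real (maxrun b j)"
    using N(1)[of "j + maxrun b j"] j maxrun_boundary[OF j(2,3)] by simp
  moreover have "real (maxrun b j) * (1 - a) < a * real j"
    using N(2)[OF j(1)] a1 by (simp add: field_simps)
  ultimately show False by (simp add: algebra_simps)
qed

text \<open>Here l is the length of the last run, s its start and L the total of the runs before s.
  Replacing s by B l turns A s S into l (A B S), which adds one term to the geometric sum.\<close>

lemma geometric_step:
  fixes A B x l s L :: real
  assumes "0 < A" "0 < B" "B * l \<le> s" "A * s * (\<Sum>i<K. (A * B) ^ i) \<le> L" "x \<le> l"
  shows "x * (\<Sum>i<Suc K. (A * B) ^ i) \<le> L + l"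
proof -
  define S where "S = (\<Sum>i<K. (A * B) ^ i)"
  have S0: "S \<ge> 0" unfolding S_def using assms(1,2) by (intro sum_nonneg) auto
  have "A * (B * l) * S \<le> A * s * S" using assms(1-3) S0 by (intro mult_right_mono mult_left_mono) auto
  then have "l * (1 + A * B * S) \<le> L + l" using assms(4) unfolding S_def[symmetric] by (simp add: algebra_simps)
  moreover have "x * (1 + A * B * S) \<le> l * (1 + A * B * S)" using assms S0 by (intro mult_right_mono) auto
  moreover have "(\<Sum>i<Suc K. (A * B) ^ i) = 1 + A * B * S"
    unfolding S_def by (simp only: sum.lessThan_Suc_shift sum_distrib_left power_Suc power_0)
  ultimately show ?thesis by (metis order_trans)
qed

text \<open>\<open>A\<close> bounds from below the ratio of the longest run to the position at a
  change of digit (liminf and \<open>maxrun_boundary\<close>), \<open>B\<close> the ratio of the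
  start of a run to its length (limsup). The start of the longest run is again a change of digit, so
  the induction continues in the prefix before it, which is shorter by a factor of at least A
  B.\<close>

lemma runs_before_boundary:
  assumes lo: "liminf_ge \<alpha> b" and up: "limsup_le \<beta> b" and a: "0 < a" "a < \<alpha>" "a < 1" and c: "\<beta> < c" "c < 1" "0 < c"
    and A: "A = a / (1 - a)" and B: "B = (1 - c) / c"
  shows "\<exists>J. \<forall>j\<ge>J. j \<ge> 1 \<longrightarrow> b (j - 1) \<noteq> b j \<longrightarrow> (\<exists>L. runs K L (pre b j) \<and> real L \<ge> A * real j * (\<Sum>i<K. (A * B) ^ i))"
proof (induction K)
  case 0
  then show ?case by (auto intro!: exI[of _ 0] runs_0)
next
  case (Suc K)
  then obtain J where J: "\<And>j. j \<ge> J \<Longrightarrow> j \<ge> 1 \<Longrightarrow> b (j - 1) \<noteq> b j \<Longrightarrow>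
    \<exists>L. runs K L (pre b j) \<and> real L \<ge> A * real j * (\<Sum>i<K. (A * B) ^ i)" by blast
  have AB: "A > 0" "B > 0" using a c by (auto simp: A B)
  have "\<forall>\<^sub>F n in sequentially. a * real n < real (maxrun b n)" using lo a by (simp add: liminf_ge_def)
  moreover have "\<forall>\<^sub>F n in sequentially. real (maxrun b n) < c * real n" using up c by (simp add: limsup_le_def)
  ultimately have "\<forall>\<^sub>F n in sequentially. a * real n < real (maxrun b n) \<and> real (maxrun b n) < c * real n"
    by (rule eventually_conj)
  then obtain N where N: "\<And>n. n \<ge> N \<Longrightarrow> a * real n < real (maxrun b n)" "\<And>n. n \<ge> N \<Longrightarrow> real (maxrun b n) < c * real n"
    unfolding eventually_sequentially by blast
  \<comment> \<open>From J' on, A j > N lets the limsup bound apply at the end of the run, and A B j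
    \<ge> J + 1 puts the start s beyond J and away from 0.\<close>
  obtain J' :: nat where J': "real J' > (real J + 1) / (A * B)" "real J' > real N / A"
    using reals_Archimedean2[of "max ((real J + 1) / (A * B)) (real N / A)"] by auto
  show ?case
  proof (rule exI[of _ "max N J'"], intro allI impI)
    fix j assume j: "max N J' \<le> j" "1 \<le> j" "b (j - 1) \<noteq> b j"
    define l where "l = maxrun b j"
    obtain s where s: "s + l \<le> j" "\<And>i. i < l \<Longrightarrow> b (s + i) = b s" "1 \<le> l" "s \<ge> 1 \<Longrightarrow> b (s - 1) \<noteq> b s" "l \<le> maxrun b (s + l)"
      using maxrun_start[OF j(2), of b] unfolding l_def by blast
    have "a * real (j + l) < real l"
      using N(1)[of "j + l"] j maxrun_boundary[OF j(2,3)] by (simp add: l_def)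
    then have lA: "real l \<ge> A * real j" unfolding A using a by (simp add: field_simps)
    moreover have "real N < A * real j"
    proof -
      have "real N / A < real j" using J'(2) j by linarith
      then show ?thesis using AB by (simp add: pos_divide_less_eq mult.commute)
    qed
    ultimately have "real l > real N" by linarith
    then have "real l < c * real (s + l)" using N(2)[of "s + l"] s(5) by simp
    then have sB: "real s \<ge> B * real l" unfolding B using c by (simp add: field_simps)
    have "real J + 1 \<le> (A * B) * real j"
    proof -
      have "(real J + 1) / (A * B) < real j" using J'(1) j by linarith
      then show ?thesis using AB by (simp add: pos_divide_less_eq mult.commute)
    qed
    also have "\<dots> = B * (A * real j)" by simp
    also have "\<dots> \<le> B * real l" using lA AB by (intro mult_left_mono) auto
    finally have sJ: "s \<ge> J" "s \<ge> 1" using sB by linarith+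
    obtain L where L: "runs K L (pre b s)" "real L \<ge> A * real s * (\<Sum>i<K. (A * B) ^ i)"
      using J[OF sJ s(4)[OF sJ(2)]] by blast
    obtain v where v: "pre b j = pre b s @ replicate l (b s) @ v" using pre_run_split[OF s(1,2)] by blast
    have "runs (Suc K) (L + l) (pre b j)" unfolding v by (rule runs_Suc[OF L(1) s(3)])
    moreover have "real (L + l) \<ge> A * real j * (\<Sum>i<Suc K. (A * B) ^ i)"
      using geometric_step[OF AB sB L(2) lA] by simp
    ultimately show "\<exists>L. runs (Suc K) L (pre b j) \<and> A * real j * (\<Sum>i<Suc K. (A * B) ^ i) \<le> real L" by blast
  qed
qed

text \<open>The rightmost run is found at a time n where R_n is close to \<beta> n. Such an n need
  not be a change of digit, so its ratio is \<open>c0\<close> instead of \<open>A\<close>; the start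
  of this run is one, and the chain goes on from there.\<close>

lemma runs_final:
  assumes lo: "liminf_ge \<alpha> b" and up: "limsup_le \<beta> b" and fu: "limsup_ge \<beta> b" and a: "0 < a" "a < \<alpha>" "a < 1" and c: "\<beta> < c" "c < 1" "0 < c"
    and A: "A = a / (1 - a)" and B: "B = (1 - c) / c" and c0: "0 < c0" "c0 < \<beta>"
  shows "\<exists>\<^sub>\<infinity>n. \<exists>L. c0 * (\<Sum>i<Suc K. (A * B) ^ i) * real n \<le> real L \<and> runs (Suc K) L (pre b n)"
  unfolding INFM_nat_le
proof
  fix m
  obtain J where J: "\<And>j. j \<ge> J \<Longrightarrow> j \<ge> 1 \<Longrightarrow> b (j - 1) \<noteq> b j \<Longrightarrow>
    \<exists>L. runs K L (pre b j) \<and> real L \<ge> A * real j * (\<Sum>i<K. (A * B) ^ i)"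
    using runs_before_boundary[OF lo up a c A B, of K] by blast
  have AB: "A > 0" "B > 0" using a c by (auto simp: A B)
  have "\<forall>\<^sub>F n in sequentially. real (maxrun b n) < c * real n" using up c by (simp add: limsup_le_def)
  then obtain N where N: "\<And>n. n \<ge> N \<Longrightarrow> real (maxrun b n) < c * real n"
    unfolding eventually_sequentially by blast
  obtain J' :: nat where J': "real J' > (real J + 1) / (c0 * B)" "real J' > real N / c0"
    using reals_Archimedean2[of "max ((real J + 1) / (c0 * B)) (real N / c0)"] by auto
  have "\<exists>\<^sub>F n in sequentially. c0 * real n < real (maxrun b n)" using fu c0 by (simp add: limsup_ge_def)
  then obtain n where n: "n \<ge> max (max m 1) J'" "c0 * real n < real (maxrun b n)"
    unfolding frequently_sequentially by blast
  define l where "l = maxrun b n"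
  obtain s where s: "s + l \<le> n" "\<And>i. i < l \<Longrightarrow> b (s + i) = b s" "1 \<le> l" "s \<ge> 1 \<Longrightarrow> b (s - 1) \<noteq> b s" "l \<le> maxrun b (s + l)"
    using maxrun_start[of n b] n(1) unfolding l_def by (metis max.boundedE)
  have l: "real l \<ge> c0 * real n" using n by (simp add: l_def)
  have "real N / c0 < real n" using J'(2) n by linarith
  then have "real N < real l" using c0 l by (simp add: pos_divide_less_eq mult.commute)
  then have "real l < c * real (s + l)" using N[of "s + l"] s(5) by simp
  then have sB: "real s \<ge> B * real l" unfolding B using c by (simp add: field_simps)
  have "(real J + 1) / (c0 * B) < real n" using J'(1) n by linarith
  then have "real J + 1 \<le> (c0 * B) * real n" using AB c0 by (simp add: pos_divide_less_eq mult.commute)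
  also have "\<dots> = B * (c0 * real n)" by simp
  also have "\<dots> \<le> B * real l" using l AB by (intro mult_left_mono) auto
  finally have sJ: "s \<ge> J" "s \<ge> 1" using sB by linarith+
  obtain L where L: "runs K L (pre b s)" "real L \<ge> A * real s * (\<Sum>i<K. (A * B) ^ i)"
    using J[OF sJ s(4)[OF sJ(2)]] by blast
  obtain v where v: "pre b n = pre b s @ replicate l (b s) @ v" using pre_run_split[OF s(1,2)] by blast
  have "runs (Suc K) (L + l) (pre b n)" unfolding v by (rule runs_Suc[OF L(1) s(3)])
  moreover have "real (L + l) \<ge> c0 * (\<Sum>i<Suc K. (A * B) ^ i) * real n"
    using geometric_step[OF AB sB L(2) l] by (simp only: mult_ac of_nat_add)
  moreover have "m \<le> n" using n(1) by simp
  ultimately show "\<exists>n\<ge>m. \<exists>L. c0 * (\<Sum>i<Suc K. (A * B) ^ i) * real n \<le> real L \<and> runs (Suc K) L (pre b n)"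
    by blast
qed

text \<open>For \<alpha> = 0 or \<beta> = 1 the ratio of the geometric series vanishes, \<gamma>
  equals \<beta>, and a single run already has share close to \<gamma>.\<close>

lemma one_run:
  assumes fu: "limsup_ge \<beta> b" and c0: "c0 < \<beta>"
  shows "\<exists>\<^sub>\<infinity>n. \<exists>L. c0 * real n \<le> real L \<and> runs 1 L (pre b n)"
  unfolding INFM_nat_le
proof
  fix m
  have "\<exists>\<^sub>F n in sequentially. c0 * real n < real (maxrun b n)" using fu c0 by (simp add: limsup_ge_def)
  then obtain n where n: "n \<ge> max m 1" "c0 * real n < real (maxrun b n)"
    unfolding frequently_sequentially by blast
  obtain s where s: "s + maxrun b n \<le> n" "\<And>i. i < maxrun b n \<Longrightarrow> b (s + i) = b s" "1 \<le> maxrun b n"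
    using maxrun_start[of n b] n(1) by (metis max.boundedE)
  obtain v where v: "pre b n = pre b s @ replicate (maxrun b n) (b s) @ v" using pre_run_split[OF s(1,2)] by blast
  have "runs (Suc 0) (0 + maxrun b n) (pre b n)" by (subst v, rule runs_Suc[OF runs_0 s(3)])
  then show "\<exists>n\<ge>m. \<exists>L. c0 * real n \<le> real L \<and> runs 1 L (pre b n)" using n
    by (intro exI[of _ n] conjI exI[of _ "maxrun b n"]) auto
qed

lemma FG_subset_run_limsup:
  assumes \<alpha>: "0 \<le> \<alpha>" "\<alpha> < \<beta>" "\<beta> \<le> 1" and d: "d < \<beta>\<^sup>2 * (1 - \<alpha>) / (\<beta> - \<alpha>)"
  shows "\<exists>K. F \<alpha> \<inter> G \<beta> \<subseteq> run_limsup K d"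
proof (cases "\<alpha> = 0 \<or> \<beta> = 1")
  case True
  then have "d < \<beta>" using d \<alpha> by (auto simp: power2_eq_square)
  moreover have "F \<alpha> \<inter> G \<beta> \<subseteq> run_limsup 1 d" if "d < \<beta>"
  proof
    fix x assume "x \<in> F \<alpha> \<inter> G \<beta>"
    then obtain b where "posseq b" "x = cf_lim b" "limsup_ge \<beta> b" by (rule FG_E)
    then show "x \<in> run_limsup 1 d" using one_run[OF _ that] unfolding run_limsup_def by blast
  qed
  ultimately show ?thesis by blast
next
  case False
  then have \<alpha>0: "\<alpha> > 0" "\<beta> < 1" "\<alpha> < 1" "\<beta> > 0" using \<alpha> by auto
  \<comment> \<open>\<open>AB e\<close> is the ratio A B of \<open>runs_final\<close> for a =
    \<alpha> - e and c = \<beta> + e, and \<open>g e\<close> is the share of infinitely many runs.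
    As e tends to 0 it tends to \<gamma> > d, so first e is fixed small, then K large.\<close>
  define AB where "AB e = ((\<alpha> - e) / (1 - (\<alpha> - e))) * ((1 - (\<beta> + e)) / (\<beta> + e))" for e
  define g where "g e = (\<beta> - e) * (1 / (1 - AB e))" for e
  have AB0: "AB 0 = \<alpha> * (1 - \<beta>) / ((1 - \<alpha>) * \<beta>)" by (simp add: AB_def)
  have AB1: "1 - AB 0 = (\<beta> - \<alpha>) / ((1 - \<alpha>) * \<beta>)"
    unfolding AB0 using \<alpha>0 by (simp add: field_simps)
  have AB1': "1 - AB 0 > 0" unfolding AB1 using \<alpha> \<alpha>0 by simp
  have ABt: "(AB \<longlongrightarrow> AB 0) (at_right 0)"
    unfolding AB_def using \<alpha>0 by (auto intro!: tendsto_eq_intros)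
  have "(g \<longlongrightarrow> (\<beta> - 0) * (1 / (1 - AB 0))) (at_right 0)"
    unfolding g_def using AB1' by (intro tendsto_intros ABt) auto
  moreover have "(\<beta> - 0) * (1 / (1 - AB 0)) = \<beta>\<^sup>2 * (1 - \<alpha>) / (\<beta> - \<alpha>)"
    unfolding AB1 by (simp add: power2_eq_square)
  ultimately have "\<forall>\<^sub>F e in at_right 0. g e > d" using d order_tendstoD(1) by metis
  moreover have "\<forall>\<^sub>F e in at_right 0. AB e < 1" using order_tendstoD(2)[OF ABt, of 1] AB1' by simp
  moreover have "\<forall>\<^sub>F e in at_right 0. e < min \<alpha> (1 - \<beta>)" using \<alpha>0 by (intro order_tendstoD(2)[OF tendsto_ident_at]) auto
  moreover have "\<forall>\<^sub>F e in at_right 0. e > (0::real)" by (rule eventually_at_right_less)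
  ultimately have "\<forall>\<^sub>F e in at_right 0. g e > d \<and> AB e < 1 \<and> e < min \<alpha> (1 - \<beta>) \<and> e > 0"
    by eventually_elim auto
  then obtain e where e: "g e > d" "AB e < 1" "e < \<alpha>" "e < 1 - \<beta>" "e > 0"
    using eventually_happens'[OF trivial_limit_at_right_real[of "0::real"]] by auto
  have ABp: "AB e > 0" unfolding AB_def using e \<alpha>0 \<alpha> by simp
  have "(\<lambda>n. \<Sum>i<n. AB e ^ i) \<longlonglongrightarrow> 1 / (1 - AB e)"
    using geometric_sums[of "AB e"] ABp e(2) by (simp add: sums_def)
  then have "(\<lambda>n. (\<beta> - e) * (\<Sum>i<Suc n. AB e ^ i)) \<longlonglongrightarrow> g e"
    unfolding g_def by (intro tendsto_intros LIMSEQ_Suc)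
  then have "\<forall>\<^sub>F n in sequentially. (\<beta> - e) * (\<Sum>i<Suc n. AB e ^ i) > d"
    using e(1) by (rule order_tendstoD(1))
  then obtain K where K: "(\<beta> - e) * (\<Sum>i<Suc K. AB e ^ i) > d"
    using eventually_happens'[OF sequentially_bot] by blast
  have "F \<alpha> \<inter> G \<beta> \<subseteq> run_limsup (Suc K) d"
  proof
    fix x assume "x \<in> F \<alpha> \<inter> G \<beta>"
    then obtain b where b: "posseq b" "x = cf_lim b" "liminf_ge \<alpha> b" "limsup_le \<beta> b" "limsup_ge \<beta> b" by (rule FG_E)
    have "\<exists>\<^sub>\<infinity>n. \<exists>L. (\<beta> - e) * (\<Sum>i<Suc K. AB e ^ i) * real n \<le> real L \<and> runs (Suc K) L (pre b n)"
      unfolding AB_def using e \<alpha>0 \<alpha> by (intro runs_final[OF b(3-5) _ _ _ _ _ _ refl refl]) auto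
    then have "\<exists>\<^sub>\<infinity>n. \<exists>L. d * real n \<le> real L \<and> runs (Suc K) L (pre b n)"
    proof (rule INFM_mono)
      fix n assume "\<exists>L. (\<beta> - e) * (\<Sum>i<Suc K. AB e ^ i) * real n \<le> real L \<and> runs (Suc K) L (pre b n)"
      moreover have "d * real n \<le> (\<beta> - e) * (\<Sum>i<Suc K. AB e ^ i) * real n" using K by (intro mult_right_mono) auto
      ultimately show "\<exists>L. d * real n \<le> real L \<and> runs (Suc K) L (pre b n)" by (meson order_trans)
    qed
    then show "x \<in> run_limsup (Suc K) d" using b by (auto simp: run_limsup_def)
  qed
  then show ?thesis by blast
qed

text \<open>Infinitely many changes of digit would force \<alpha> \<le> \<beta>/(1+\<beta>). Hence
  the digits are eventually constant, and a point is coded by a finite word and one digit.\<close>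

lemma FG_dim_0:
  assumes "0 \<le> \<beta>" "\<alpha> \<le> 1" "\<alpha> > \<beta> / (1 + \<beta>)"
  shows "hausdorff_dim (F \<alpha> \<inter> G \<beta>) = 0"
proof (rule hausdorff_dim_countable)
  define h where "h = (\<lambda>(w, c). cf_lim (\<lambda>i. if i < length w then w ! i else c))"
  have "F \<alpha> \<inter> G \<beta> \<subseteq> range h"
  proof
    fix x assume "x \<in> F \<alpha> \<inter> G \<beta>"
    then obtain b where b: "x = cf_lim b" "liminf_ge \<alpha> b" "limsup_le \<beta> b" by (rule FG_E)
    have "\<not> (\<exists>\<^sub>\<infinity>j. j \<ge> 1 \<and> b (j - 1) \<noteq> b j)"
      using not_eventually_constant_bound[OF b(2,3)] assms by force
    then obtain N where N: "\<And>j. j \<ge> N \<Longrightarrow> j \<ge> 1 \<Longrightarrow> b (j - 1) = b j"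
      unfolding INFM_nat_le by blast
    have c: "b (N + k) = b N" for k
    proof (induction k)
      case (Suc k)
      then show ?case using N[of "Suc (N + k)"] by simp
    qed simp
    have "(\<lambda>i. if i < length (pre b N) then pre b N ! i else b N) = b"
    proof
      fix i show "(if i < length (pre b N) then pre b N ! i else b N) = b i"
        using c[of "i - N"] by auto
    qed
    then have "x = h (pre b N, b N)" using b(1) by (simp add: h_def)
    then show "x \<in> range h" by blast
  qed
  then show "countable (F \<alpha> \<inter> G \<beta>)" by (rule countable_subset) simp
qed

section \<open>The upper bound\<close>

text \<open>The exact length of \<open>cyl w\<close>, by \<open>cfmap_diff\<close> at 0 and 1. It is
  comparable to \<open>cont w powr -2\<close>, but adds up over subcylinders without loss of
  constants.\<close>

definition cyl_len :: "nat list \<Rightarrow> real" where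
  "cyl_len w = 1 / (cont w * cfden w 1)"

definition box :: "nat \<Rightarrow> nat \<Rightarrow> nat list set" where
  "box N n = {w. length w = n \<and> set w \<subseteq> {1..N}}"

lemma finite_box: "finite (box N n)"
  using finite_lists_length_eq[of "{1..N}" n] by (simp add: box_def conj_commute)

lemma box_words: "box N n \<subseteq> words n"
  by (auto simp: box_def words_def)

lemma finite_words_box:
  assumes "finite S" "S \<subseteq> words n"
  obtains N where "S \<subseteq> box N n"
proof -
  define N where "N = Max (insert 0 (\<Union>(set ` S)))"
  have "finite (insert 0 (\<Union>(set ` S)))" using assms by auto
  then have "a \<le> N" if "w \<in> S" "a \<in> set w" for w a
    unfolding N_def using that by (intro Max_ge) auto
  then have "S \<subseteq> box N n" using assms(2) by (fastforce simp: box_def words_def Suc_le_eq intro: gr0I)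
  then show ?thesis using that by blast
qed

lemma box_Suc: "box N (Suc n) = (\<lambda>(w, a). w @ [a]) ` (box N n \<times> {1..N})"
proof (intro equalityI subsetI)
  fix w assume w: "w \<in> box N (Suc n)"
  then have "w = butlast w @ [last w]" by (auto simp: box_def intro: append_butlast_last_id[symmetric])
  moreover have "butlast w \<in> box N n" "last w \<in> {1..N}"
    using w by (auto simp: box_def dest: in_set_butlastD) (metis Zero_not_Suc atLeastAtMost_iff last_in_set length_0_conv subsetD One_nat_def)+
  ultimately show "w \<in> (\<lambda>(w, a). w @ [a]) ` (box N n \<times> {1..N})" by force
qed (auto simp: box_def)

text \<open>The subcylinders are adjacent, so the sum telescopes. Those with last digit above N
  occupy the share (q + q')/((N+1) q + q') \<le> 2/(N+1), because q' \<le> q.\<close>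

lemma cyl_len_snoc_sum:
  assumes "0 \<notin> set w"
  shows "(\<Sum>a\<in>{1..N}. cyl_len (w @ [a])) \<le> cyl_len w"
    "cyl_len w * (1 - 2 / (real N + 1)) \<le> (\<Sum>a\<in>{1..N}. cyl_len (w @ [a]))"
proof -
  obtain q' where q: "0 \<le> q'" "q' \<le> cont w" "1 \<le> cont w" "\<And>X. X \<ge> 0 \<Longrightarrow> cfden w X = cont w + q' * X"
    using cfden_affine[OF assms] by blast
  define q where "q = cont w"
  have q1: "q \<ge> 1" "q' \<le> q" using q by (auto simp: q_def)
  have len: "cyl_len (w @ [a]) = (1 / q) * (1 / (real a * q + q') - 1 / ((real a + 1) * q + q'))" if "a \<ge> 1" for a
  proof -
    have c: "cont (w @ [a]) = real a * q + q'"
      using q(4)[of "1/real a"] that by (simp add: cont_def cfden_append field_simps flip: q_def)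
        (simp add: q_def cont_def)
    have d: "cfden (w @ [a]) 1 = (real a + 1) * q + q'"
      using q(4)[of "1/(real a + 1)"] that by (simp add: cfden_append field_simps q_def)
    have p: "real a * q + q' > 0" "(real a + 1) * q + q' > 0" "q > 0" using q1 q(1) that by (auto intro: add_pos_nonneg)
    have "1 / (real a * q + q') - 1 / ((real a + 1) * q + q') = q / ((real a * q + q') * ((real a + 1) * q + q'))"
      using p by (simp add: divide_simps) (simp add: algebra_simps)
    then show ?thesis unfolding cyl_len_def c d using p by simp
  qed
  have sum: "(\<Sum>a\<in>{1..N}. cyl_len (w @ [a])) = (1 / q) * (1 / (q + q') - 1 / ((real N + 1) * q + q'))"
  proof (induction N)
    case (Suc N)
    have "(\<Sum>a\<in>{1..Suc N}. cyl_len (w @ [a])) = (\<Sum>a\<in>{1..N}. cyl_len (w @ [a])) + cyl_len (w @ [Suc N])" by simp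
    also have "\<dots> = (1 / q) * (1 / (q + q') - 1 / ((real N + 1) * q + q')) + (1 / q) * (1 / ((real N + 1) * q + q') - 1 / ((real (Suc N) + 1) * q + q'))"
      using Suc len[of "Suc N"] by (simp add: add.commute)
    finally show ?case by (simp add: algebra_simps)
  qed simp
  have lw: "cyl_len w = (1 / q) * (1 / (q + q'))" using q(4)[of 1] by (simp add: cyl_len_def q_def)
  have p: "(real N + 1) * q + q' > 0" "q + q' > 0" using q1 q(1) by (auto intro: add_pos_nonneg)
  show "(\<Sum>a\<in>{1..N}. cyl_len (w @ [a])) \<le> cyl_len w"
    unfolding sum lw using q1 p by (intro mult_left_mono) auto
  have "1 / ((real N + 1) * q + q') \<le> (1 / (q + q')) * (2 / (real N + 1))"
  proof -
    have "(q + q') * (real N + 1) \<le> 2 * ((real N + 1) * q + q')"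
      using q1 q(1) mult_right_mono[of q' q "real N + 1"] by (simp add: algebra_simps)
    then show ?thesis using p by (simp add: divide_simps mult_ac)
  qed
  then show "cyl_len w * (1 - 2 / (real N + 1)) \<le> (\<Sum>a\<in>{1..N}. cyl_len (w @ [a]))"
    unfolding sum lw mult.assoc using q1 by (intro mult_left_mono) (simp_all add: algebra_simps)
qed

lemma box_len_sum:
  shows "(\<Sum>w\<in>box N n. cyl_len w) \<le> 1"
    "N \<ge> 1 \<Longrightarrow> (1 - 2 / (real N + 1)) ^ n \<le> (\<Sum>w\<in>box N n. cyl_len w)"
proof -
  have inj: "inj_on (\<lambda>(w, a). w @ [a]) (box N n \<times> {1..N})" for n by (auto simp: inj_on_def)
  have rec: "(\<Sum>w\<in>box N (Suc n). cyl_len w) = (\<Sum>w\<in>box N n. \<Sum>a\<in>{1..N}. cyl_len (w @ [a]))" for n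
    unfolding box_Suc sum.reindex[OF inj] by (simp add: sum.cartesian_product case_prod_unfold)
  have b0: "box N 0 = {[]}" by (auto simp: box_def)
  have z: "0 \<notin> set w" if "w \<in> box N n" for w n using that by (auto simp: box_def)
  show "(\<Sum>w\<in>box N n. cyl_len w) \<le> 1"
  proof (induction n)
    case (Suc n)
    have "(\<Sum>w\<in>box N (Suc n). cyl_len w) \<le> (\<Sum>w\<in>box N n. cyl_len w)"
      unfolding rec using z by (intro sum_mono cyl_len_snoc_sum(1)) auto
    then show ?case using Suc by simp
  qed (simp add: b0 cyl_len_def)
  assume N: "N \<ge> 1"
  show "(1 - 2 / (real N + 1)) ^ n \<le> (\<Sum>w\<in>box N n. cyl_len w)"
  proof (induction n)
    case (Suc n)
    have r: "0 \<le> 1 - 2 / (real N + 1)" using N by (simp add: field_simps)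
    have "(1 - 2 / (real N + 1)) ^ Suc n \<le> (\<Sum>w\<in>box N n. cyl_len w) * (1 - 2 / (real N + 1))"
      using mult_right_mono[OF Suc r] by (simp add: mult.commute)
    also have "\<dots> = (\<Sum>w\<in>box N n. cyl_len w * (1 - 2 / (real N + 1)))" by (rule sum_distrib_right)
    also have "\<dots> \<le> (\<Sum>w\<in>box N (Suc n). cyl_len w)"
      unfolding rec using z by (intro sum_mono cyl_len_snoc_sum(2)) auto
    finally show ?case .
  qed (simp add: b0 cyl_len_def)
qed

lemma cyl_len_bounds:
  assumes "0 \<notin> set w"
  shows "cyl_len w \<le> cont w powr -2" "cont w powr -2 \<le> 2 * cyl_len w"
proof -
  have c: "1 \<le> cont w" "cont w \<le> cfden w 1" "cfden w 1 \<le> 2 * cont w"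
    using cont_ge_1[OF assms] cfden_bounds[OF assms, of 1] by auto
  have e: "cont w powr -2 = 1 / (cont w * cont w)"
    using c by (simp add: powr_minus powr_numeral divide_inverse power2_eq_square)
  show "cyl_len w \<le> cont w powr -2" unfolding e cyl_len_def using c by (intro divide_left_mono mult_left_mono mult_pos_pos) auto
  have "1 / (cont w * cont w) = 2 * (1 / (cont w * (2 * cont w)))" by simp
  also have "\<dots> \<le> 2 * (1 / (cont w * cfden w 1))" using c by (intro mult_left_mono divide_left_mono mult_pos_pos) auto
  finally show "cont w powr -2 \<le> 2 * cyl_len w" unfolding e cyl_len_def .
qed

lemma wsum_1_le:
  assumes "finite S" "S \<subseteq> words n" shows "wsum 1 S \<le> 2"
proof -
  obtain N where N: "S \<subseteq> box N n" using finite_words_box[OF assms] by blast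
  have "wsum 1 S \<le> (\<Sum>w\<in>S. 2 * cyl_len w)"
    unfolding wsum_def using assms(2) cyl_len_bounds(2) by (intro sum_mono) (auto simp: words_def)
  also have "\<dots> \<le> (\<Sum>w\<in>box N n. 2 * cyl_len w)"
  proof (intro sum_mono2 finite_box N)
    fix w assume "w \<in> box N n - S"
    then have z: "0 \<notin> set w" by (auto simp: box_def)
    have "0 < cont w powr -2" using cont_ge_1[OF z] by simp
    then show "0 \<le> 2 * cyl_len w" using cyl_len_bounds(2)[OF z] by linarith
  qed
  also have "\<dots> \<le> 2" using box_len_sum(1)[of N n] by (simp flip: sum_distrib_left)
  finally show ?thesis .
qed

section \<open>The infimum defining \<open>pre_s\<close>, over finite sets of words\<close>

definition pre_s_set :: "nat \<Rightarrow> real \<Rightarrow> real set" where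
  "pre_s_set n c = {\<rho>. 0 \<le> \<rho> \<and> (\<forall>S. finite S \<longrightarrow> S \<subseteq> words n \<longrightarrow> (\<Sum>w\<in>S. (1 / (c * cont w)) powr (2 * \<rho>)) \<le> 1)}"

lemma bij_words: "bij_betw (\<lambda>a. map a [1..<Suc n]) ({1..n} \<rightarrow>\<^sub>E {1..}) (words n)"
proof (rule bij_betwI')
  fix a b :: "nat \<Rightarrow> nat" assume ab: "a \<in> {1..n} \<rightarrow>\<^sub>E {1..}" "b \<in> {1..n} \<rightarrow>\<^sub>E {1..}"
  show "(map a [1..<Suc n] = map b [1..<Suc n]) = (a = b)"
  proof
    assume e: "map a [1..<Suc n] = map b [1..<Suc n]"
    show "a = b"
    proof (rule PiE_ext[OF ab])
      fix i assume "i \<in> {1..n}" then show "a i = b i" using e by (auto simp del: upt_Suc)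
    qed
  qed simp
next
  fix a :: "nat \<Rightarrow> nat" assume a: "a \<in> {1..n} \<rightarrow>\<^sub>E {1..}"
  have "a i \<noteq> 0" if "i \<in> {1..n}" for i using a that by (force simp: PiE_iff)
  then show "map a [1..<Suc n] \<in> words n" by (force simp: words_def simp del: upt_Suc)
next
  fix w assume w: "w \<in> words n"
  define a where "a = (\<lambda>i. if i \<in> {1..n} then w ! (i - 1) else undefined)"
  have "a \<in> {1..n} \<rightarrow>\<^sub>E {1..}"
  proof (rule PiE_I)
    fix i assume i: "i \<in> {1..n}"
    then have "w ! (i - 1) \<in> set w" using w by (auto simp: words_def intro!: nth_mem)
    then have "w ! (i - 1) \<noteq> 0" using w unfolding words_def by (metis (mono_tags, lifting) mem_Collect_eq)
    then show "a i \<in> {1..}" using i by (simp add: a_def Suc_le_eq)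
  qed (auto simp: a_def)
  moreover have "w = map a [1..<Suc n]"
    using w by (intro nth_equalityI) (auto simp: words_def a_def simp del: upt_Suc)
  ultimately show "\<exists>a\<in>{1..n} \<rightarrow>\<^sub>E {1..}. w = map a [1..<Suc n]" by blast
qed

text \<open>The terms are nonnegative, so the \<open>ennreal\<close> sum over all words is the
  supremum of its finite partial sums, and divergence just violates the bound 1. The number
  \<open>c\<close> of \<open>pre_s_set\<close> stands for \<tau>^(n\<gamma>/(1-\<gamma>)).\<close>

lemma pre_s_eq: "pre_s n \<gamma> \<tau> = Inf (pre_s_set n (\<tau> powr (real n * \<gamma> / (1 - \<gamma>))))"
proof -
  define c where "c = \<tau> powr (real n * \<gamma> / (1 - \<gamma>))"
  have "(\<Sum>\<^sub>\<infinity> a \<in> {1..n} \<rightarrow>\<^sub>E {1..}. ennreal ((1 / (c * real (cf_denom a n))) powr (2 * \<rho>))) \<le> 1 \<longleftrightarrow>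
     (\<forall>S. finite S \<longrightarrow> S \<subseteq> words n \<longrightarrow> (\<Sum>w\<in>S. (1 / (c * cont w)) powr (2 * \<rho>)) \<le> 1)" for \<rho>
  proof -
    have "(\<Sum>\<^sub>\<infinity> a \<in> {1..n} \<rightarrow>\<^sub>E {1..}. ennreal ((1 / (c * real (cf_denom a n))) powr (2 * \<rho>))) =
      (\<Sum>\<^sub>\<infinity> a \<in> {1..n} \<rightarrow>\<^sub>E {1..}. ennreal ((1 / (c * cont (map a [1..<Suc n]))) powr (2 * \<rho>)))"
    proof (rule infsum_cong)
      fix a :: "nat \<Rightarrow> nat" assume a: "a \<in> {1..n} \<rightarrow>\<^sub>E {1..}"
      have "real (cf_denom a n) = cont (map a [1..<Suc n])"
        using a by (intro cf_denom_eq_cont) (force simp: PiE_iff)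
      then show "ennreal ((1 / (c * real (cf_denom a n))) powr (2 * \<rho>)) = ennreal ((1 / (c * cont (map a [1..<Suc n]))) powr (2 * \<rho>))" by simp
    qed
    also have "\<dots> = infsum (\<lambda>w. ennreal ((1 / (c * cont w)) powr (2 * \<rho>))) (words n)"
      by (rule infsum_reindex_bij_betw[OF bij_words])
    also have "\<dots> = (SUP S\<in>{S. finite S \<and> S \<subseteq> words n}. \<Sum>w\<in>S. ennreal ((1 / (c * cont w)) powr (2 * \<rho>)))"
      by (rule nonneg_infsum_complete) simp
    also have "\<dots> = (SUP S\<in>{S. finite S \<and> S \<subseteq> words n}. ennreal (\<Sum>w\<in>S. (1 / (c * cont w)) powr (2 * \<rho>)))"
      by (simp add: sum_ennreal)
    also have "\<dots> \<le> 1 \<longleftrightarrow> (\<forall>S. finite S \<longrightarrow> S \<subseteq> words n \<longrightarrow> (\<Sum>w\<in>S. (1 / (c * cont w)) powr (2 * \<rho>)) \<le> 1)"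
      unfolding SUP_le_iff ennreal_1[symmetric] by (auto simp: ennreal_le_iff simp del: ennreal_1)
    finally show ?thesis .
  qed
  then show ?thesis unfolding pre_s_def pre_s_set_def c_def by simp
qed

lemma one_divide_powr: "x > 0 \<Longrightarrow> (1 / x) powr s = x powr (- s)" for x :: real
  by (simp add: powr_minus inverse_powr divide_inverse)

text \<open>Without this the infimum over reals would say nothing. For \<rho> \<ge> 1 the sum of
  q^(-2\<rho>) is at most that of q^(-2), which is at most 2 by cylinder lengths, and c^(-2\<rho>)
  \<le> 1/2 for large \<rho> because c > 1.\<close>

lemma pre_s_set_nonempty:
  assumes "c > 1" shows "\<exists>\<rho>. \<rho> \<in> pre_s_set n c"
proof -
  obtain \<rho> where \<rho>: "\<rho> \<ge> 1" "2 * c powr (- 2 * \<rho>) \<le> 1"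
  proof -
    define \<rho> where "\<rho> = max 1 (ln 2 / (2 * ln c))"
    have "ln c > 0" using assms by simp
    moreover have "ln 2 / (2 * ln c) \<le> \<rho>" by (simp add: \<rho>_def)
    ultimately have "ln 2 \<le> 2 * \<rho> * ln c" by (simp add: pos_divide_le_eq mult_ac)
    then have "exp (ln 2 - 2 * \<rho> * ln c) \<le> exp 0" by (subst exp_le_cancel_iff) simp
    then have "2 * c powr (- 2 * \<rho>) \<le> 1" using assms by (simp add: exp_diff powr_def exp_minus divide_inverse)
    then show ?thesis using that[of \<rho>] by (simp add: \<rho>_def)
  qed
  have "(\<Sum>w\<in>S. (1 / (c * cont w)) powr (2 * \<rho>)) \<le> 1" if S: "finite S" "S \<subseteq> words n" for S
  proof -
    have "(\<Sum>w\<in>S. (1 / (c * cont w)) powr (2 * \<rho>)) \<le> (\<Sum>w\<in>S. c powr (- 2 * \<rho>) * cont w powr (- 2 * 1))"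
    proof (rule sum_mono)
      fix w assume "w \<in> S"
      then have w: "cont w \<ge> 1" using S cont_ge_1 by (auto simp: words_def)
      have "(1 / (c * cont w)) powr (2 * \<rho>) = c powr (- 2 * \<rho>) * cont w powr (- 2 * \<rho>)"
        using w assms by (subst one_divide_powr) (auto simp: powr_mult)
      also have "\<dots> \<le> c powr (- 2 * \<rho>) * cont w powr (- 2 * 1)"
      proof -
        have "cont w powr (- 2 * \<rho>) \<le> cont w powr (- 2 * 1)" using w \<rho>(1) by (intro powr_mono) linarith+
        then show ?thesis by (intro mult_left_mono) auto
      qed
      finally show "(1 / (c * cont w)) powr (2 * \<rho>) \<le> c powr (- 2 * \<rho>) * cont w powr (- 2 * 1)" .
    qed
    also have "\<dots> = c powr (- 2 * \<rho>) * wsum 1 S" by (simp add: wsum_def sum_distrib_left)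
    also have "\<dots> \<le> c powr (- 2 * \<rho>) * 2" using wsum_1_le[OF S] by (intro mult_left_mono) auto
    finally show ?thesis using \<rho> by linarith
  qed
  then have "\<rho> \<in> pre_s_set n c" using \<rho> by (auto simp: pre_s_set_def)
  then show ?thesis by blast
qed

lemma not_bounded_sum_powr:
  assumes "s \<le> 1"
  shows "\<exists>N. (\<Sum>a\<in>{1..N}. real a powr (- s)) > M"
proof (rule ccontr)
  assume "\<not> ?thesis"
  then have le: "(\<Sum>a\<in>{1..N}. real a powr (- s)) \<le> M" for N by (auto simp: not_less)
  have "summable (\<lambda>n. real n powr (- s))"
  proof (rule bounded_imp_summable)
    fix n show "(\<Sum>k\<le>n. real k powr (- s)) \<le> M"
    proof -
      have "(\<Sum>k\<le>n. real k powr (- s)) = (\<Sum>a\<in>{1..n}. real a powr (- s))"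
        by (rule sum.mono_neutral_right) (auto simp: not_le Suc_le_eq)
      then show ?thesis using le by simp
    qed
  qed simp
  then show False using assms by (simp add: summable_real_powr_iff)
qed

text \<open>The words a 1 ... 1 alone suffice: their q is at most a constant times a, and the series
  of a^(-2\<rho>) diverges for \<rho> \<le> 1/2.\<close>

lemma pre_s_set_gt_half:
  assumes "\<rho> \<in> pre_s_set n c" "n \<ge> 1" "c > 0"
  shows "\<rho> > 1 / 2"
proof (rule ccontr)
  assume "\<not> \<rho> > 1 / 2"
  then have \<rho>: "\<rho> \<ge> 0" "2 * \<rho> \<le> 1" using assms by (auto simp: pre_s_set_def)
  define v where "v = replicate (n - 1) (1::nat)"
  have v: "0 \<notin> set v" by (simp add: v_def)
  define C where "C = (c * 2 * cont v) powr (2 * \<rho>)"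
  have cv: "cont v \<ge> 1" using cont_ge_1[OF v] .
  have C0: "C > 0" using cv assms(3) by (simp add: C_def)
  obtain N where N: "(\<Sum>a\<in>{1..N}. real a powr (- (2 * \<rho>))) > C" using not_bounded_sum_powr[OF \<rho>(2)] by blast
  define S where "S = (\<lambda>a. a # v) ` {1..N}"
  have "S \<subseteq> words n" using v assms(2) by (auto simp: S_def words_def v_def)
  then have "1 \<ge> (\<Sum>w\<in>S. (1 / (c * cont w)) powr (2 * \<rho>))" using assms(1) by (simp add: pre_s_set_def S_def)
  also have "(\<Sum>w\<in>S. (1 / (c * cont w)) powr (2 * \<rho>)) = (\<Sum>a\<in>{1..N}. (1 / (c * cont (a # v))) powr (2 * \<rho>))"
    unfolding S_def by (subst sum.reindex) (auto simp: inj_on_def)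
  also have "\<dots> \<ge> (\<Sum>a\<in>{1..N}. real a powr (- (2 * \<rho>)) / C)"
  proof (rule sum_mono)
    fix a assume a: "a \<in> {1..N}"
    have "cont (a # v) \<le> 2 * cont [a] * cont v" using cont_append_bounds(2)[of "[a]" v] v a by simp
    then have le: "c * cont (a # v) \<le> real a * (c * 2 * cont v)" using assms(3) by simp
    have p: "0 < cont (a # v)" using cont_ge_1[of "a # v"] v a by auto
    have "real a powr (- (2 * \<rho>)) / C = (1 / (real a * (c * 2 * cont v))) powr (2 * \<rho>)"
    proof -
      have "real a * (c * 2 * cont v) > 0" using a cv assms(3) by (intro mult_pos_pos) auto
      then have "(1 / (real a * (c * 2 * cont v))) powr (2 * \<rho>) = (real a * (c * 2 * cont v)) powr (- (2 * \<rho>))"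
        by (rule one_divide_powr)
      also have "\<dots> = real a powr (- (2 * \<rho>)) * (c * 2 * cont v) powr (- (2 * \<rho>))" by (rule powr_mult)
      finally show ?thesis unfolding C_def powr_minus_divide[of "c * 2 * cont v"] by simp
    qed
    also have "\<dots> \<le> (1 / (c * cont (a # v))) powr (2 * \<rho>)"
      using le p assms(3) a cv \<rho> by (intro powr_mono2 divide_left_mono mult_pos_pos) auto
    finally show "real a powr (- (2 * \<rho>)) / C \<le> (1 / (c * cont (a # v))) powr (2 * \<rho>)" .
  qed
  also have "(\<Sum>a\<in>{1..N}. real a powr (- (2 * \<rho>)) / C) = (\<Sum>a\<in>{1..N}. real a powr (- (2 * \<rho>))) / C"
    by (rule sum_divide_distrib[symmetric])
  finally show False using N C0 by (simp add: pos_le_divide_eq field_simps)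
qed

lemma hausdorff_measure_0_mono:
  assumes "A \<subseteq> B" "hausdorff_measure s B = 0" shows "hausdorff_measure s A = 0"
proof -
  have "hausdorff_premeasure s \<delta> A \<le> hausdorff_premeasure s \<delta> B" for \<delta>
    unfolding hausdorff_premeasure_def using assms(1) by (intro INF_superset_mono) auto
  then have "hausdorff_measure s A \<le> hausdorff_measure s B" unfolding hausdorff_measure_def by (rule SUP_mono')
  then show ?thesis using assms(2) by simp
qed

text \<open>Membership of \<rho>1 bounds the sum of q^(-2\<rho>1) over words of length n by
  \<theta>^n with \<theta> = \<tau>^(2t), t = \<rho>1 \<gamma>/(1-\<gamma>). At exponent \<rho>
  growth and decay balance for the run share d = t/(\<rho> + t). This equals \<gamma> at \<rho>1 and
  drops below \<gamma> for \<rho> > \<rho>1, leaving room for some d < \<gamma>.\<close>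

lemma FG_dim_le:
  assumes \<alpha>: "0 \<le> \<alpha>" "\<alpha> < \<beta>" "\<beta> \<le> 1" and \<gamma>: "\<gamma> = \<beta>\<^sup>2 * (1 - \<alpha>) / (\<beta> - \<alpha>)" "0 < \<gamma>" "\<gamma> < 1"
    and n: "n \<ge> 1" and \<rho>1: "\<rho>1 \<in> pre_s_set n (golden powr (real n * \<gamma> / (1 - \<gamma>)))"
  shows "hausdorff_dim (F \<alpha> \<inter> G \<beta>) \<le> ereal \<rho>1"
proof (rule hausdorff_dim_le)
  define c where "c = golden powr (real n * \<gamma> / (1 - \<gamma>))"
  have c: "c > 1" unfolding c_def using n \<gamma>(2,3) golden_gt_1 by (intro gr_one_powr) auto
  have half: "\<rho>1 > 1 / 2" using pre_s_set_gt_half[OF \<rho>1 n] by simp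
  then show "0 \<le> \<rho>1" by simp
  fix \<rho> assume \<rho>: "\<rho> > \<rho>1"
  define t where "t = \<rho>1 * \<gamma> / (1 - \<gamma>)"
  define \<theta> where "\<theta> = golden powr (2 * t)"
  have t: "t > 0" using half \<gamma>(2,3) by (simp add: t_def)
  have \<theta>: "\<theta> \<ge> 1" unfolding \<theta>_def using t golden_gt_1 by (intro ge_one_powr_ge_zero) auto
  have \<theta>n: "\<theta> ^ n = c powr (2 * \<rho>1)"
    unfolding \<theta>_def c_def t_def by (simp add: powr_powr powr_realpow[symmetric] mult_ac)
  have H: "wsum \<rho> S \<le> \<theta> ^ n" if S: "finite S" "S \<subseteq> words n" for S
  proof -
    have "wsum \<rho> S \<le> (\<Sum>w\<in>S. c powr (2 * \<rho>1) * (1 / (c * cont w)) powr (2 * \<rho>1))"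
      unfolding wsum_def
    proof (rule sum_mono)
      fix w assume "w \<in> S"
      then have w: "cont w \<ge> 1" using S cont_ge_1 by (auto simp: words_def)
      have "cont w powr (- 2 * \<rho>) \<le> cont w powr (- 2 * \<rho>1)" using w \<rho> by (intro powr_mono) auto
      also have "\<dots> = c powr (2 * \<rho>1) * (1 / (c * cont w)) powr (2 * \<rho>1)"
      proof -
        have "(1 / (c * cont w)) powr (2 * \<rho>1) = (c * cont w) powr (- (2 * \<rho>1))"
          using w c by (intro one_divide_powr mult_pos_pos) auto
        also have "\<dots> = c powr (- (2 * \<rho>1)) * cont w powr (- (2 * \<rho>1))" by (rule powr_mult)
        finally show ?thesis using c by (simp add: powr_minus)
      qed
      finally show "cont w powr (- 2 * \<rho>) \<le> c powr (2 * \<rho>1) * (1 / (c * cont w)) powr (2 * \<rho>1)" .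
    qed
    also have "\<dots> = c powr (2 * \<rho>1) * (\<Sum>w\<in>S. (1 / (c * cont w)) powr (2 * \<rho>1))" by (rule sum_distrib_left[symmetric])
    also have "\<dots> \<le> c powr (2 * \<rho>1) * 1" using \<rho>1 S unfolding c_def[symmetric] by (intro mult_left_mono) (auto simp: pre_s_set_def)
    finally show ?thesis unfolding \<theta>n by simp
  qed
  have rh: "\<rho> > 1 / 2" using half \<rho> by simp
  obtain D where D: "D \<ge> 1" "\<And>m S. finite S \<Longrightarrow> S \<subseteq> words m \<Longrightarrow> wsum \<rho> S \<le> D * \<theta> ^ m"
    using wsum_growth[OF rh n \<theta> H] by blast
  have "t / (\<rho> + t) < t / (\<rho>1 + t)" using t \<rho> half by (intro divide_strict_left_mono) auto
  also have "t / (\<rho>1 + t) = \<gamma>" using half \<gamma>(2,3) unfolding t_def by (simp add: divide_simps) (simp add: algebra_simps)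
  finally obtain d where d: "t / (\<rho> + t) < d" "d < \<gamma>" using dense by blast
  have "t < d * (\<rho> + t)" using d(1) t rh by (simp add: pos_divide_less_eq)
  then have "(1 - d) * t < \<rho> * d" by (simp add: algebra_simps)
  then have "(1 - d) * t * (2 * ln golden) < \<rho> * d * (2 * ln golden)" using golden_gt_1 by (intro mult_strict_right_mono) auto
  then have d': "(1 - d) * ln \<theta> < 2 * \<rho> * d * ln golden" by (simp add: \<theta>_def ln_powr mult_ac)
  obtain K where "F \<alpha> \<inter> G \<beta> \<subseteq> run_limsup K d" using FG_subset_run_limsup[OF \<alpha>, of d] d(2) \<gamma>(1) by blast
  then show "hausdorff_measure \<rho> (F \<alpha> \<inter> G \<beta>) = 0"
    using run_limsup_null[OF rh \<theta> D(1) D(2) d'] hausdorff_measure_0_mono by blast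
qed

text \<open>With \<gamma> = 1 the share d can be taken so close to 1 that the decay of the runs
  beats any finite growth rate of the free part, and that rate is finite as soon as \<rho> >
  1/2.\<close>

lemma FG_dim_le_half:
  assumes \<alpha>: "0 \<le> \<alpha>" "\<alpha> < \<beta>" "\<beta> \<le> 1" and \<gamma>: "1 = \<beta>\<^sup>2 * (1 - \<alpha>) / (\<beta> - \<alpha>)"
  shows "hausdorff_dim (F \<alpha> \<inter> G \<beta>) \<le> ereal (1 / 2)"
proof (rule hausdorff_dim_le)
  fix \<rho> :: real assume \<rho>: "\<rho> > 1 / 2"
  obtain Z where Z: "Z \<ge> 1" "\<And>S. finite S \<Longrightarrow> S \<subseteq> words 1 \<Longrightarrow> wsum \<rho> S \<le> Z"
    using wsum_letters[OF \<rho>] by blast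
  obtain D where D: "D \<ge> 1" "\<And>m S. finite S \<Longrightarrow> S \<subseteq> words m \<Longrightarrow> wsum \<rho> S \<le> D * Z ^ m"
    using wsum_growth[OF \<rho>, of 1 Z] Z by auto
  define t where "t = 2 * \<rho> * ln golden"
  have t: "t > 0" "ln Z \<ge> 0" using \<rho> golden_gt_1 Z by (auto simp: t_def)
  have "ln Z / (t + ln Z) < 1" using t by simp
  then obtain d where d: "ln Z / (t + ln Z) < d" "d < 1" using dense by blast
  have "ln Z < d * (t + ln Z)" using d(1) t by (simp add: pos_divide_less_eq)
  then have d': "(1 - d) * ln Z < 2 * \<rho> * d * ln golden" by (simp add: t_def algebra_simps)
  obtain K where "F \<alpha> \<inter> G \<beta> \<subseteq> run_limsup K d" using FG_subset_run_limsup[OF \<alpha>, of d] d(2) \<gamma> by auto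
  then show "hausdorff_measure \<rho> (F \<alpha> \<inter> G \<beta>) = 0"
    using run_limsup_null[OF \<rho> Z(1) D(1) D(2) d'] hausdorff_measure_0_mono by blast
qed simp

section \<open>Mass distribution on a tree of words\<close>

definition cat :: "(nat \<Rightarrow> nat list) \<Rightarrow> nat \<Rightarrow> nat list" where
  "cat c k = concat (map c [0..<k])"

text \<open>With nonempty words, the first n + 1 of them contain at least n + 1 digits, so position
  n exists there.\<close>

definition digits :: "(nat \<Rightarrow> nat list) \<Rightarrow> nat \<Rightarrow> nat" where
  "digits c n = cat c (Suc n) ! n"

lemma cat_0 [simp]: "cat c 0 = []" by (simp add: cat_def)
lemma cat_Suc: "cat c (Suc k) = cat c k @ c k" by (simp add: cat_def)

lemma cat_prefix: "j \<le> k \<Longrightarrow> \<exists>v. cat c k = cat c j @ v"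
  by (induction k rule: dec_induct) (auto simp: cat_Suc)

lemma length_cat_ge: "(\<And>i. c i \<noteq> []) \<Longrightarrow> k \<le> length (cat c k)"
proof (induction k)
  case (Suc k)
  have "length (c k) \<ge> 1" using Suc.prems[of k] by (simp add: Suc_le_eq)
  then show ?case using Suc by (simp add: cat_Suc)
qed simp

lemma cat_nth:
  assumes "n < length (cat c j)" "n < length (cat c k)"
  shows "cat c j ! n = cat c k ! n"
proof (cases "j \<le> k")
  case True
  then obtain v where "cat c k = cat c j @ v" using cat_prefix by blast
  then show ?thesis using assms by (simp add: nth_append)
next
  case False
  then obtain v where "cat c j = cat c k @ v" using cat_prefix[of k j c] by auto
  then show ?thesis using assms by (simp add: nth_append)
qed

lemma digits_nth:
  assumes "\<And>i. c i \<noteq> []" "n < length (cat c k)"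
  shows "digits c n = cat c k ! n"
  unfolding digits_def using length_cat_ge[of c "Suc n"] assms by (intro cat_nth) auto

lemma pre_digits:
  assumes "\<And>i. c i \<noteq> []" "n \<le> length (cat c k)"
  shows "pre (digits c) n = take n (cat c k)"
  using assms by (intro nth_equalityI) (auto simp: digits_nth[of c _ k])

lemma cat_cong: "(\<And>i. i < k \<Longrightarrow> c i = d i) \<Longrightarrow> cat c k = cat d k"
  unfolding cat_def by (intro arg_cong[of _ _ concat] map_cong) auto

lemma set_cat: "set (cat c k) = (\<Union>i<k. set (c i))"
  by (auto simp: cat_def)

lemma posseq_digits:
  assumes "\<And>i. c i \<noteq> []" "\<And>i. 0 \<notin> set (c i)"
  shows "posseq (digits c)"
  unfolding posseq_def
proof
  fix n
  have "n < length (cat c (Suc n))" using length_cat_ge[of c "Suc n"] assms(1) by simp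
  then have "digits c n \<in> set (cat c (Suc n))" unfolding digits_def by (rule nth_mem)
  then show "digits c n \<noteq> 0" using assms(2) unfolding set_cat by (metis UN_E)
qed

lemma cont_cat_le:
  assumes "\<And>i. 0 \<notin> set (c i)"
  shows "cont (cat c k) \<le> 2 ^ k * (\<Prod>i<k. cont (c i))"
proof (induction k)
  case (Suc k)
  have z: "0 \<notin> set (cat c k)" using assms by (simp add: set_cat)
  have "cont (cat c (Suc k)) \<le> 2 * cont (cat c k) * cont (c k)"
    unfolding cat_Suc by (rule cont_append_bounds(2)[OF z assms])
  also have "\<dots> \<le> 2 * (2 ^ k * (\<Prod>i<k. cont (c i))) * cont (c k)"
    using Suc cont_ge_1[OF assms[of k]] by (intro mult_right_mono mult_left_mono) auto
  finally show ?case by (simp add: mult_ac)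
qed simp

text \<open>Words are chosen level by level, independently. The measure lives on the choice
  sequences, not on the reals, so nothing has to be pushed forward along
  \<open>cf_lim\<close>.\<close>

locale word_tree =
  fixes W :: "nat \<Rightarrow> nat list set" and \<rho> :: real
  assumes finite_W: "finite (W i)" and W_nonempty: "W i \<noteq> {}"
    and W_word: "w \<in> W i \<Longrightarrow> w \<noteq> [] \<and> 0 \<notin> set w" and \<rho>_pos: "\<rho> > 0"
begin

definition paths :: "(nat \<Rightarrow> nat list) set" where
  "paths = {c. \<forall>i. c i \<in> W i}"

text \<open>The factor $4^\rho$ pays for \<open>cont (u @ v) \<le> 2 * cont u * cont v\<close> at each concatenation.\<close>

definition Z :: "nat \<Rightarrow> real" where
  "Z i = (\<Sum>w\<in>W i. cont w powr (- 2 * \<rho>)) / 4 powr \<rho>"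

definition branch :: "nat \<Rightarrow> nat list measure" where
  "branch i = point_measure (W i) (\<lambda>w. ennreal (cont w powr (- 2 * \<rho>) / (\<Sum>w\<in>W i. cont w powr (- 2 * \<rho>))))"

lemma cont_pos: "w \<in> W i \<Longrightarrow> cont w > 0"
  using cont_ge_1 W_word by (meson less_le_trans zero_less_one)

lemma sum_pos: "(\<Sum>w\<in>W i. cont w powr (- 2 * \<rho>)) > 0"
  using finite_W W_nonempty cont_pos by (intro sum_pos) fastforce+

lemma Z_pos: "Z i > 0"
  using sum_pos by (simp add: Z_def)

lemma emeasure_branch:
  "w \<in> W i \<Longrightarrow> emeasure (branch i) {w} = ennreal (cont w powr (- 2 * \<rho>) / (\<Sum>w\<in>W i. cont w powr (- 2 * \<rho>)))"
  unfolding branch_def using finite_W by (subst emeasure_point_measure_finite2) auto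

lemma space_branch: "space (branch i) = W i" and sets_branch: "sets (branch i) = Pow (W i)"
  by (auto simp: branch_def space_point_measure sets_point_measure)

lemma prob_branch: "prob_space (branch i)"
proof
  have "emeasure (branch i) (space (branch i)) = (\<Sum>w\<in>W i. ennreal (cont w powr (- 2 * \<rho>) / (\<Sum>w\<in>W i. cont w powr (- 2 * \<rho>))))"
    unfolding space_branch using finite_W unfolding branch_def by (subst emeasure_point_measure_finite) auto
  also have "\<dots> = ennreal (\<Sum>w\<in>W i. cont w powr (- 2 * \<rho>) / (\<Sum>w\<in>W i. cont w powr (- 2 * \<rho>)))"
    using sum_pos[of i] by (intro sum_ennreal) auto
  also have "(\<Sum>w\<in>W i. cont w powr (- 2 * \<rho>) / (\<Sum>w\<in>W i. cont w powr (- 2 * \<rho>))) = 1"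
    using sum_pos[of i] by (simp flip: sum_divide_distrib)
  finally show "emeasure (branch i) (space (branch i)) = 1" by simp
qed

definition \<mu> :: "(nat \<Rightarrow> nat list) measure" where
  "\<mu> = PiM UNIV branch"

lemma space_\<mu>: "space \<mu> = paths"
  by (auto simp: \<mu>_def space_PiM space_branch paths_def PiE_iff)

lemma emeasure_paths: "emeasure \<mu> paths = 1"
proof -
  interpret prob_space \<mu> unfolding \<mu>_def by (rule prob_space_PiM) (rule prob_branch)
  show ?thesis using emeasure_space_1 by (simp add: space_\<mu>)
qed

definition pcyl :: "(nat \<Rightarrow> nat list) \<Rightarrow> nat \<Rightarrow> (nat \<Rightarrow> nat list) set" where
  "pcyl c k = {d \<in> paths. \<forall>i<k. d i = c i}"

lemma pcyl_measure:
  assumes "c \<in> paths"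
  shows "pcyl c k \<in> sets \<mu>" "emeasure \<mu> (pcyl c k) \<le> ennreal (cont (cat c k) powr (- 2 * \<rho>) / (\<Prod>i<k. Z i))"
proof -
  interpret product_prob_space branch UNIV
    by (intro product_prob_space.intro product_sigma_finite.intro prob_space_imp_sigma_finite prob_branch
        product_prob_space_axioms.intro)
  have c: "c i \<in> W i" for i using assms by (simp add: paths_def)
  then have z: "0 \<notin> set (c i)" for i using W_word by blast
  have e: "pcyl c k = {d \<in> space (PiM UNIV branch). \<forall>i\<in>{..<k}. d i \<in> {c i}}"
    using space_\<mu> by (auto simp: pcyl_def \<mu>_def)
  show "pcyl c k \<in> sets \<mu>" unfolding e \<mu>_def
    using c by (intro sets.sets_Collect_finite_All sets_Collect_single) (auto simp: sets_branch)
  have "emeasure \<mu> (pcyl c k) = (\<Prod>i<k. emeasure (branch i) {c i})"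
    unfolding e \<mu>_def using c by (intro emeasure_PiM_Collect) (auto simp: sets_branch)
  also have "\<dots> = (\<Prod>i<k. ennreal (cont (c i) powr (- 2 * \<rho>) / (4 powr \<rho> * Z i)))"
    using c by (simp add: emeasure_branch Z_def)
  also have "\<dots> = ennreal (\<Prod>i<k. cont (c i) powr (- 2 * \<rho>) / (4 powr \<rho> * Z i))"
    by (simp add: prod_ennreal divide_nonneg_nonneg less_imp_le Z_pos)
  \<comment> \<open>The k factors 4^\<rho> combine to (2^k)^(2\<rho>), exactly what
    \<open>cont_cat_le\<close> loses.\<close>
  also have "(\<Prod>i<k. cont (c i) powr (- 2 * \<rho>) / (4 powr \<rho> * Z i)) = (2 ^ k * (\<Prod>i<k. cont (c i))) powr (- 2 * \<rho>) / (\<Prod>i<k. Z i)"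
  proof -
    have p: "(\<Prod>i<k. cont (c i)) powr (- 2 * \<rho>) = (\<Prod>i<k. cont (c i) powr (- 2 * \<rho>))"
      by (rule prod_powr_distrib)
    have "(2 ^ k :: real) powr (- 2 * \<rho>) = (\<Prod>i<k. 1 / 4 powr \<rho>)"
    proof -
      have "(2 ^ k :: real) powr (- 2 * \<rho>) = (2 powr (- 2 * \<rho>)) ^ k" by (simp add: powr_realpow[symmetric] powr_powr mult.commute)
      also have "(2::real) powr (- 2 * \<rho>) = 1 / 4 powr \<rho>"
      proof -
        have "(2::real) powr (- 2 * \<rho>) = (2 powr 2) powr (- \<rho>)" by (simp only: powr_powr) simp
        then show ?thesis by (simp add: powr_minus divide_inverse)
      qed
      finally show ?thesis by simp
    qed
    then have "(2 ^ k * (\<Prod>i<k. cont (c i))) powr (- 2 * \<rho>) = (\<Prod>i<k. 1 / 4 powr \<rho>) * (\<Prod>i<k. cont (c i) powr (- 2 * \<rho>))"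
      unfolding powr_mult p by (simp only:)
    then show ?thesis by (simp add: prod_dividef prod.distrib power_one_over)
  qed
  also have "\<dots> \<le> cont (cat c k) powr (- 2 * \<rho>) / (\<Prod>i<k. Z i)"
  proof (rule divide_right_mono)
    have "cont (cat c k) > 0" using cont_ge_1[of "cat c k"] z by (simp add: set_cat)
    then show "(2 ^ k * (\<Prod>i<k. cont (c i))) powr (- 2 * \<rho>) \<le> cont (cat c k) powr (- 2 * \<rho>)"
      using cont_cat_le[of c k] z \<rho>_pos by (intro powr_mono2') auto
  qed (use Z_pos in \<open>simp add: prod_nonneg less_imp_le\<close>)
  finally show "emeasure \<mu> (pcyl c k) \<le> ennreal (cont (cat c k) powr (- 2 * \<rho>) / (\<Prod>i<k. Z i))"
    by (simp add: ennreal_leI)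
qed

text \<open>Serves sets met by a single path, whose diameter may be 0: a path has arbitrarily small
  cylinders, since q tends to infinity while the normalising products are at least \<open>c0\<close>
  infinitely often.\<close>

lemma pcyl_small:
  assumes c: "c \<in> paths" and c0: "c0 > 0" and inf: "\<exists>\<^sub>\<infinity>k. c0 \<le> (\<Prod>i<k. Z i)" and e: "e > 0"
  shows "\<exists>k. emeasure \<mu> (pcyl c k) \<le> ennreal e"
proof -
  have cW: "c i \<noteq> []" "0 \<notin> set (c i)" for i using c W_word by (auto simp: paths_def)
  have "(\<lambda>n. (golden\<^sup>2 / (golden^2) ^ n) powr \<rho>) \<longlonglongrightarrow> 0 powr \<rho>"
    using \<rho>_pos by (intro tendsto_powr2 inv_cont_tendsto_0) auto
  then have "\<forall>\<^sub>F n in sequentially. (golden\<^sup>2 / (golden^2) ^ n) powr \<rho> < c0 * e"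
    using c0 e by (intro order_tendstoD(2)) auto
  then obtain N where N: "\<And>n. n \<ge> N \<Longrightarrow> (golden\<^sup>2 / (golden^2) ^ n) powr \<rho> < c0 * e"
    unfolding eventually_sequentially by blast
  obtain k where k: "k \<ge> N" "c0 \<le> (\<Prod>i<k. Z i)" using inf unfolding INFM_nat_le by blast
  have z: "0 \<notin> set (cat c k)" using cW by (simp add: set_cat)
  have cp: "cont (cat c k) > 0" using cont_ge_1[OF z] by simp
  have "cont (cat c k) powr (- 2 * \<rho>) = (1 / (cont (cat c k))\<^sup>2) powr \<rho>"
  proof -
    have "1 / (cont (cat c k))\<^sup>2 = cont (cat c k) powr (-2)" using cp by (simp add: powr_minus powr_numeral divide_inverse)
    then show ?thesis by (simp add: powr_powr)
  qed
  also have "\<dots> \<le> (golden\<^sup>2 / (golden^2) ^ length (cat c k)) powr \<rho>"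
    using inv_cont_sq_le[OF z] \<rho>_pos cp by (intro powr_mono2) auto
  also have "\<dots> < c0 * e" using length_cat_ge[of c k] cW(1) k(1) by (intro N) auto
  finally have "cont (cat c k) powr (- 2 * \<rho>) \<le> c0 * e" by simp
  then have "cont (cat c k) powr (- 2 * \<rho>) / (\<Prod>i<k. Z i) \<le> c0 * e / c0"
    using k(2) c0 e by (intro frac_le) auto
  then have "ennreal (cont (cat c k) powr (- 2 * \<rho>) / (\<Prod>i<k. Z i)) \<le> ennreal e" using c0 by (intro ennreal_leI) simp
  then show ?thesis using pcyl_measure(2)[OF c, of k] order_trans by blast
qed

text \<open>Mass distribution principle. Paths parting at level k are at least 1/(\<Delta> q^2)
  apart, and the cylinder up to level k has mass at most q^(-2\<rho>) divided by the product of the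
  \<open>Z i\<close>, so this product has to stay above a constant times \<Delta>^\<rho>. Covering
  sets are arbitrary; each preimage is therefore enlarged to a measurable cylinder before masses are
  added.\<close>

theorem dim_ge:
  assumes A: "\<And>c. c \<in> paths \<Longrightarrow> cf_lim (digits c) \<in> A"
    and c0: "c0 > 0" and inf: "\<exists>\<^sub>\<infinity>k. c0 \<le> (\<Prod>i<k. Z i)"
    and sep: "\<And>c d k. c \<in> paths \<Longrightarrow> d \<in> paths \<Longrightarrow> (\<And>i. i < k \<Longrightarrow> c i = d i) \<Longrightarrow> c k \<noteq> d k \<Longrightarrow>
      \<Delta> k > 0 \<and> 1 / (\<Delta> k * (cont (cat c k))\<^sup>2) \<le> \<bar>cf_lim (digits c) - cf_lim (digits d)\<bar> \<and>
      c0 * \<Delta> k powr \<rho> \<le> (\<Prod>i<k. Z i)"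
  shows "ereal \<rho> \<le> hausdorff_dim A"
proof (rule hausdorff_dim_ge)
  show "ennreal c0 > 0" "\<rho> \<ge> 0" using c0 \<rho>_pos by auto
  fix U :: "nat \<Rightarrow> real set"
  assume cov: "A \<subseteq> (\<Union>i. U i)" and U: "\<And>i. bounded (U i) \<and> diameter (U i) \<le> 1"
  have piece: "\<exists>V\<in>sets \<mu>. {c \<in> paths. cf_lim (digits c) \<in> U i} \<subseteq> V \<and>
    emeasure \<mu> V \<le> diam_pow \<rho> (U i) / ennreal c0 + ennreal e" if e: "e > 0" for i e
  proof -
    define E where "E = {c \<in> paths. cf_lim (digits c) \<in> U i}"
    consider "E = {}" | c where "c \<in> E" "\<And>d. d \<in> E \<Longrightarrow> d = c" | c d where "c \<in> E" "d \<in> E" "c \<noteq> d" by blast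
    \<comment> \<open>A set containing two points is charged to the smallest cylinder containing both.\<close>
    then have "\<exists>V\<in>sets \<mu>. E \<subseteq> V \<and> emeasure \<mu> V \<le> diam_pow \<rho> (U i) / ennreal c0 + ennreal e"
    proof cases
      case 1
      show ?thesis by (intro bexI[of _ "{}"] conjI) (simp_all add: 1)
    next
      case 2
      have c: "c \<in> paths" using 2(1) unfolding E_def by blast
      obtain k where k: "emeasure \<mu> (pcyl c k) \<le> ennreal e" using pcyl_small[OF c c0 inf e] by blast
      have "d \<in> pcyl c k" if "d \<in> E" for d using 2(2)[OF that] c by (simp add: pcyl_def)
      then have "E \<subseteq> pcyl c k" by blast
      moreover have "emeasure \<mu> (pcyl c k) \<le> diam_pow \<rho> (U i) / ennreal c0 + ennreal e"
        using k by (rule order_trans) (simp add: add_increasing)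
      ultimately show ?thesis using pcyl_measure(1)[OF c] by blast
    next
      case 3
      define P where "P k \<longleftrightarrow> (\<exists>c\<in>E. \<exists>d\<in>E. c k \<noteq> d k)" for k
      have "\<exists>k. P k" using 3 by (auto simp: P_def fun_eq_iff)
      define k where "k = (LEAST k. P k)"
      have "P k" unfolding k_def using \<open>\<exists>k. P k\<close> by (rule LeastI_ex)
      then obtain c d where cd: "c \<in> E" "d \<in> E" "c k \<noteq> d k" by (auto simp: P_def)
      have agree: "c' j = d' j" if "c' \<in> E" "d' \<in> E" "j < k" for c' d' j
        using not_less_Least[of j P] that by (auto simp: P_def k_def)
      have pc: "c \<in> paths" "d \<in> paths" using cd by (auto simp: E_def)
      have s: "\<Delta> k > 0" "1 / (\<Delta> k * (cont (cat c k))\<^sup>2) \<le> \<bar>cf_lim (digits c) - cf_lim (digits d)\<bar>"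
        "c0 * \<Delta> k powr \<rho> \<le> (\<Prod>i<k. Z i)"
        using sep[OF pc agree[OF cd(1,2)] cd(3)] by auto
      have dm: "\<bar>cf_lim (digits c) - cf_lim (digits d)\<bar> \<le> diameter (U i)"
        using diameter_bounded_bound[of "U i"] U cd by (auto simp: E_def dist_real_def)
      have cW: "0 \<notin> set (c i)" for i using pc(1) W_word by (auto simp: paths_def)
      have cp: "cont (cat c k) > 0" using cont_ge_1[of "cat c k"] cW by (simp add: set_cat)
      have "cont (cat c k) powr (- 2 * \<rho>) / (\<Prod>i<k. Z i) \<le> cont (cat c k) powr (- 2 * \<rho>) / (c0 * \<Delta> k powr \<rho>)"
        using s c0 by (intro divide_left_mono mult_pos_pos prod_pos) (auto simp: Z_pos)
      also have "\<dots> = (1 / (\<Delta> k * (cont (cat c k))\<^sup>2)) powr \<rho> / c0"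
      proof -
        have "(cont (cat c k))\<^sup>2 = cont (cat c k) powr 2" using cp by (simp add: powr_numeral)
        then have "(1 / (\<Delta> k * (cont (cat c k))\<^sup>2)) powr \<rho> = \<Delta> k powr (- \<rho>) * (cont (cat c k) powr 2) powr (- \<rho>)"
          using cp s(1) by (subst one_divide_powr) (auto simp: powr_mult)
        then show ?thesis using s(1) by (simp add: powr_powr powr_minus divide_inverse)
      qed
      also have "\<dots> \<le> diameter (U i) powr \<rho> / c0"
        using s dm c0 \<rho>_pos cp by (intro divide_right_mono powr_mono2) auto
      finally have "ennreal (cont (cat c k) powr (- 2 * \<rho>) / (\<Prod>i<k. Z i)) \<le> ennreal (diameter (U i) powr \<rho> / c0)"
        by (rule ennreal_leI)
      also have "\<dots> = ennreal (diameter (U i) powr \<rho>) / ennreal c0" using c0 by (simp add: divide_ennreal)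
      also have "ennreal (diameter (U i) powr \<rho>) = diam_pow \<rho> (U i)"
        using cd \<rho>_pos by (auto simp: E_def diam_pow_def)
      finally have "emeasure \<mu> (pcyl c k) \<le> diam_pow \<rho> (U i) / ennreal c0"
        using pcyl_measure(2)[OF pc(1), of k] by (rule order_trans[rotated])
      then have "emeasure \<mu> (pcyl c k) \<le> diam_pow \<rho> (U i) / ennreal c0 + ennreal e"
        by (rule order_trans) simp
      moreover have "E \<subseteq> pcyl c k" using agree cd(1) by (auto simp: pcyl_def E_def)
      ultimately show ?thesis using pcyl_measure(1)[OF pc(1)] by blast
    qed
    then show ?thesis unfolding E_def .
  qed
  define S where "S = (\<Sum>i. diam_pow \<rho> (U i))"
  have "1 \<le> S / ennreal c0 + ennreal e" if e: "e > 0" for e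
  proof -
    have "\<exists>V. \<forall>i. V i \<in> sets \<mu> \<and> {c \<in> paths. cf_lim (digits c) \<in> U i} \<subseteq> V i \<and>
      emeasure \<mu> (V i) \<le> diam_pow \<rho> (U i) / ennreal c0 + ennreal (e * (1/2) ^ Suc i)"
    proof (rule choice, rule allI)
      fix i
      have "e * (1/2) ^ Suc i > 0" using e by simp
      from piece[OF this, of i]
      show "\<exists>V. V \<in> sets \<mu> \<and> {c \<in> paths. cf_lim (digits c) \<in> U i} \<subseteq> V \<and>
        emeasure \<mu> V \<le> diam_pow \<rho> (U i) / ennreal c0 + ennreal (e * (1/2) ^ Suc i)" by blast
    qed
    then obtain V where V: "\<And>i. V i \<in> sets \<mu>" "\<And>i. {c \<in> paths. cf_lim (digits c) \<in> U i} \<subseteq> V i"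
      "\<And>i. emeasure \<mu> (V i) \<le> diam_pow \<rho> (U i) / ennreal c0 + ennreal (e * (1/2) ^ Suc i)" by blast
    have "paths \<subseteq> (\<Union>i. V i)"
    proof
      fix c assume c: "c \<in> paths"
      then obtain i where "cf_lim (digits c) \<in> U i" using A cov by blast
      then show "c \<in> (\<Union>i. V i)" using V(2)[of i] c by blast
    qed
    then have "emeasure \<mu> paths \<le> emeasure \<mu> (\<Union>i. V i)" using V(1) by (intro emeasure_mono) auto
    also have "\<dots> \<le> (\<Sum>i. emeasure \<mu> (V i))" using V(1) by (intro emeasure_subadditive_countably) auto
    also have "\<dots> \<le> (\<Sum>i. diam_pow \<rho> (U i) / ennreal c0 + ennreal (e * (1/2) ^ Suc i))"
      using V(3) by (intro suminf_le summableI) auto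
    also have "\<dots> = (\<Sum>i. diam_pow \<rho> (U i) / ennreal c0) + (\<Sum>i. ennreal (e * (1/2) ^ Suc i))"
      by (rule suminf_add[symmetric]) (auto intro: summableI)
    also have "(\<Sum>i. diam_pow \<rho> (U i) / ennreal c0) = S / ennreal c0" unfolding S_def by (rule ennreal_suminf_divide)
    also have "(\<Sum>i. ennreal (e * (1/2) ^ Suc i)) = ennreal e"
    proof -
      have "(\<lambda>i. e * (1/2) ^ Suc i) sums (e * 1)" by (intro sums_mult power_half_series)
      then show ?thesis using e by (intro suminf_ennreal_eq) auto
    qed
    finally show ?thesis unfolding emeasure_paths .
  qed
  then have "1 \<le> S / ennreal c0" by (rule ennreal_le_epsilon)
  then have "ennreal c0 * 1 \<le> ennreal c0 * (S / ennreal c0)" by (rule mult_left_mono) simp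
  also have "\<dots> = S * ennreal c0 / ennreal c0" unfolding ennreal_times_divide by (simp only: mult.commute)
  also have "\<dots> = S" using c0 by (intro mult_divide_eq_ennreal) auto
  finally show "ennreal c0 \<le> (\<Sum>i. diam_pow \<rho> (U i))" by (simp add: S_def)
qed

end

section \<open>Sequences with prescribed runs\<close>

lemma common_prefix:
  assumes "length w = length w'" "w \<noteq> w'"
  shows "\<exists>p a a' r r'. w = p @ a # r \<and> w' = p @ a' # r' \<and> a \<noteq> a'"
  using assms
proof (induction w w' rule: list_induct2)
  case (Cons x xs y ys)
  show ?case
  proof (cases "x = y")
    case True
    then have "xs \<noteq> ys" using Cons.prems by simp
    then obtain p a a' r r' where "xs = p @ a # r" "ys = p @ a' # r'" "a \<noteq> a'" using Cons.IH by blast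
    then have "x # xs = (x # p) @ a # r" "y # ys = (x # p) @ a' # r'" "a \<noteq> a'" using True by auto
    then show ?thesis by blast
  next
    case False
    then have "x # xs = [] @ x # xs" "y # ys = [] @ y # ys" "x \<noteq> y" by auto
    then show ?thesis by blast
  qed
qed simp

text \<open>
  The common suffix ensures that the digit following the first difference still lies inside the
  two words, where it is bounded by \<open>B\<close>.
\<close>

lemma separation:
  assumes u: "0 \<notin> set u" and w: "0 \<notin> set w" "0 \<notin> set w'" "\<forall>a\<in>set w \<union> set w'. a \<le> B"
    and len: "length w = length w'" "w \<noteq> w'" and tl: "w = v @ [x, y]" "w' = v' @ [x, y]"
    and X: "0 \<le> X" "X \<le> 1" "0 \<le> Y" "Y \<le> 1"
  shows "1 / (16 * (real B + 1) ^ (2 * length w + 3) * (cont u)\<^sup>2) \<le> \<bar>cfmap (u @ w) X - cfmap (u @ w') Y\<bar>"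
proof -
  obtain p a a' r r' where d: "w = p @ a # r" "w' = p @ a' # r'" "a \<noteq> a'" using common_prefix[OF len] by blast
  have lr: "length r = length r'" using len d by simp
  have rne: "r \<noteq> []"
  proof
    assume r: "r = []"
    then have r': "r' = []" using lr by simp
    have "last w = a" unfolding d(1) r by simp
    moreover have "last w' = a'" unfolding d(2) r' by simp
    moreover have "last w = y" "last w' = y" unfolding tl by simp_all
    ultimately show False using d(3) by simp
  qed
  have pos: "0 \<notin> set p" "a \<ge> 1" "a' \<ge> 1" "0 \<notin> set r" "0 \<notin> set r'" "a \<le> B" "a' \<le> B"
    using w d by (auto simp: Suc_le_eq)
  \<comment> \<open>A nonempty remainder starts with a digit at most B, so its value is at least
    1/(B+1). Two remainders then differ by at most 1 - 1/(B+1), and after distinct digits a distance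
    of 1/(B+1) is left.\<close>
  have tail: "1 / (real B + 1) \<le> cfmap r X \<and> cfmap r X \<le> 1" if h: "r \<noteq> []" "0 \<notin> set r" "\<forall>a\<in>set r. a \<le> B" "0 \<le> X" "X \<le> 1" for r X
  proof -
    obtain c r2 where r: "r = c # r2" using h(1) by (cases r) auto
    have c: "c \<ge> 1" "c \<le> B" "0 \<notin> set r2" using h r by (auto simp: Suc_le_eq)
    have "0 \<le> cfmap r2 X \<and> cfmap r2 X \<le> 1" using cfmap_range[OF c(3) h(4,5)] .
    then show ?thesis using c unfolding r by (auto simp: divide_simps)
  qed
  define \<xi> \<eta> where "\<xi> = cfmap r X" and "\<eta> = cfmap r' Y"
  have xi: "1 / (real B + 1) \<le> \<xi>" "\<xi> \<le> 1" using tail[of r X] rne pos w d X by (auto simp: \<xi>_def)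
  have rne': "r' \<noteq> []" using rne lr by auto
  have eta: "1 / (real B + 1) \<le> \<eta>" "\<eta> \<le> 1" using tail[of r' Y] rne' pos w d X by (auto simp: \<eta>_def)
  have Bp: "1 / (real B + 1) > 0" by simp
  have "1 \<le> \<bar>real a - real a'\<bar>" using d(3) by linarith
  then have num: "1 / (real B + 1) \<le> \<bar>(real a' + \<eta>) - (real a + \<xi>)\<bar>" using xi eta by linarith
  have den: "real a + \<xi> > 0" "real a' + \<eta> > 0" "real a + \<xi> \<le> real B + 1" "real a' + \<eta> \<le> real B + 1"
    using xi eta pos Bp by linarith+
  have "1 / (real B + 1) / ((real B + 1) * (real B + 1)) \<le> \<bar>(real a' + \<eta>) - (real a + \<xi>)\<bar> / ((real a + \<xi>) * (real a' + \<eta>))"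
    using num den Bp by (intro frac_le mult_mono mult_pos_pos) (auto intro: order_trans)
  also have "\<dots> = \<bar>cfmap (a # r) X - cfmap (a' # r') Y\<bar>"
  proof -
    have "cfmap (a # r) X - cfmap (a' # r') Y = ((real a' + \<eta>) - (real a + \<xi>)) / ((real a + \<xi>) * (real a' + \<eta>))"
      using den unfolding cfmap.simps \<xi>_def[symmetric] \<eta>_def[symmetric] by (simp add: diff_frac_eq)
    then show ?thesis using den by (simp add: abs_mult)
  qed
  finally have inner: "1 / (real B + 1) ^ 3 \<le> \<bar>cfmap (a # r) X - cfmap (a' # r') Y\<bar>" by (simp add: power3_eq_cube mult_ac)
  have zup: "0 \<notin> set (u @ p)" using u pos by simp
  have r1: "0 \<le> cfmap (a # r) X" "cfmap (a # r) X \<le> 1" using cfmap_range[of "a # r" X] pos X by auto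
  have r2: "0 \<le> cfmap (a' # r') Y" "cfmap (a' # r') Y \<le> 1" using cfmap_range[of "a' # r'" Y] pos X by auto
  have "cont p \<le> (real B + 1) ^ length p" using w d by (intro cont_le_power) auto
  also have "\<dots> \<le> (real B + 1) ^ length w" using d by (intro power_increasing) auto
  finally have cp: "cont p \<le> (real B + 1) ^ length w" .
  have cu: "cont u \<ge> 1" using cont_ge_1[OF u] .
  have "cont (u @ p) \<le> 2 * cont u * cont p" by (rule cont_append_bounds(2)[OF u pos(1)])
  also have "\<dots> \<le> 2 * cont u * (real B + 1) ^ length w" using cp cu by (intro mult_left_mono) auto
  finally have "(cont (u @ p))\<^sup>2 \<le> (2 * cont u * (real B + 1) ^ length w)\<^sup>2"
    using cont_ge_1[OF zup] by (intro power_mono) auto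
  also have "\<dots> = 4 * (cont u)\<^sup>2 * (real B + 1) ^ (2 * length w)"
    by (simp add: power_mult_distrib power_mult mult.commute[of 2 "length w"])
  finally have c2: "4 * (cont (u @ p))\<^sup>2 \<le> 16 * (real B + 1) ^ (2 * length w) * (cont u)\<^sup>2" by simp
  \<comment> \<open>One factor 4 of 16 is the square of the 2 in \<open>cont_append_bounds\<close>,
    the other comes from \<open>cfmap_diff_ge\<close>. The exponent 3 is that of
    \<open>inner\<close>, and 2 * length w bounds the square of q for the common prefix.\<close>
  have "1 / (16 * (real B + 1) ^ (2 * length w + 3) * (cont u)\<^sup>2) = 1 / (real B + 1) ^ 3 / (16 * (real B + 1) ^ (2 * length w) * (cont u)\<^sup>2)"
    by (simp add: power_add mult_ac)
  also have "\<dots> \<le> \<bar>cfmap (a # r) X - cfmap (a' # r') Y\<bar> / (4 * (cont (u @ p))\<^sup>2)"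
    using inner c2 cont_ge_1[OF zup] by (intro frac_le) auto
  also have "\<dots> \<le> \<bar>cfmap (u @ p) (cfmap (a # r) X) - cfmap (u @ p) (cfmap (a' # r') Y)\<bar>"
    by (rule cfmap_diff_ge[OF zup r1 r2])
  also have "\<dots> = \<bar>cfmap (u @ w) X - cfmap (u @ w') Y\<bar>" unfolding d by (simp add: cfmap_append)
  finally show ?thesis .
qed

text \<open>Stage k is a gap from m k to n k, made of N k blocks of length \<Lambda> k, followed by
  a run of ones of length rl k up to m (k+1). Each block ends with two different digits, which no
  constant window contains. \<open>lim_\<alpha>\<close> looks at n (k+1) + rl k because there the
  next run catches up with the previous one, and R_j / j is asymptotically smallest.\<close>

locale run_profile =
  fixes b :: "nat \<Rightarrow> nat" and m n N \<Lambda> rl :: "nat \<Rightarrow> nat" and \<alpha> \<beta> :: real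
  assumes n_eq: "n k = m k + N k * \<Lambda> k" and N_pos: "N k \<ge> 1" and \<Lambda>_ge: "\<Lambda> k \<ge> 2"
    and m_Suc: "m (Suc k) = n k + rl k" and rl_pos: "rl k \<ge> 1"
    and pair: "1 \<le> r \<Longrightarrow> r \<le> N k \<Longrightarrow> b (m k + r * \<Lambda> k - 2) \<noteq> b (m k + r * \<Lambda> k - 1)"
    and run: "n k \<le> p \<Longrightarrow> p < m (Suc k) \<Longrightarrow> b p = 1"
    and lim_\<beta>: "(\<lambda>k. real (rl k) / real (m (Suc k))) \<longlonglongrightarrow> \<beta>"
    and lim_\<alpha>: "(\<lambda>k. real (rl k) / (real (n (Suc k)) + real (rl k))) \<longlonglongrightarrow> \<alpha>"
    and lim_\<Lambda>: "(\<lambda>k. (real (\<Lambda> k) + 1) / real (m k)) \<longlonglongrightarrow> 0"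
    and \<beta>_nonneg: "\<beta> \<ge> 0"
begin

lemma m_less_n: "m k + 2 \<le> n k"
proof -
  have "1 * 2 \<le> N k * \<Lambda> k" using N_pos \<Lambda>_ge by (intro mult_le_mono) auto
  then show ?thesis by (simp add: n_eq)
qed

lemma m_less_Suc: "m k < m (Suc k)" using m_less_n[of k] m_Suc[of k] by linarith

lemma m_strict_mono: "strict_mono m" using m_less_Suc by (rule strict_monoI_Suc)

lemma m_ge: "k \<le> m k" using m_strict_mono by (rule strict_mono_imp_increasing)

lemma stage:
  assumes "m 0 < t" obtains k where "m k < t" "t \<le> m (Suc k)"
proof -
  have "\<exists>k. m (Suc k) \<ge> t" using m_ge[of "Suc t"] by (intro exI[of _ t]) simp
  define k where "k = (LEAST k. m (Suc k) \<ge> t)"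
  have 1: "m (Suc k) \<ge> t" unfolding k_def using \<open>\<exists>k. m (Suc k) \<ge> t\<close> by (rule LeastI_ex)
  have "m k < t"
  proof (cases k)
    case (Suc j)
    then show ?thesis using not_less_Least[of j "\<lambda>k. m (Suc k) \<ge> t"] by (simp add: k_def)
  qed (use assms in simp)
  then show ?thesis using 1 that by blast
qed

lemma stage_le:
  assumes "m K \<le> j" obtains k where "m k \<le> j" "j < m (Suc k)" "K \<le> k"
proof -
  have "m 0 < Suc j" using assms m_strict_mono by (meson le_imp_less_Suc le_trans strict_mono_less_eq zero_le)
  then obtain k where k: "m k < Suc j" "Suc j \<le> m (Suc k)" by (rule stage)
  have "m K < m (Suc k)" using assms k by simp
  then have "K \<le> k" using m_strict_mono by (simp add: strict_mono_less)
  then show ?thesis using that[of k] k by simp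
qed

lemma window_pair:
  assumes "\<And>i. i < l \<Longrightarrow> b (s + i) = b s" "b (e - 2) \<noteq> b (e - 1)" "e \<ge> 2" "e \<le> s + l"
  shows "e \<le> s + 1"
proof (rule ccontr)
  assume "\<not> e \<le> s + 1"
  then have "b (e - 2) = b s" "b (e - 1) = b s"
    using assms(1)[of "e - 2 - s"] assms(1)[of "e - 1 - s"] assms(3,4) by auto
  then show False using assms(2) by simp
qed

lemma window_run:
  assumes "\<And>i. i < l \<Longrightarrow> b (s + i) = b s" "n k \<le> s + l"
  shows "l \<le> s + l - n k + 1"
proof -
  have e: "b (n k - 2) \<noteq> b (n k - 1)" using pair[of "N k" k] N_pos by (simp add: n_eq)
  have "n k \<le> s + 1" using window_pair[OF assms(1) e _ assms(2)] m_less_n[of k] by linarith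
  then show ?thesis using assms(2) by linarith
qed

text \<open>The last block end strictly before the end of the window cuts it: at most one digit of
  the window lies to the left, at most one block to the right. If no block of this gap ends there,
  the end of the previous gap cuts instead, and the run of length rl k is added.\<close>

lemma window_gap:
  assumes w: "\<And>i. i < l \<Longrightarrow> b (s + i) = b s" and t: "m (Suc k) < s + l" "s + l \<le> n (Suc k)"
  shows "l \<le> rl k + \<Lambda> (Suc k) + 1"
proof -
  define L where "L = \<Lambda> (Suc k)"
  have L: "L \<ge> 2" using \<Lambda>_ge by (simp add: L_def)
  define r where "r = (s + l - m (Suc k) - 1) div L"
  have r1: "m (Suc k) + r * L < s + l"
  proof -
    have "r * L \<le> s + l - m (Suc k) - 1" unfolding r_def by simp
    then show ?thesis using t by linarith
  qed
  have r2: "s + l \<le> m (Suc k) + r * L + L"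
  proof -
    have "s + l - m (Suc k) - 1 < r * L + L" unfolding r_def using L
      by (metis add.commute dividend_less_div_times less_le_trans zero_less_numeral)
    then show ?thesis by linarith
  qed
  show ?thesis
  proof (cases "r = 0")
    case True
    have "n k \<le> s + l" using t m_Suc[of k] by linarith
    then have "l \<le> s + l - n k + 1" using window_run[of l s k] w by blast
    then show ?thesis using r2 True m_Suc[of k] t by (simp add: L_def)
  next
    case False
    have "r * L < N (Suc k) * L" using r1 t(2) n_eq[of "Suc k"] unfolding L_def by linarith
    then have "r \<le> N (Suc k)" using mult_less_cancel2 less_imp_le by blast
    then have e: "b (m (Suc k) + r * L - 2) \<noteq> b (m (Suc k) + r * L - 1)"
      using pair[of r "Suc k"] False by (simp add: L_def)
    have "2 \<le> r * L" using False L by (metis One_nat_def Suc_leI le_trans mult.commute mult_le_mono2 mult.right_neutral neq0_conv)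
    then have "2 \<le> m (Suc k) + r * L" "m (Suc k) + r * L \<le> s + l" using r1 by linarith+
    then have "m (Suc k) + r * L \<le> s + 1" using window_pair[of l s "m (Suc k) + r * L"] w e by blast
    then show ?thesis using r2 by (simp add: L_def)
  qed
qed

text \<open>Stated for single windows and their end points, so that \<open>liminf_le_b\<close> can
  apply it to windows ending before a given position. \<open>C\<close> absorbs windows ending in
  early stages, where the ratios are not yet close to their limits.\<close>

lemma window_bound:
  assumes c: "c > \<beta>"
  obtains C :: real where "\<And>s l. (\<And>i. i < l \<Longrightarrow> b (s + i) = b s) \<Longrightarrow> real l \<le> c * real (s + l) + C" "C \<ge> 0"
proof -
  define e where "e = (c - \<beta>) / 2"
  have e: "e > 0" using c by (simp add: e_def)
  have "\<forall>\<^sub>F k in sequentially. real (rl k) / real (m (Suc k)) < \<beta> + e"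
    using e by (intro order_tendstoD(2)[OF lim_\<beta>]) simp
  moreover have "\<forall>\<^sub>F k in sequentially. (real (\<Lambda> (Suc k)) + 1) / real (m (Suc k)) < e"
    using e by (intro order_tendstoD(2)[OF LIMSEQ_Suc[OF lim_\<Lambda>]])
  ultimately have "\<forall>\<^sub>F k in sequentially. real (rl k) / real (m (Suc k)) < \<beta> + e \<and> (real (\<Lambda> (Suc k)) + 1) / real (m (Suc k)) < e"
    by (rule eventually_conj)
  then obtain K where K: "\<And>k. k \<ge> K \<Longrightarrow> real (rl k) / real (m (Suc k)) < \<beta> + e"
    "\<And>k. k \<ge> K \<Longrightarrow> (real (\<Lambda> (Suc k)) + 1) / real (m (Suc k)) < e" unfolding eventually_sequentially by blast
  have mp: "real (m (Suc k)) > 0" for k using m_ge[of "Suc k"] by simp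
  have K1: "real (rl k) \<le> (\<beta> + e) * real (m (Suc k))" if "k \<ge> K" for k
    using K(1)[OF that] mp[of k] by (simp add: pos_divide_less_eq)
  have K2: "real (\<Lambda> (Suc k)) + 1 \<le> e * real (m (Suc k))" if "k \<ge> K" for k
    using K(2)[OF that] mp[of k] by (simp add: pos_divide_less_eq)
  define C where "C = real (m (Suc K)) + 1"
  have "real l \<le> c * real (s + l) + C" if w: "\<And>i. i < l \<Longrightarrow> b (s + i) = b s" for s l
  proof (cases "s + l \<le> m (Suc K)")
    case True
    have "0 \<le> c * real (s + l)" using c \<beta>_nonneg by (intro mult_nonneg_nonneg) auto
    then show ?thesis using True by (simp add: C_def)
  next
    case False
    then have "m (Suc K) \<le> s + l - 1" by simp
    then obtain j where j: "m j \<le> s + l - 1" "s + l - 1 < m (Suc j)" "Suc K \<le> j" by (rule stage_le)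
    obtain k where k: "j = Suc k" "K \<le> k" using j(3) by (metis Suc_le_D Suc_le_mono)
    have t: "m (Suc k) < s + l" "s + l \<le> m (Suc (Suc k))" using j False by (auto simp: k)
    have "real l \<le> c * real (s + l) + 1"
    proof (cases "s + l \<le> n (Suc k)")
      case True
      then have "l \<le> rl k + \<Lambda> (Suc k) + 1" using window_gap[of l s k] w t(1) by blast
      then have "real l \<le> real (rl k) + (real (\<Lambda> (Suc k)) + 1)" by linarith
      also have "\<dots> \<le> (\<beta> + e) * real (m (Suc k)) + e * real (m (Suc k))" using K1[OF k(2)] K2[OF k(2)] by linarith
      also have "\<dots> = c * real (m (Suc k))" by (simp add: e_def algebra_simps)
      also have "\<dots> \<le> c * real (s + l)" using t(1) c \<beta>_nonneg by (intro mult_left_mono) auto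
      finally show ?thesis by simp
    next
      case False
      then have "l \<le> s + l - n (Suc k) + 1" using window_run[of l s "Suc k"] w by simp
      then have l: "real l \<le> real (s + l) - real (n (Suc k)) + 1" using False by linarith
      define t' where "t' = real (s + l)"
      define q where "q = real (rl (Suc k)) / real (m (Suc (Suc k)))"
      have q: "q \<le> \<beta> + e" "q \<ge> 0" "q \<le> 1" using K(1)[of "Suc k"] k(2) m_Suc[of "Suc k"] by (auto simp: q_def divide_simps)
      have nq: "real (n (Suc k)) = (1 - q) * real (m (Suc (Suc k)))"
        using mp[of "Suc k"] m_Suc[of "Suc k"] by (simp add: q_def field_simps)
      have "(1 - q) * t' \<le> real (n (Suc k))" unfolding nq t'_def using t(2) q by (intro mult_left_mono) auto
      then have "real l \<le> q * t' + 1" using l unfolding t'_def[symmetric] by (simp add: algebra_simps)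
      also have "q * t' \<le> c * t'" using q c e_def e by (intro mult_right_mono) (auto simp: t'_def field_simps)
      finally show ?thesis by (simp add: t'_def)
    qed
    then show ?thesis by (simp add: C_def)
  qed
  then show ?thesis using that[of C] by (simp add: C_def)
qed

lemma limsup_le_b: "limsup_le \<beta> b"
  unfolding limsup_le_def
proof (intro allI impI)
  fix c assume c: "c > \<beta>"
  define c' where "c' = (\<beta> + c) / 2"
  have c': "c' > \<beta>" "c' < c" using c by (auto simp: c'_def)
  obtain C :: real where C: "\<And>s l. (\<And>i. i < l \<Longrightarrow> b (s + i) = b s) \<Longrightarrow> real l \<le> c' * real (s + l) + C"
    using window_bound[OF c'(1)] by metis
  obtain M :: nat where M: "real M > C / (c - c')" using reals_Archimedean2 by blast
  show "\<forall>\<^sub>F j in sequentially. real (maxrun b j) < c * real j"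
    unfolding eventually_sequentially
  proof (intro exI[of _ "max 1 M"] allI impI)
    fix j assume j: "max 1 M \<le> j"
    obtain s where s: "s + maxrun b j \<le> j" "\<And>i. i < maxrun b j \<Longrightarrow> b (s + i) = b s"
      using maxrun_obtain[of j b] j by auto
    have "real (maxrun b j) \<le> c' * real (s + maxrun b j) + C" using C[of "maxrun b j" s] s(2) by blast
    also have "\<dots> \<le> c' * real j + C" using s(1) c'(1) \<beta>_nonneg by (intro add_right_mono mult_left_mono) auto
    also have "C < (c - c') * real j"
    proof -
      have "C / (c - c') < real j" using M j by linarith
      then show ?thesis using c'(2) by (simp add: pos_divide_less_eq mult.commute)
    qed
    finally show "real (maxrun b j) < c * real j" by (simp add: algebra_simps)
  qed
qed

lemma maxrun_ge_run:
  assumes "n k < j" "j \<le> m (Suc k)" shows "j - n k \<le> maxrun b j"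
  using assms run[of k] by (intro maxrun_ge[of _ "n k"]) auto

lemma maxrun_ge_rl:
  assumes "m (Suc k) \<le> j" shows "rl k \<le> maxrun b j"
  using assms run[of k] m_Suc[of k] rl_pos[of k] by (intro maxrun_ge[of _ "n k"]) auto

lemma limsup_ge_b: "limsup_ge \<beta> b"
  unfolding limsup_ge_def
proof (intro allI impI)
  fix c assume "c < \<beta>"
  then have "\<forall>\<^sub>F k in sequentially. c < real (rl k) / real (m (Suc k))" by (rule order_tendstoD(1)[OF lim_\<beta>])
  then obtain K where K: "\<And>k. k \<ge> K \<Longrightarrow> c < real (rl k) / real (m (Suc k))" unfolding eventually_sequentially by blast
  show "\<exists>\<^sub>F j in sequentially. c * real j < real (maxrun b j)"
    unfolding frequently_sequentially
  proof
    fix i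
    define k where "k = max i K"
    have mp: "real (m (Suc k)) > 0" using m_ge[of "Suc k"] by simp
    have "c * real (m (Suc k)) < real (rl k)" using K[of k] mp by (simp add: k_def pos_less_divide_eq)
    also have "\<dots> \<le> real (maxrun b (m (Suc k)))" using maxrun_ge_rl[of k] by simp
    finally have "c * real (m (Suc k)) < real (maxrun b (m (Suc k)))" .
    moreover have "i \<le> m (Suc k)" using m_ge[of "Suc k"] by (simp add: k_def)
    ultimately show "\<exists>j\<ge>i. c * real j < real (maxrun b j)" by blast
  qed
qed

text \<open>After the end of run k, R_j is at least rl k, and within the next run also at least j -
  n (k+1). Relative to j the first bound decreases and the second increases, so the worst point is
  the crossing j = n (k+1) + rl k, with value \<open>q\<close>.\<close>

lemma liminf_ge_b: "liminf_ge \<alpha> b"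
  unfolding liminf_ge_def
proof (intro allI impI)
  fix a assume "a < \<alpha>"
  then have "\<forall>\<^sub>F k in sequentially. a < real (rl k) / (real (n (Suc k)) + real (rl k))" by (rule order_tendstoD(1)[OF lim_\<alpha>])
  then obtain K where K: "\<And>k. k \<ge> K \<Longrightarrow> a < real (rl k) / (real (n (Suc k)) + real (rl k))"
    unfolding eventually_sequentially by blast
  show "\<forall>\<^sub>F j in sequentially. a * real j < real (maxrun b j)"
    unfolding eventually_sequentially
  proof (intro exI[of _ "m (Suc K)"] allI impI)
    fix j assume "m (Suc K) \<le> j"
    then obtain j' where j': "m j' \<le> j" "j < m (Suc j')" "Suc K \<le> j'" by (rule stage_le)
    obtain k where k: "j' = Suc k" "K \<le> k" using j'(3) by (metis Suc_le_D Suc_le_mono)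
    define q where "q = real (rl k) / (real (n (Suc k)) + real (rl k))"
    define S where "S = real (n (Suc k)) + real (rl k)"
    have S: "S > 0" using rl_pos[of k] by (simp add: S_def)
    have qS: "q * S = real (rl k)" using S by (simp add: q_def S_def)
    have q: "a < q" "0 \<le> q" "q \<le> 1" using K[OF k(2)] by (auto simp: q_def divide_simps)
    have jp: "real j > 0" using j'(1) m_ge[of j'] k by simp
    have "q * real j \<le> real (maxrun b j)"
    proof (cases "real j \<le> S")
      case True
      then have "q * real j \<le> q * S" using q by (intro mult_left_mono) auto
      also have "\<dots> \<le> real (maxrun b j)" using qS maxrun_ge_rl[of k j] j'(1) k by simp
      finally show ?thesis .
    next
      case False
      then have nj: "n (Suc k) < j" by (simp add: S_def)
      have "real (n (Suc k)) = (1 - q) * S" using qS by (simp add: S_def algebra_simps)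
      also have "\<dots> \<le> (1 - q) * real j" using False q by (intro mult_left_mono) auto
      finally have "q * real j \<le> real j - real (n (Suc k))" by (simp add: algebra_simps)
      also have "\<dots> = real (j - n (Suc k))" using nj by simp
      also have "\<dots> \<le> real (maxrun b j)" using maxrun_ge_run[OF nj] j'(2) k by simp
      finally show ?thesis .
    qed
    moreover have "a * real j < q * real j" using q(1) jp by (rule mult_strict_right_mono)
    ultimately show "a * real j < real (maxrun b j)" by linarith
  qed
qed

lemma liminf_le_b: "liminf_le \<alpha> b"
  unfolding liminf_le_def
proof (intro allI impI)
  fix a assume a: "a > \<alpha>"
  \<comment> \<open>At j = n (k+1) + rl k one has rl k < (\<alpha> + e) j, and other windows exceed
    rl k by at most 3 e j; the sum stays below a = \<alpha> + 5 e.\<close>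
  define e where "e = (a - \<alpha>) / 5"
  have e: "e > 0" "a = \<alpha> + 5 * e" using a by (simp_all add: e_def field_simps)
  obtain C :: real where C: "\<And>s l. (\<And>i. i < l \<Longrightarrow> b (s + i) = b s) \<Longrightarrow> real l \<le> (\<beta> + e) * real (s + l) + C" "C \<ge> 0"
    using window_bound[of "\<beta> + e"] e(1) by auto
  have "\<forall>\<^sub>F k in sequentially. real (rl k) / (real (n (Suc k)) + real (rl k)) < \<alpha> + e"
    using e by (intro order_tendstoD(2)[OF lim_\<alpha>]) auto
  then obtain K1 where K1: "\<And>k. k \<ge> K1 \<Longrightarrow> real (rl k) / (real (n (Suc k)) + real (rl k)) < \<alpha> + e"
    unfolding eventually_sequentially by blast
  have "\<forall>\<^sub>F k in sequentially. real (rl k) / real (m (Suc k)) > \<beta> - e"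
    using e by (intro order_tendstoD(1)[OF lim_\<beta>]) auto
  then obtain K2 where K2: "\<And>k. k \<ge> K2 \<Longrightarrow> real (rl k) / real (m (Suc k)) > \<beta> - e"
    unfolding eventually_sequentially by blast
  have "\<forall>\<^sub>F k in sequentially. (real (\<Lambda> (Suc k)) + 1) / real (m (Suc k)) < e"
    using e by (intro order_tendstoD(2)[OF LIMSEQ_Suc[OF lim_\<Lambda>]])
  then obtain K3 where K3: "\<And>k. k \<ge> K3 \<Longrightarrow> (real (\<Lambda> (Suc k)) + 1) / real (m (Suc k)) < e"
    unfolding eventually_sequentially by blast
  obtain K4 :: nat where K4: "real K4 > C / e" using reals_Archimedean2 by blast
  show "\<exists>\<^sub>F j in sequentially. real (maxrun b j) < a * real j"
    unfolding frequently_sequentially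
  proof
    fix i
    define k where "k = Max {i, K1, K2, K3, K4}"
    have k: "i \<le> k" "K1 \<le> k" "K2 \<le> k" "K3 \<le> k" "K4 \<le> k" by (auto simp: k_def)
    define j where "j = n (Suc k) + rl k"
    define M where "M = real (m (Suc k))"
    have M: "M > 0" "M \<ge> real k" using m_ge[of "Suc k"] by (auto simp: M_def)
    have l1: "real (rl k) \<ge> (\<beta> - e) * M" using K2[OF k(3)] M by (simp add: M_def pos_less_divide_eq)
    have l2: "real (\<Lambda> (Suc k)) + 1 \<le> e * M" using K3[OF k(4)] M by (simp add: M_def pos_divide_less_eq)
    have "C / e \<le> M" using K4 k(5) M(2) by linarith
    then have l3: "C \<le> e * M" using e by (simp add: pos_divide_le_eq mult.commute)
    have Mj: "M \<le> real j" using m_less_n[of "Suc k"] by (simp add: M_def j_def)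
    have l4: "real (rl k) < (\<alpha> + e) * real j" using K1[OF k(2)] rl_pos[of k] by (simp add: j_def pos_divide_less_eq)
    have j1: "j \<ge> 1" using rl_pos[of k] by (simp add: j_def)
    obtain s where s: "s + maxrun b j \<le> j" "\<And>i. i < maxrun b j \<Longrightarrow> b (s + i) = b s"
      using maxrun_obtain[OF j1, of b] by blast
    define l where "l = maxrun b j"
    have w: "b (s + i) = b s" if "i < l" for i using s(2) that by (simp add: l_def)
    \<comment> \<open>Windows ending before the gap compare with \<beta> M, hence with rl k up to 2
      e M, and \<open>C\<close> adds e M. Windows ending later exceed rl k by at most a block length
      plus 1.\<close>
    have "real l \<le> real (rl k) + 3 * e * M"
    proof -
      consider "s + l \<le> m (Suc k)" | "m (Suc k) < s + l" "s + l \<le> n (Suc k)" | "n (Suc k) < s + l" by linarith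
      then show ?thesis
      proof cases
        case 1
        have "real l \<le> (\<beta> + e) * real (s + l) + C" using C(1)[of l s] w by blast
        also have "\<dots> \<le> (\<beta> + e) * M + C" using 1 e \<beta>_nonneg by (intro add_right_mono mult_left_mono) (auto simp: M_def)
        finally show ?thesis using l1 l3 by (simp add: algebra_simps)
      next
        case 2
        have "l \<le> rl k + \<Lambda> (Suc k) + 1" using window_gap[of l s k] w 2 by blast
        then have "real l \<le> real (rl k) + (real (\<Lambda> (Suc k)) + 1)" by linarith
        then show ?thesis using l2 e M mult_pos_pos[of e M] by linarith
      next
        case 3
        have "l \<le> s + l - n (Suc k) + 1" using window_run[of l s "Suc k"] w 3 by simp
        then have "l \<le> rl k + 1" using s(1) by (simp add: j_def l_def)
        then have "real l \<le> real (rl k) + 1" by linarith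
        moreover have "1 \<le> e * M" using l2 by linarith
        ultimately show ?thesis using e M mult_pos_pos[of e M] by linarith
      qed
    qed
    also have "\<dots> < (\<alpha> + e) * real j + 3 * e * real j" using l4 Mj e by (intro add_less_le_mono mult_left_mono) auto
    also have "\<dots> \<le> a * real j" unfolding e(2) using e(1) by (simp add: algebra_simps)
    finally have "real (maxrun b j) < a * real j" by (simp add: l_def)
    moreover have "i \<le> j" using m_ge[of "Suc k"] m_less_n[of "Suc k"] k(1) unfolding j_def by linarith
    ultimately show "\<exists>j\<ge>i. real (maxrun b j) < a * real j" by blast
  qed
qed

end

text \<open>The suffix \<open>[1, 2]\<close> prevents runs longer than a word inside a gap.\<close>

definition gap_weight :: "real \<Rightarrow> nat list set \<Rightarrow> real" where
  "gap_weight \<rho> T = (\<Sum>w\<in>T. cont (w @ [1, 2]) powr (- 2 * \<rho>)) / 4 powr \<rho>"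

text \<open>At position m a gap of length about \<open>\<kappa> i\<close> m is followed by a run of
  about \<open>\<nu> i\<close> times the position reached. The run then has share \<nu>/(1+\<nu>) at
  its end, and a run of share \<beta> has share \<beta>/(1+\<beta>+\<kappa>) at the next crossing
  point. \<open>gain\<close> compares logarithms per m: the roughly \<kappa> m/(M+2) words of the
  gap must earn more than the run of length \<nu>(1+\<kappa>)m costs.\<close>

locale run_construction =
  fixes \<alpha> \<beta> \<rho> :: real and \<kappa> \<nu> :: "nat \<Rightarrow> real" and T :: "nat \<Rightarrow> nat list set" and M :: "nat \<Rightarrow> nat"
  assumes \<rho>_pos: "\<rho> > 0" and \<beta>_nonneg: "\<beta> \<ge> 0" and \<kappa>_pos: "\<kappa> i > 0" and \<nu>_pos: "\<nu> i > 0"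
    and lim_\<nu>: "(\<lambda>i. \<nu> i / (1 + \<nu> i)) \<longlonglongrightarrow> \<beta>"
    and lim_\<kappa>: "(\<lambda>i. \<beta> / (1 + \<beta> + \<kappa> i)) \<longlonglongrightarrow> \<alpha>"
    and T_finite: "finite (T i)" and T_words: "T i \<subseteq> words (M i)"
    and T_weight: "gap_weight \<rho> (T i) > 1"
    and gain: "2 * \<rho> * ln golden * \<nu> i * (1 + \<kappa> i) < \<kappa> i / (real (M i) + 2) * ln (gap_weight \<rho> (T i))"
begin

text \<open>The element 2 accounts for the suffix \<open>[1, 2]\<close> appended to every gap word;
  \<open>sep\<close> is the constant of \<open>separation\<close> for words of length
  \<open>M i + 2\<close>.\<close>

definition B :: "nat \<Rightarrow> nat" where "B i = Max (insert 2 (\<Union>(set ` T i)))"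
definition sep :: "nat \<Rightarrow> real" where "sep i = 16 * (real (B i) + 1) ^ (2 * (M i + 2) + 3)"

definition gaps :: "nat \<Rightarrow> nat \<Rightarrow> nat" where "gaps i m = nat \<lceil>\<kappa> i * real m / (real (M i) + 2)\<rceil>"
definition start :: "nat \<Rightarrow> nat \<Rightarrow> nat" where "start i m = m + gaps i m * (M i + 2)"
definition runlen :: "nat \<Rightarrow> nat \<Rightarrow> nat" where "runlen i m = nat \<lfloor>\<nu> i * real (start i m)\<rfloor>"

text \<open>
  A stage with parameter index \<open>i\<close> may start at position \<open>m\<close> once the rounding errors, the separation
  constant and the word length are negligible against \<open>m\<close>; the index is raised only when this holds.
  The last condition says that the mass bound gains the factor by which the position grows, which
  later absorbs the separation constants.
\<close>

definition good :: "nat \<Rightarrow> nat \<Rightarrow> bool" where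
  "good i m \<longleftrightarrow> 1 \<le> m \<and> sep i powr \<rho> \<le> real m \<and> (real (M i) + 3) * (real i + 1) \<le> real m \<and> 1 \<le> \<nu> i * real m \<and>
     real (start i m + runlen i m) \<le> real m * (gap_weight \<rho> (T i) ^ gaps i m * (golden powr (- 2 * \<rho> * real (runlen i m)) / 4 powr \<rho>))"

lemma gaps_bounds:
  "\<kappa> i * real m / (real (M i) + 2) \<le> real (gaps i m)" "real (gaps i m) \<le> \<kappa> i * real m / (real (M i) + 2) + 1"
proof -
  have "0 \<le> \<kappa> i * real m / (real (M i) + 2)" using \<kappa>_pos[of i] by simp
  then have "real (gaps i m) = of_int \<lceil>\<kappa> i * real m / (real (M i) + 2)\<rceil>" unfolding gaps_def by simp
  then show "\<kappa> i * real m / (real (M i) + 2) \<le> real (gaps i m)" "real (gaps i m) \<le> \<kappa> i * real m / (real (M i) + 2) + 1" by linarith+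
qed

lemma start_bounds:
  "real m + \<kappa> i * real m \<le> real (start i m)" "real (start i m) \<le> real m + \<kappa> i * real m + (real (M i) + 2)"
proof -
  have e: "real (start i m) = real m + real (gaps i m) * (real (M i) + 2)" by (simp add: start_def algebra_simps)
  have p: "real (M i) + 2 > 0" by simp
  have "\<kappa> i * real m \<le> real (gaps i m) * (real (M i) + 2)"
    using gaps_bounds(1)[of i m] p by (simp only: pos_divide_le_eq)
  then show "real m + \<kappa> i * real m \<le> real (start i m)" unfolding e by simp
  have "real (gaps i m) * (real (M i) + 2) \<le> (\<kappa> i * real m / (real (M i) + 2) + 1) * (real (M i) + 2)"
    using gaps_bounds(2)[of i m] by (intro mult_right_mono) auto
  also have "\<dots> = \<kappa> i * real m + (real (M i) + 2)" by (simp add: distrib_right)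
  finally show "real (start i m) \<le> real m + \<kappa> i * real m + (real (M i) + 2)" unfolding e by simp
qed

lemma runlen_bounds:
  "real (runlen i m) \<le> \<nu> i * real (start i m)" "\<nu> i * real (start i m) - 1 \<le> real (runlen i m)"
proof -
  have "0 \<le> \<nu> i * real (start i m)" using \<nu>_pos[of i] by simp
  then have "real (runlen i m) = of_int \<lfloor>\<nu> i * real (start i m)\<rfloor>" unfolding runlen_def by simp
  then show "real (runlen i m) \<le> \<nu> i * real (start i m)" "\<nu> i * real (start i m) - 1 \<le> real (runlen i m)" by linarith+
qed

text \<open>By \<open>gain\<close> the logarithm of the mass earned exceeds that of the loss by
  about a m with a > 0, while rounding, the factor 4^\<rho> of the run and the growth factor
  \<open>Q\<close> of the position cost only the constant \<open>C\<close>.\<close>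

lemma growth_eventually:
  "\<exists>t. \<forall>m\<ge>t. real (start i m + runlen i m) \<le> real m * (gap_weight \<rho> (T i) ^ gaps i m * (golden powr (- 2 * \<rho> * real (runlen i m)) / 4 powr \<rho>))"
proof -
  define z where "z = ln (gap_weight \<rho> (T i))"
  define L where "L = real (M i) + 2"
  define g where "g = 2 * \<rho> * ln golden"
  have z: "z > 0" using T_weight[of i] by (simp add: z_def)
  have g: "g > 0" using \<rho>_pos golden_gt_1 by (simp add: g_def)
  have L: "L > 0" by (simp add: L_def)
  define a where "a = \<kappa> i / L * z - g * \<nu> i * (1 + \<kappa> i)"
  have a: "a > 0" using gain[of i] by (simp add: a_def g_def L_def z_def)
  define Q where "Q = (1 + \<nu> i) * (1 + \<kappa> i + L)"
  have Q: "Q > 0" using \<nu>_pos[of i] \<kappa>_pos[of i] L by (simp add: Q_def add_pos_pos)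
  define C where "C = g * \<nu> i * L + \<rho> * ln 4 + ln Q"
  obtain t :: nat where t: "real t > C / a" using reals_Archimedean2 by blast
  show ?thesis
  proof (intro exI[of _ "max 1 t"] allI impI)
    fix m assume m: "max 1 t \<le> m"
    have m1: "real m \<ge> 1" using m by simp
    have "C / a < real m" using t m by linarith
    then have Cm: "C \<le> a * real m" using a by (simp add: pos_divide_less_eq mult.commute)
    have "real (start i m + runlen i m) \<le> (1 + \<nu> i) * real (start i m)"
      using runlen_bounds(1)[of i m] by (simp add: algebra_simps)
    also have "\<dots> \<le> (1 + \<nu> i) * ((1 + \<kappa> i + L) * real m)"
    proof (intro mult_left_mono)
      have "L \<le> L * real m" using m1 L by simp
      then show "real (start i m) \<le> (1 + \<kappa> i + L) * real m" using start_bounds(2)[of i m] unfolding L_def[symmetric] by (simp add: algebra_simps)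
    qed (use \<nu>_pos[of i] in simp)
    also have "\<dots> = real m * exp (ln Q)" using Q by (simp add: Q_def)
    also have "\<dots> \<le> real m * exp (real (gaps i m) * z - g * real (runlen i m) - \<rho> * ln 4)"
    proof (intro mult_left_mono, subst exp_le_cancel_iff)
      have "\<kappa> i / L * z * real m \<le> real (gaps i m) * z"
        using mult_right_mono[OF gaps_bounds(1)[of i m], of z] z by (simp add: L_def mult_ac)
      moreover have "g * real (runlen i m) \<le> g * (\<nu> i * (real m + \<kappa> i * real m + L))"
        using runlen_bounds(1)[of i m] start_bounds(2)[of i m] \<nu>_pos[of i] g unfolding L_def
        by (intro mult_left_mono) (auto intro: order_trans mult_left_mono)
      ultimately show "ln Q \<le> real (gaps i m) * z - g * real (runlen i m) - \<rho> * ln 4"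
        using Cm unfolding C_def a_def by (simp add: algebra_simps)
    qed simp
    also have "exp (real (gaps i m) * z - g * real (runlen i m) - \<rho> * ln 4) =
      gap_weight \<rho> (T i) ^ gaps i m * (golden powr (- 2 * \<rho> * real (runlen i m)) / 4 powr \<rho>)"
    proof -
      have "exp (real (gaps i m) * z) = gap_weight \<rho> (T i) ^ gaps i m" using T_weight[of i] by (simp add: exp_of_nat_mult z_def)
      moreover have "golden powr (- 2 * \<rho> * real (runlen i m)) = exp (- (g * real (runlen i m)))"
        by (simp add: powr_def g_def mult_ac)
      moreover have "4 powr \<rho> = exp (\<rho> * ln 4)" by (simp add: powr_def)
      ultimately show ?thesis by (simp add: exp_diff exp_minus divide_inverse)
    qed
    finally show "real (start i m + runlen i m) \<le> real m * (gap_weight \<rho> (T i) ^ gaps i m * (golden powr (- 2 * \<rho> * real (runlen i m)) / 4 powr \<rho>))" .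
  qed
qed

lemma good_eventually: "\<exists>t. \<forall>m\<ge>t. good i m"
proof -
  obtain t1 where t1: "\<forall>m\<ge>t1. real (start i m + runlen i m) \<le> real m * (gap_weight \<rho> (T i) ^ gaps i m * (golden powr (- 2 * \<rho> * real (runlen i m)) / 4 powr \<rho>))"
    using growth_eventually by blast
  obtain t2 :: nat where t2: "real t2 > max (max (sep i powr \<rho>) ((real (M i) + 3) * (real i + 1))) (1 / \<nu> i)"
    using reals_Archimedean2 by blast
  show ?thesis
  proof (intro exI[of _ "max 1 (max t1 t2)"] allI impI)
    fix m assume m: "max 1 (max t1 t2) \<le> m"
    then have "real t2 \<le> real m" by simp
    then have h: "sep i powr \<rho> \<le> real m" "(real (M i) + 3) * (real i + 1) \<le> real m" "1 / \<nu> i \<le> real m" using t2 by linarith+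
    then have "1 \<le> \<nu> i * real m" using \<nu>_pos[of i] by (simp add: pos_divide_le_eq mult.commute)
    then show "good i m" unfolding good_def using h m t1 by auto
  qed
qed

definition threshold :: "nat \<Rightarrow> nat" where "threshold i = (SOME t. \<forall>m\<ge>t. good i m)"

lemma threshold: "threshold i \<le> m \<Longrightarrow> good i m"
  using someI_ex[OF good_eventually[of i]] unfolding threshold_def by blast

text \<open>The clause \<open>i \<le> m\<close> keeps the set finite. The index tends to infinity
  with m although the thresholds are only known to exist, which lets all parameters converge at a
  slow enough pace.\<close>

definition param_at :: "nat \<Rightarrow> nat" where "param_at m = Max {i. i \<le> m \<and> threshold i \<le> m}"

lemma param_at_finite: "finite {i. i \<le> m \<and> threshold i \<le> m}"
  by (rule finite_subset[of _ "{..m}"]) auto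

lemma param_at_good: assumes "threshold 0 \<le> m" shows "good (param_at m) m"
proof -
  have "0 \<in> {i. i \<le> m \<and> threshold i \<le> m}" using assms by simp
  then have "param_at m \<in> {i. i \<le> m \<and> threshold i \<le> m}" unfolding param_at_def by (intro Max_in param_at_finite) blast
  then show ?thesis by (intro threshold) simp
qed

lemma param_at_ge: "i \<le> m \<Longrightarrow> threshold i \<le> m \<Longrightarrow> i \<le> param_at m"
  unfolding param_at_def by (intro Max_ge param_at_finite) simp

primrec run_end :: "nat \<Rightarrow> nat" where
  "run_end 0 = max 1 (threshold 0)"
| "run_end (Suc k) = start (param_at (run_end k)) (run_end k) + runlen (param_at (run_end k)) (run_end k)"

definition param :: "nat \<Rightarrow> nat" where "param k = param_at (run_end k)"

lemma run_end_Suc: "run_end (Suc k) = start (param k) (run_end k) + runlen (param k) (run_end k)"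
  by (simp add: param_def)

lemma run_end_ge: "run_end 0 \<le> run_end k"
proof (induction k)
  case (Suc k)
  then show ?case unfolding run_end_Suc start_def by simp
qed simp

lemma good_run_end: "good (param k) (run_end k)"
  unfolding param_def using run_end_ge[of k] by (intro param_at_good) simp

lemma run_end_pos: "run_end k \<ge> 1" using run_end_ge[of k] by simp

lemma gaps_pos: "gaps (param k) (run_end k) \<ge> 1"
proof -
  have "0 < \<kappa> (param k) * real (run_end k) / (real (M (param k)) + 2)" using \<kappa>_pos run_end_pos[of k] by simp
  then have "0 < real (gaps (param k) (run_end k))" using gaps_bounds(1)[of "param k" "run_end k"] by linarith
  then show ?thesis by simp
qed

lemma runlen_pos: "runlen (param k) (run_end k) \<ge> 1"
proof -
  have "1 \<le> \<nu> (param k) * real (run_end k)" using good_run_end[of k] by (simp add: good_def)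
  also have "\<dots> \<le> \<nu> (param k) * real (start (param k) (run_end k))" using \<nu>_pos[of "param k"] by (intro mult_left_mono) (auto simp: start_def)
  finally show ?thesis unfolding runlen_def by (simp add: le_nat_iff le_floor_iff)
qed

text \<open>The pair (k, r) says that r words of the gap of stage k have been placed; once all are
  placed, the run comes next. Each word is a separate tree level, so two paths part within one word,
  whose length and digits are controlled by \<open>sep\<close>.\<close>

primrec state :: "nat \<Rightarrow> nat \<times> nat" where
  "state 0 = (0, 0)"
| "state (Suc i) = (case state i of (k, r) \<Rightarrow> if r < gaps (param k) (run_end k) then (k, Suc r) else (Suc k, 0))"

definition state_words :: "nat \<times> nat \<Rightarrow> nat list set" where
  "state_words = (\<lambda>(k, r). if r < gaps (param k) (run_end k) then (\<lambda>w. w @ [1, 2]) ` T (param k) else {replicate (runlen (param k) (run_end k)) 1})"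

definition W :: "nat \<Rightarrow> nat list set" where
  "W i = (case i of 0 \<Rightarrow> {replicate (run_end 0) 1} | Suc j \<Rightarrow> state_words (state j))"

lemma state_le: "state i = (k, r) \<Longrightarrow> r \<le> gaps (param k) (run_end k)"
  by (induction i arbitrary: k r) (auto split: prod.splits if_splits)

lemma state_reach: "r \<le> gaps (param k) (run_end k) \<Longrightarrow> \<exists>i. state i = (k, r)"
proof (induction k arbitrary: r)
  case 0
  then show ?case
  proof (induction r)
    case 0
    show ?case by (rule exI[of _ 0]) simp
  next
    case (Suc r)
    then obtain i where "state i = (0, r)" by auto
    then show ?case using Suc.prems by (intro exI[of _ "Suc i"]) simp
  qed
next
  case (Suc k)
  show ?case using Suc.prems
  proof (induction r)
    case 0
    obtain i where "state i = (k, gaps (param k) (run_end k))" using Suc.IH by blast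
    then show ?case by (intro exI[of _ "Suc i"]) simp
  next
    case (Suc r)
    then obtain i where "state i = (Suc k, r)" by auto
    then show ?case using Suc.prems by (intro exI[of _ "Suc i"]) simp
  qed
qed

lemma T_nonempty: "T i \<noteq> {}"
  using T_weight[of i] by (auto simp: gap_weight_def)

sublocale tree: word_tree W \<rho>
proof
  fix i
  show "finite (W i)" by (auto simp: W_def state_words_def T_finite split: nat.split prod.split)
  show "W i \<noteq> {}" using T_nonempty by (auto simp: W_def state_words_def split: nat.split prod.split)
  fix w assume w: "w \<in> W i"
  show "w \<noteq> [] \<and> 0 \<notin> set w"
  proof (cases i)
    case 0
    then show ?thesis using w run_end_pos[of 0] by (simp add: W_def split: if_splits)
  next
    case (Suc j)
    obtain k r where s: "state j = (k, r)" by (cases "state j")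
    show ?thesis
    proof (cases "r < gaps (param k) (run_end k)")
      case True
      then show ?thesis using w T_words[of "param k"] s by (auto simp: W_def Suc state_words_def words_def)
    next
      case False
      then show ?thesis using w runlen_pos[of k] s by (auto simp: W_def Suc state_words_def)
    qed
  qed
qed (rule \<rho>_pos)

lemma Z_gap: "state j = (k, r) \<Longrightarrow> r < gaps (param k) (run_end k) \<Longrightarrow> tree.Z (Suc j) = gap_weight \<rho> (T (param k))"
  unfolding tree.Z_def gap_weight_def W_def state_words_def by (simp add: sum.reindex inj_on_def)

lemma Z_run: "state j = (k, r) \<Longrightarrow> \<not> r < gaps (param k) (run_end k) \<Longrightarrow>
   tree.Z (Suc j) \<ge> golden powr (- 2 * \<rho> * real (runlen (param k) (run_end k))) / 4 powr \<rho>"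
proof -
  assume s: "state j = (k, r)" "\<not> r < gaps (param k) (run_end k)"
  define l where "l = runlen (param k) (run_end k)"
  have "cont (replicate l 1) > 0" using cont_ge_1[of "replicate l 1"] by auto
  then have "(golden ^ l) powr (- 2 * \<rho>) \<le> cont (replicate l 1) powr (- 2 * \<rho>)"
    using cont_ones_le[of l] \<rho>_pos by (intro powr_mono2') auto
  moreover have "(golden ^ l) powr (- 2 * \<rho>) = golden powr (- 2 * \<rho> * real l)"
    by (simp add: powr_realpow[symmetric] powr_powr mult_ac)
  ultimately have "golden powr (- 2 * \<rho> * real l) / 4 powr \<rho> \<le> cont (replicate l 1) powr (- 2 * \<rho>) / 4 powr \<rho>"
    by (intro divide_right_mono) auto
  then show ?thesis using s unfolding tree.Z_def W_def state_words_def l_def by simp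
qed

definition c0 :: real where "c0 = tree.Z 0 / real (run_end 0)"

lemma c0_pos: "c0 > 0" using tree.Z_pos[of 0] run_end_pos[of 0] by (simp add: c0_def)

text \<open>Gap words multiply the product by a factor above 1 and the run takes part of the gain
  back. The last condition of \<open>good\<close> leaves a surplus of at least the growth of the
  position, so the product keeps a factor \<open>run_end k\<close>; this pays for the separation
  constant, as \<open>good\<close> has sep^\<rho> \<le> m. \<open>c0\<close> is chosen for equality
  at the first level.\<close>

lemma prod_ge: "state j = (k, r) \<Longrightarrow> c0 * real (run_end k) * gap_weight \<rho> (T (param k)) ^ r \<le> (\<Prod>i<Suc j. tree.Z i)"
proof (induction j arbitrary: k r)
  case 0
  then show ?case using run_end_pos[of 0] by (simp add: c0_def)
next
  case (Suc j)
  obtain k' r' where s: "state j = (k', r')" by (cases "state j")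
  have IH: "c0 * real (run_end k') * gap_weight \<rho> (T (param k')) ^ r' \<le> (\<Prod>i<Suc j. tree.Z i)" by (rule Suc.IH[OF s])
  show ?case
  proof (cases "r' < gaps (param k') (run_end k')")
    case True
    then have kr: "k = k'" "r = Suc r'" using Suc.prems s by auto
    have "c0 * real (run_end k) * gap_weight \<rho> (T (param k)) ^ r = c0 * real (run_end k') * gap_weight \<rho> (T (param k')) ^ r' * tree.Z (Suc j)"
      unfolding Z_gap[OF s True] kr by simp
    also have "\<dots> \<le> (\<Prod>i<Suc j. tree.Z i) * tree.Z (Suc j)" using IH tree.Z_pos[of "Suc j"] by (intro mult_right_mono) auto
    finally show ?thesis by simp
  next
    case False
    then have kr: "k = Suc k'" "r = 0" using Suc.prems s by auto
    have r': "r' = gaps (param k') (run_end k')" using state_le[OF s] False by simp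
    define y where "y = golden powr (- 2 * \<rho> * real (runlen (param k') (run_end k'))) / 4 powr \<rho>"
    have y: "y \<ge> 0" "y \<le> tree.Z (Suc j)" using Z_run[OF s False] by (auto simp: y_def)
    have "real (run_end k) \<le> real (run_end k') * (gap_weight \<rho> (T (param k')) ^ r' * y)"
      using good_run_end[of k'] unfolding kr run_end_Suc r' good_def y_def by blast
    then have "c0 * real (run_end k) \<le> c0 * (real (run_end k') * (gap_weight \<rho> (T (param k')) ^ r' * y))"
      using c0_pos by (intro mult_left_mono) auto
    also have "\<dots> = c0 * real (run_end k') * gap_weight \<rho> (T (param k')) ^ r' * y" by (simp only: mult_ac)
    also have "\<dots> \<le> (\<Prod>i<Suc j. tree.Z i) * tree.Z (Suc j)"
      using IH y tree.Z_pos by (intro mult_mono prod_nonneg) (auto simp: less_imp_le)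
    finally show ?thesis unfolding kr by simp
  qed
qed

lemma prod_ge_run_end: "state j = (k, r) \<Longrightarrow> c0 * real (run_end k) \<le> (\<Prod>i<Suc j. tree.Z i)"
proof -
  assume s: "state j = (k, r)"
  have "1 \<le> gap_weight \<rho> (T (param k)) ^ r" using T_weight[of "param k"] by (intro one_le_power) simp
  then have "c0 * real (run_end k) * 1 \<le> c0 * real (run_end k) * gap_weight \<rho> (T (param k)) ^ r"
    using c0_pos by (intro mult_left_mono) auto
  then show ?thesis using prod_ge[OF s] by simp
qed

lemma path_in: "c \<in> tree.paths \<Longrightarrow> c i \<in> W i" by (simp add: tree.paths_def)
lemma path_word: "c \<in> tree.paths \<Longrightarrow> c i \<noteq> []" "c \<in> tree.paths \<Longrightarrow> 0 \<notin> set (c i)"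
  using path_in tree.W_word by blast+

lemma path_gap:
  assumes "c \<in> tree.paths" "state j = (k, r)" "r < gaps (param k) (run_end k)"
  obtains w where "w \<in> T (param k)" "c (Suc j) = w @ [1, 2]"
  using path_in[OF assms(1), of "Suc j"] assms(2,3) by (auto simp: W_def state_words_def)

lemma path_run:
  assumes "c \<in> tree.paths" "state j = (k, r)" "\<not> r < gaps (param k) (run_end k)"
  shows "c (Suc j) = replicate (runlen (param k) (run_end k)) 1"
  using path_in[OF assms(1), of "Suc j"] assms(2,3) by (auto simp: W_def state_words_def)

lemma T_length: "w \<in> T i \<Longrightarrow> length w = M i" using T_words[of i] by (auto simp: words_def)

lemma path_length:
  assumes c: "c \<in> tree.paths" shows "state j = (k, r) \<Longrightarrow> length (cat c (Suc j)) = run_end k + r * (M (param k) + 2)"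
proof (induction j arbitrary: k r)
  case 0
  have "c 0 = replicate (run_end 0) 1" using path_in[OF c, of 0] by (simp add: W_def)
  then have "length (cat c (Suc 0)) = run_end 0" unfolding cat_Suc by (simp del: run_end.simps)
  moreover have "k = 0" "r = 0" using 0 by auto
  ultimately show ?case by simp
next
  case (Suc j)
  obtain k' r' where s: "state j = (k', r')" by (cases "state j")
  have IH: "length (cat c (Suc j)) = run_end k' + r' * (M (param k') + 2)" by (rule Suc.IH[OF s])
  show ?case
  proof (cases "r' < gaps (param k') (run_end k')")
    case True
    then have kr: "k = k'" "r = Suc r'" using Suc.prems s by auto
    obtain w where "w \<in> T (param k')" "c (Suc j) = w @ [1, 2]" using path_gap[OF c s True] by blast
    then have "length (c (Suc j)) = M (param k') + 2" using T_length by simp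
    then show ?thesis unfolding cat_Suc[of c "Suc j"] kr using IH by simp
  next
    case False
    then have kr: "k = Suc k'" "r = 0" using Suc.prems s by auto
    have r': "r' = gaps (param k') (run_end k')" using state_le[OF s] False by simp
    have "length (c (Suc j)) = runlen (param k') (run_end k')" using path_run[OF c s False] by simp
    then show ?thesis unfolding cat_Suc[of c "Suc j"] kr run_end_Suc start_def using IH r' by simp
  qed
qed

section \<open>Limits of the run ratios along the constructed sequences\<close>

lemma param_tendsto: "filterlim param at_top sequentially"
  unfolding filterlim_at_top
proof
  fix I
  have mono: "run_end k < run_end (Suc k)" for k
    unfolding run_end_Suc using runlen_pos[of k] by (simp add: start_def)
  then have "strict_mono run_end" by (rule strict_monoI_Suc)
  then have ge: "k \<le> run_end k" for k by (rule strict_mono_imp_increasing)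
  show "\<forall>\<^sub>F k in sequentially. I \<le> param k"
    unfolding eventually_sequentially param_def
  proof (intro exI[of _ "max I (threshold I)"] allI impI param_at_ge)
    fix k assume "max I (threshold I) \<le> k"
    then show "I \<le> run_end k" "threshold I \<le> run_end k" using ge[of k] by linarith+
  qed
qed

lemma lim_inverse_param: "(\<lambda>k. 1 / (real (param k) + 1)) \<longlonglongrightarrow> 0"
proof -
  have "(\<lambda>i. 1 / (real i + 1)) \<longlonglongrightarrow> 0" using LIMSEQ_inverse_real_of_nat by (simp add: inverse_eq_divide add.commute)
  then show ?thesis using filterlim_compose[OF _ param_tendsto] by blast
qed

lemma \<Lambda>_le: "(real (M (param k) + 2) + 1) / real (run_end k) \<le> 1 / (real (param k) + 1)"
proof -
  have "(real (M (param k)) + 3) * (real (param k) + 1) \<le> real (run_end k)" using good_run_end[of k] by (simp add: good_def)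
  moreover have "real (run_end k) > 0" using run_end_pos[of k] by simp
  ultimately show ?thesis by (simp add: divide_simps algebra_simps)
qed

lemma lim_\<Lambda>: "(\<lambda>k. (real (M (param k) + 2) + 1) / real (run_end k)) \<longlonglongrightarrow> 0"
  by (rule Lim_null_comparison[OF always_eventually lim_inverse_param]) (use \<Lambda>_le in simp)

lemma lim_ratio_\<beta>: "(\<lambda>k. real (runlen (param k) (run_end k)) / real (run_end (Suc k))) \<longlonglongrightarrow> \<beta>"
proof -
  have "(\<lambda>k. \<nu> (param k) / (1 + \<nu> (param k))) \<longlonglongrightarrow> \<beta>" using filterlim_compose[OF lim_\<nu> param_tendsto] .
  moreover have "(\<lambda>k. real (runlen (param k) (run_end k)) / real (run_end (Suc k)) - \<nu> (param k) / (1 + \<nu> (param k))) \<longlonglongrightarrow> 0"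
  proof (rule Lim_null_comparison[OF always_eventually lim_\<Lambda>], rule allI)
    fix k
    define l n v where "l = real (runlen (param k) (run_end k))" and "n = real (start (param k) (run_end k))" and "v = \<nu> (param k)"
    have b: "l \<le> v * n" "v * n - 1 \<le> l" "v > 0" "l \<ge> 0" using runlen_bounds[where i = "param k" and m = "run_end k"] \<nu>_pos by (auto simp: l_def n_def v_def)
    have n: "n \<ge> real (run_end k)" "real (run_end k) > 0" using run_end_pos[of k] by (auto simp: n_def start_def)
    have e: "real (run_end (Suc k)) = n + l" unfolding run_end_Suc by (simp add: n_def l_def)
    have "l / (n + l) - v / (1 + v) = - ((v * n - l) / ((n + l) * (1 + v)))"
      using b n by (simp add: divide_simps) (simp add: algebra_simps)
    then have "norm (l / (n + l) - v / (1 + v)) = (v * n - l) / ((n + l) * (1 + v))"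
      using b n by simp
    also have "\<dots> \<le> 1 / (real (run_end k) * 1)" using b n by (intro frac_le mult_mono) auto
    also have "\<dots> \<le> (real (M (param k) + 2) + 1) / real (run_end k)" using n(2) by (simp add: divide_right_mono)
    finally show "norm (real (runlen (param k) (run_end k)) / real (run_end (Suc k)) - \<nu> (param k) / (1 + \<nu> (param k))) \<le> (real (M (param k) + 2) + 1) / real (run_end k)"
      unfolding e l_def v_def .
  qed
  ultimately show ?thesis using tendsto_add[of _ 0] by fastforce
qed

lemma lim_ratio_\<alpha>:
  "(\<lambda>k. real (runlen (param k) (run_end k)) / (real (start (param (Suc k)) (run_end (Suc k))) + real (runlen (param k) (run_end k)))) \<longlonglongrightarrow> \<alpha>"
proof -
  define p where "p k = real (runlen (param k) (run_end k)) / real (run_end (Suc k))" for k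
  have p: "p \<longlonglongrightarrow> \<beta>" unfolding p_def by (rule lim_ratio_\<beta>)
  define h where "h k = \<beta> / (1 + \<beta> + \<kappa> (param (Suc k)))" for k
  have h: "h \<longlonglongrightarrow> \<alpha>" unfolding h_def using LIMSEQ_Suc[OF filterlim_compose[OF lim_\<kappa> param_tendsto]] .
  define E where "E k = \<bar>p k - \<beta>\<bar> + \<beta> * (1 / (real (param (Suc k)) + 1))" for k
  have "(\<lambda>k. \<bar>p k - \<beta>\<bar> + \<beta> * (1 / (real (param (Suc k)) + 1))) \<longlonglongrightarrow> \<bar>\<beta> - \<beta>\<bar> + \<beta> * 0"
    by (intro tendsto_intros p LIMSEQ_Suc[OF lim_inverse_param])
  then have E: "E \<longlonglongrightarrow> 0" unfolding E_def by simp
  have "(\<lambda>k. real (runlen (param k) (run_end k)) / (real (start (param (Suc k)) (run_end (Suc k))) + real (runlen (param k) (run_end k))) - h k) \<longlonglongrightarrow> 0"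
  proof (rule Lim_null_comparison[OF always_eventually E], rule allI)
    fix k
    define m i where "m = run_end (Suc k)" and "i = param (Suc k)"
    have m: "real m > 0" using run_end_pos[of "Suc k"] by (simp add: m_def del: run_end.simps)
    define q where "q = p k"
    define g where "g = real (start i m) / real m - 1"
    have l: "real (runlen (param k) (run_end k)) = q * real m" using m by (simp add: q_def p_def m_def del: run_end.simps)
    have n: "real (start i m) = (1 + g) * real m" using m by (simp add: g_def)
    have q0: "q \<ge> 0" by (simp add: q_def p_def)
    have "(1 + \<kappa> i) * real m \<le> (1 + g) * real m" using start_bounds(1)[of m i] unfolding n by (simp add: algebra_simps)
    then have g1: "\<kappa> i \<le> g" using m by simp
    have "(1 + g) * real m \<le> (1 + \<kappa> i) * real m + (real (M i) + 2)" using start_bounds(2)[of i m] unfolding n by (simp add: algebra_simps)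
    then have "(g - \<kappa> i) * real m \<le> real (M i) + 2" by (simp add: algebra_simps)
    then have "g - \<kappa> i \<le> (real (M i) + 2) / real m" using m by (simp add: pos_le_divide_eq)
    also have "\<dots> \<le> (real (M i + 2) + 1) / real m" using m by (intro divide_right_mono) auto
    also have "\<dots> \<le> 1 / (real i + 1)" using \<Lambda>_le[of "Suc k"] unfolding m_def i_def .
    finally have g2: "g - \<kappa> i \<le> 1 / (real i + 1)" .
    have k0: "\<kappa> i > 0" by (rule \<kappa>_pos)
    have "real (runlen (param k) (run_end k)) / (real (start i m) + real (runlen (param k) (run_end k))) = q / (1 + g + q)"
      unfolding l n using m by (simp flip: distrib_right)
    moreover have "q / (1 + g + q) - \<beta> / (1 + \<beta> + \<kappa> i) = ((q - \<beta>) * (1 + \<kappa> i) + \<beta> * (\<kappa> i - g)) / ((1 + g + q) * (1 + \<beta> + \<kappa> i))"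
      using g1 k0 q0 \<beta>_nonneg by (simp add: divide_simps) (simp add: algebra_simps)
    moreover have "\<bar>((q - \<beta>) * (1 + \<kappa> i) + \<beta> * (\<kappa> i - g)) / ((1 + g + q) * (1 + \<beta> + \<kappa> i))\<bar> \<le> \<bar>q - \<beta>\<bar> + \<beta> * (1 / (real i + 1))"
    proof -
      define D where "D = (1 + g + q) * (1 + \<beta> + \<kappa> i)"
      have D: "D \<ge> 1 + \<kappa> i" "D \<ge> 1"
      proof -
        have "1 * (1 + \<kappa> i) \<le> D" unfolding D_def using g1 k0 q0 \<beta>_nonneg by (intro mult_mono) auto
        then show "D \<ge> 1 + \<kappa> i" "D \<ge> 1" using k0 by auto
      qed
      have "\<bar>(q - \<beta>) * (1 + \<kappa> i) + \<beta> * (\<kappa> i - g)\<bar> \<le> \<bar>q - \<beta>\<bar> * (1 + \<kappa> i) + \<beta> * (g - \<kappa> i)"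
        using k0 g1 \<beta>_nonneg by (intro order_trans[OF abs_triangle_ineq]) (simp add: abs_mult)
      also have "\<dots> \<le> \<bar>q - \<beta>\<bar> * D + \<beta> * (1 / (real i + 1)) * D"
      proof (intro add_mono mult_left_mono)
        have "\<beta> * (g - \<kappa> i) \<le> \<beta> * (1 / (real i + 1))" using g2 \<beta>_nonneg by (intro mult_left_mono) auto
        also have "\<dots> = \<beta> * (1 / (real i + 1)) * 1" by simp
        also have "\<dots> \<le> \<beta> * (1 / (real i + 1)) * D" using D(2) \<beta>_nonneg by (intro mult_left_mono) auto
        finally show "\<beta> * (g - \<kappa> i) \<le> \<beta> * (1 / (real i + 1)) * D" .
      qed (use D in auto)
      also have "\<dots> = (\<bar>q - \<beta>\<bar> + \<beta> * (1 / (real i + 1))) * D" by (simp only: distrib_right)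
      finally show ?thesis unfolding D_def[symmetric] using D(2) by (simp add: pos_divide_le_eq)
    qed
    ultimately show "norm (real (runlen (param k) (run_end k)) / (real (start (param (Suc k)) (run_end (Suc k))) + real (runlen (param k) (run_end k))) - h k) \<le> E k"
      unfolding h_def E_def m_def[symmetric] i_def[symmetric] q_def[symmetric] by simp
  qed
  from tendsto_add[OF this h] show ?thesis by simp
qed

lemma path_profile:
  assumes c: "c \<in> tree.paths"
  shows "run_profile (digits c) run_end (\<lambda>k. start (param k) (run_end k)) (\<lambda>k. gaps (param k) (run_end k)) (\<lambda>k. M (param k) + 2) (\<lambda>k. runlen (param k) (run_end k)) \<alpha> \<beta>"
proof
  fix k
  show "start (param k) (run_end k) = run_end k + gaps (param k) (run_end k) * (M (param k) + 2)" by (simp add: start_def)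
  show "1 \<le> gaps (param k) (run_end k)" by (rule gaps_pos)
  show "2 \<le> M (param k) + 2" by simp
  show "run_end (Suc k) = start (param k) (run_end k) + runlen (param k) (run_end k)" by (rule run_end_Suc)
  show "1 \<le> runlen (param k) (run_end k)" by (rule runlen_pos)
next
  fix k r assume r: "1 \<le> r" "r \<le> gaps (param k) (run_end k)"
  then obtain r' where r': "r = Suc r'" by (cases r) auto
  then have lt: "r' < gaps (param k) (run_end k)" using r by simp
  obtain j where j: "state j = (k, r')" using state_reach[of r' k] lt by auto
  then have j2: "state (Suc j) = (k, r)" using lt r' by simp
  obtain w where w: "c (Suc j) = w @ [1, 2]" using path_gap[OF c j lt] by blast
  define u where "u = cat c (Suc j) @ w"
  have u: "cat c (Suc (Suc j)) = u @ [1, 2]" unfolding cat_Suc[of c "Suc j"] w u_def by simp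
  have len: "length u + 2 = run_end k + r * (M (param k) + 2)" using path_length[OF c j2] u by simp
  have "digits c (length u) = 1" "digits c (length u + 1) = 2"
    using digits_nth[of c _ "Suc (Suc j)"] path_word(1)[OF c] u by (auto simp: nth_append)
  moreover have "run_end k + r * (M (param k) + 2) - 2 = length u" "run_end k + r * (M (param k) + 2) - 1 = length u + 1" using len by linarith+
  ultimately show "digits c (run_end k + r * (M (param k) + 2) - 2) \<noteq> digits c (run_end k + r * (M (param k) + 2) - 1)" by simp
next
  fix k p assume p: "start (param k) (run_end k) \<le> p" "p < run_end (Suc k)"
  obtain j where j: "state j = (k, gaps (param k) (run_end k))" using state_reach by blast
  have u: "cat c (Suc (Suc j)) = cat c (Suc j) @ replicate (runlen (param k) (run_end k)) 1"
    unfolding cat_Suc[of c "Suc j"] using path_run[OF c j] by simp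
  have len: "length (cat c (Suc j)) = start (param k) (run_end k)" using path_length[OF c j] by (simp add: start_def)
  have "p < length (cat c (Suc (Suc j)))" unfolding u using p(2) len run_end_Suc[of k] by simp
  then have "digits c p = cat c (Suc (Suc j)) ! p" using path_word(1)[OF c] by (intro digits_nth) auto
  also have "\<dots> = 1" unfolding u using p len run_end_Suc[of k] by (simp add: nth_append)
  finally show "digits c p = 1" .
qed (rule lim_ratio_\<beta>, rule lim_ratio_\<alpha>, rule lim_\<Lambda>, rule \<beta>_nonneg)

lemma path_in_FG:
  assumes c: "c \<in> tree.paths"
  shows "cf_lim (digits c) \<in> F \<alpha> \<inter> G \<beta>"
proof -
  interpret P: run_profile "digits c" run_end "\<lambda>k. start (param k) (run_end k)" "\<lambda>k. gaps (param k) (run_end k)" "\<lambda>k. M (param k) + 2" "\<lambda>k. runlen (param k) (run_end k)" \<alpha> \<beta>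
    by (rule path_profile[OF c])
  have "posseq (digits c)" using path_word[OF c] by (intro posseq_digits)
  then show ?thesis unfolding FG_iff using P.liminf_ge_b P.liminf_le_b P.limsup_le_b P.limsup_ge_b by blast
qed

text \<open>Level j is filled in state j - 1. Level 0 holds a single word, so paths never part there
  and the truncation of j - 1 is harmless.\<close>

definition sep_at :: "nat \<Rightarrow> real" where
  "sep_at j = sep (param (fst (state (j - 1))))"

lemma T_digit: "w \<in> T i \<Longrightarrow> a \<in> set w \<Longrightarrow> a \<le> B i"
  unfolding B_def using T_finite[of i] by (intro Max_ge) auto

lemma B_ge: "2 \<le> B i" unfolding B_def using T_finite[of i] by (intro Max_ge) auto

lemma path_cfmap:
  assumes c: "c \<in> tree.paths"
  obtains X where "0 \<le> X" "X \<le> 1" "cf_lim (digits c) = cfmap (cat c j) X"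
proof -
  have ps: "posseq (digits c)" using path_word[OF c] by (intro posseq_digits)
  have "pre (digits c) (length (cat c j)) = cat c j" using pre_digits[of c "length (cat c j)" j] path_word(1)[OF c] by simp
  then show ?thesis using that cf_lim_shift[OF ps, of "length (cat c j)"] cf_lim_range_closed[OF posseq_shift[OF ps]] by metis
qed

theorem dim_FG_ge: "ereal \<rho> \<le> hausdorff_dim (F \<alpha> \<inter> G \<beta>)"
proof (rule tree.dim_ge[of _ c0 sep_at])
  show "\<And>c. c \<in> tree.paths \<Longrightarrow> cf_lim (digits c) \<in> F \<alpha> \<inter> G \<beta>" by (rule path_in_FG)
  show "c0 > 0" by (rule c0_pos)
  show "\<exists>\<^sub>\<infinity>j. c0 \<le> (\<Prod>i<j. tree.Z i)"
    unfolding INFM_nat_le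
  proof
    fix n
    obtain k r where s: "state n = (k, r)" by (cases "state n")
    have "c0 * 1 \<le> c0 * real (run_end k)" using c0_pos run_end_pos[of k] by (intro mult_left_mono) auto
    then have "c0 \<le> (\<Prod>i<Suc n. tree.Z i)" using prod_ge_run_end[OF s] by linarith
    then show "\<exists>j\<ge>n. c0 \<le> (\<Prod>i<j. tree.Z i)" by (intro exI[of _ "Suc n"]) simp
  qed
  fix c d j assume c: "c \<in> tree.paths" and d: "d \<in> tree.paths" and agree: "\<And>i. i < j \<Longrightarrow> c i = d i" and ne: "c j \<noteq> d j"
  have "j \<noteq> 0"
  proof
    assume "j = 0"
    then show False using ne path_in[OF c, of 0] path_in[OF d, of 0] by (simp add: W_def)
  qed
  then obtain j' where j: "j = Suc j'" by (cases j) auto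
  obtain k r where s: "state j' = (k, r)" by (cases "state j'")
  \<comment> \<open>Run levels have one word only, so paths part in a gap word, which ends with
    \<open>[1, 2]\<close> as \<open>separation\<close> requires.\<close>
  have lt: "r < gaps (param k) (run_end k)"
  proof (rule ccontr)
    assume "\<not> r < gaps (param k) (run_end k)"
    then show False using ne path_run[OF c s] path_run[OF d s] j by simp
  qed
  obtain w where w: "w \<in> T (param k)" "c j = w @ [1, 2]" using path_gap[OF c s lt] j by blast
  obtain w' where w': "w' \<in> T (param k)" "d j = w' @ [1, 2]" using path_gap[OF d s lt] j by blast
  define u where "u = cat c j"
  have ud: "u = cat d j" unfolding u_def using agree by (rule cat_cong)
  have u0: "0 \<notin> set u" using path_word(2)[OF c] by (simp add: u_def set_cat)
  obtain X where X: "0 \<le> X" "X \<le> 1" "cf_lim (digits c) = cfmap (cat c (Suc j)) X" using path_cfmap[OF c] by blast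
  obtain Y where Y: "0 \<le> Y" "Y \<le> 1" "cf_lim (digits d) = cfmap (cat d (Suc j)) Y" using path_cfmap[OF d] by blast
  have sk: "sep_at j = sep (param k)" using s by (simp add: sep_at_def j)
  have sp: "sep (param k) > 0" by (simp add: sep_def)
  have len: "length (c j) = M (param k) + 2" "length (c j) = length (d j)" using w w' T_length by auto
  have dig: "\<forall>a\<in>set (c j) \<union> set (d j). a \<le> B (param k)"
    using w w' T_digit[of _ "param k"] B_ge[of "param k"] by auto
  have "1 / (16 * (real (B (param k)) + 1) ^ (2 * length (c j) + 3) * (cont u)\<^sup>2) \<le> \<bar>cfmap (u @ c j) X - cfmap (u @ d j) Y\<bar>"
    by (rule separation[OF u0 path_word(2)[OF c] path_word(2)[OF d] dig len(2) ne w(2) w'(2) X(1,2) Y(1,2)])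
  then have "1 / (sep (param k) * (cont u)\<^sup>2) \<le> \<bar>cf_lim (digits c) - cf_lim (digits d)\<bar>"
    unfolding X(3) Y(3) cat_Suc u_def[symmetric] ud[symmetric] len(1) sep_def .
  moreover have "c0 * sep (param k) powr \<rho> \<le> c0 * real (run_end k)"
    using good_run_end[of k] c0_pos by (intro mult_left_mono) (auto simp: good_def)
  ultimately show "sep_at j > 0 \<and> 1 / (sep_at j * (cont (cat c j))\<^sup>2) \<le> \<bar>cf_lim (digits c) - cf_lim (digits d)\<bar> \<and>
      c0 * sep_at j powr \<rho> \<le> (\<Prod>i<j. tree.Z i)"
    using prod_ge_run_end[OF s] sp unfolding sk u_def unfolding j by (intro conjI) linarith+
qed

end

section \<open>The lower bound\<close>

text \<open>\<open>R\<close> is the rate per digit that the gap words must earn to pay for the runs;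
  the divisor \<open>M + 2\<close> counts the suffix \<open>[1, 2]\<close>.\<close>

definition alphabet :: "real \<Rightarrow> real \<Rightarrow> nat \<Rightarrow> nat list set \<Rightarrow> bool" where
  "alphabet \<rho> R M T \<longleftrightarrow> finite T \<and> T \<subseteq> words M \<and> gap_weight \<rho> T > 1 \<and> R < ln (gap_weight \<rho> T) / (real M + 2)"

text \<open>The constant 12 is 2 * 3 * 2: joining the suffix costs a factor 2,
  \<open>cont [1, 2]\<close> is 3, and 4^\<rho> = 2^(2\<rho>).\<close>

lemma gap_weight_ge:
  assumes "T \<subseteq> words M" "\<rho> \<ge> 0"
  shows "12 powr (- 2 * \<rho>) * wsum \<rho> T \<le> gap_weight \<rho> T"
proof -
  have c12: "cont [1, 2] = 3" by (simp add: cont_def)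
  have e: "(6::real) powr (- 2 * \<rho>) / 4 powr \<rho> = 12 powr (- 2 * \<rho>)"
  proof -
    have "(4::real) powr \<rho> = (2 powr 2) powr \<rho>" by simp
    also have "\<dots> = 2 powr (2 * \<rho>)" by (simp only: powr_powr)
    finally have "(6::real) powr (- 2 * \<rho>) / 4 powr \<rho> = 6 powr (- 2 * \<rho>) * 2 powr (- 2 * \<rho>)"
      by (simp add: powr_minus divide_inverse)
    then show ?thesis by (simp flip: powr_mult)
  qed
  have "(\<Sum>w\<in>T. 6 powr (- 2 * \<rho>) * cont w powr (- 2 * \<rho>)) \<le> (\<Sum>w\<in>T. cont (w @ [1, 2]) powr (- 2 * \<rho>))"
  proof (rule sum_mono)
    fix w assume "w \<in> T"
    then have z: "0 \<notin> set w" using assms by (auto simp: words_def)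
    have "cont (w @ [1, 2]) \<le> 6 * cont w" using cont_append_bounds(2)[OF z, of "[1, 2]"] unfolding c12 by simp
    moreover have "cont (w @ [1, 2]) > 0" using cont_ge_1[of "w @ [1, 2]"] z by simp
    ultimately have "(6 * cont w) powr (- 2 * \<rho>) \<le> cont (w @ [1, 2]) powr (- 2 * \<rho>)"
      using assms(2) by (intro powr_mono2') auto
    then show "6 powr (- 2 * \<rho>) * cont w powr (- 2 * \<rho>) \<le> cont (w @ [1, 2]) powr (- 2 * \<rho>)" by (simp add: powr_mult)
  qed
  then have "6 powr (- 2 * \<rho>) * wsum \<rho> T / 4 powr \<rho> \<le> gap_weight \<rho> T"
    unfolding gap_weight_def wsum_def sum_distrib_left by (intro divide_right_mono) auto
  then show ?thesis unfolding e[symmetric] by simp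
qed

lemma alphabetI:
  assumes "finite T" "T \<subseteq> words M" "\<rho> \<ge> 0" "R \<ge> 0" and w: "exp (R * (real M + 2)) * 12 powr (2 * \<rho>) < wsum \<rho> T"
  shows "alphabet \<rho> R M T"
proof -
  have "exp (R * (real M + 2)) = exp (R * (real M + 2)) * 12 powr (2 * \<rho>) * 12 powr (- 2 * \<rho>)"
    by (simp add: powr_minus)
  also have "\<dots> < wsum \<rho> T * 12 powr (- 2 * \<rho>)" using w by (intro mult_strict_right_mono) auto
  also have "\<dots> \<le> gap_weight \<rho> T" using gap_weight_ge[OF assms(2,3)] by (simp add: mult.commute)
  finally have g: "exp (R * (real M + 2)) < gap_weight \<rho> T" .
  have "1 \<le> exp (R * (real M + 2))" using assms(4) by simp
  then have g1: "gap_weight \<rho> T > 1" using g by linarith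
  have "ln (exp (R * (real M + 2))) < ln (gap_weight \<rho> T)" using g g1 by (subst ln_less_cancel_iff) auto
  then have "R < ln (gap_weight \<rho> T) / (real M + 2)" by (simp add: pos_less_divide_eq)
  then show ?thesis using assms(1,2) g1 by (simp add: alphabet_def)
qed

text \<open>The series of a^(-2\<rho>) diverges, so single letters reach every rate.\<close>

lemma alphabet_half:
  assumes "0 \<le> \<rho>" "\<rho> < 1 / 2" shows "\<exists>M T. alphabet \<rho> R M T"
proof -
  define R' where "R' = max R 0"
  obtain N where N: "(\<Sum>a\<in>{1..N}. real a powr (- (2 * \<rho>))) > exp (R' * (real 1 + 2)) * 12 powr (2 * \<rho>)"
    using not_bounded_sum_powr[of "2 * \<rho>"] assms by auto
  define T where "T = (\<lambda>a. [a]) ` {1..N}"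
  have "wsum \<rho> T = (\<Sum>a\<in>{1..N}. real a powr (- (2 * \<rho>)))"
    unfolding wsum_def T_def by (subst sum.reindex) (auto simp: inj_on_def)
  then have "alphabet \<rho> R' 1 T" using N assms by (intro alphabetI) (auto simp: T_def words_def R'_def)
  then have "alphabet \<rho> R 1 T" by (auto simp: alphabet_def R'_def)
  then show ?thesis by blast
qed

text \<open>Write q^(-2\<rho>) = q^(2-2\<rho>) q^(-2). The first factor is at least
  \<open>y ^ n / y\<close> because q is at least \<tau>^(n-1); the second is at least the cylinder
  length, and these lengths sum to more than 1/2 once digits up to a large N are allowed. As y > 1,
  an n fixed beforehand absorbs the constant 12^(2\<rho>).\<close>

lemma alphabet_one:
  assumes "0 \<le> \<rho>" "\<rho> < 1" shows "\<exists>M T. alphabet \<rho> 0 M T"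
proof -
  define y where "y = golden powr (2 - 2 * \<rho>)"
  have y: "y > 1" unfolding y_def using assms golden_gt_1 by (intro gr_one_powr) auto
  obtain n where n: "4 * y * 12 powr (2 * \<rho>) < y ^ n" using real_arch_pow[OF y] by blast
  have "(\<lambda>N. (1 - 2 / (real N + 1)) ^ n) \<longlonglongrightarrow> (1 - 2 * 0) ^ n"
  proof (intro tendsto_intros)
    have "(\<lambda>N. 2 * inverse (real (Suc N))) \<longlonglongrightarrow> 2 * 0" by (intro tendsto_intros LIMSEQ_inverse_real_of_nat)
    then show "(\<lambda>N. 2 / (real N + 1)) \<longlonglongrightarrow> 2 * 0" by (simp add: divide_inverse add.commute)
  qed
  then have "\<forall>\<^sub>F N in sequentially. (1 - 2 / (real N + 1)) ^ n > 1 / 2" by (intro order_tendstoD(1)) auto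
  moreover have "\<forall>\<^sub>F N in sequentially. N \<ge> (1::nat)" by (rule eventually_ge_at_top)
  ultimately have "\<forall>\<^sub>F N in sequentially. (1 - 2 / (real N + 1)) ^ n > 1 / 2 \<and> N \<ge> (1::nat)" by (rule eventually_conj)
  then obtain N where N: "(1 - 2 / (real N + 1)) ^ n > 1 / 2" "N \<ge> (1::nat)"
    using eventually_happens'[OF sequentially_bot] by blast
  have half: "1 / 2 < (\<Sum>w\<in>box N n. cyl_len w)" using box_len_sum(2)[OF N(2), of n] N(1) by linarith
  have "y ^ n / y * (1 / 2) < y ^ n / y * (\<Sum>w\<in>box N n. cyl_len w)" using half y by (intro mult_strict_left_mono) auto
  also have "\<dots> = (\<Sum>w\<in>box N n. y ^ n / y * cyl_len w)" by (rule sum_distrib_left)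
  also have "\<dots> \<le> wsum \<rho> (box N n)"
    unfolding wsum_def
  proof (rule sum_mono)
    fix w assume w: "w \<in> box N n"
    then have z: "0 \<notin> set w" "length w = n" by (auto simp: box_def)
    have c: "cont w \<ge> 1" using cont_ge_1[OF z(1)] .
    have "golden ^ n / golden \<le> cont w" using cont_ge_golden[OF z(1)] z(2) by (simp add: pos_divide_le_eq mult.commute)
    then have "(golden ^ n / golden) powr (2 - 2 * \<rho>) \<le> cont w powr (2 - 2 * \<rho>)" using assms by (intro powr_mono2) auto
    moreover have "(golden ^ n / golden) powr (2 - 2 * \<rho>) = y ^ n / y"
      by (simp add: y_def powr_divide powr_powr powr_realpow[symmetric] mult.commute)
    ultimately have yc: "y ^ n / y \<le> cont w powr (2 - 2 * \<rho>)" by simp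
    have "y ^ n / y * cyl_len w \<le> cont w powr (2 - 2 * \<rho>) * cont w powr -2"
    proof (rule mult_mono)
      show "0 \<le> cyl_len w" using cyl_len_bounds(2)[OF z(1)] powr_ge_zero[of "cont w" "-2"] by linarith
    qed (use yc cyl_len_bounds(1)[OF z(1)] in simp_all)
    also have "\<dots> = cont w powr (- 2 * \<rho>)" by (simp flip: powr_add)
    finally show "y ^ n / y * cyl_len w \<le> cont w powr (- 2 * \<rho>)" .
  qed
  finally have "y ^ n / y * (1 / 2) < wsum \<rho> (box N n)" .
  moreover have "12 powr (2 * \<rho>) < y ^ n / y * (1 / 2)"
  proof -
    have "2 * y * 12 powr (2 * \<rho>) \<le> 4 * y * 12 powr (2 * \<rho>)" using y by (intro mult_right_mono) auto
    then have "2 * y * 12 powr (2 * \<rho>) < y ^ n" using n by linarith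
    then show ?thesis using y by (simp add: field_simps)
  qed
  ultimately have "alphabet \<rho> 0 n (box N n)"
    using assms finite_box box_words by (intro alphabetI) auto
  then show ?thesis by blast
qed

text \<open>If the infimum at n exceeds \<rho>1, some finite set of words has sum above 1 at
  \<rho>1, that is, weight above exp(n g), where g is the bound on \<open>R\<close>. As R < g, a
  large n of this kind absorbs the constant 12^(2\<rho>) and the two extra digits.\<close>

lemma alphabet_pre_s:
  assumes \<gamma>: "0 < \<gamma>" "\<gamma> < 1" and \<rho>: "0 < \<rho>" "\<rho> \<le> \<rho>1" and R: "R \<ge> 0" "R < 2 * \<rho>1 * ln golden * (\<gamma> / (1 - \<gamma>))"
    and inf: "\<exists>\<^sub>F n in sequentially. pre_s n \<gamma> golden > \<rho>1"
  shows "\<exists>M T. alphabet \<rho> R M T"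
proof -
  define g where "g = 2 * \<rho>1 * ln golden * (\<gamma> / (1 - \<gamma>))"
  obtain N :: nat where N: "real N > (2 * R + 2 * \<rho> * ln 12) / (g - R)" using reals_Archimedean2 by blast
  obtain n where n: "n \<ge> N" "pre_s n \<gamma> golden > \<rho>1" using inf unfolding frequently_sequentially by blast
  define c where "c = golden powr (real n * \<gamma> / (1 - \<gamma>))"
  have c: "c > 0" by (simp add: c_def)
  have "\<rho>1 \<notin> pre_s_set n c"
  proof
    assume "\<rho>1 \<in> pre_s_set n c"
    moreover have "bdd_below (pre_s_set n c)" by (rule bdd_belowI[of _ 0]) (simp add: pre_s_set_def)
    ultimately have "pre_s n \<gamma> golden \<le> \<rho>1" unfolding pre_s_eq c_def by (intro cInf_lower)
    then show False using n by simp
  qed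
  then obtain T where T: "finite T" "T \<subseteq> words n" "(\<Sum>w\<in>T. (1 / (c * cont w)) powr (2 * \<rho>1)) > 1"
    using \<rho> by (auto simp: pre_s_set_def not_le)
  have "c powr (2 * \<rho>1) * 1 < c powr (2 * \<rho>1) * (\<Sum>w\<in>T. (1 / (c * cont w)) powr (2 * \<rho>1))"
    using T(3) c by (intro mult_strict_left_mono) auto
  also have "\<dots> = (\<Sum>w\<in>T. c powr (2 * \<rho>1) * (1 / (c * cont w)) powr (2 * \<rho>1))" by (rule sum_distrib_left)
  also have "\<dots> \<le> wsum \<rho> T"
    unfolding wsum_def
  proof (rule sum_mono)
    fix w assume "w \<in> T"
    then have w: "cont w \<ge> 1" using T cont_ge_1 by (auto simp: words_def)
    have "(1 / (c * cont w)) powr (2 * \<rho>1) = (c * cont w) powr (- (2 * \<rho>1))"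
      using w c by (intro one_divide_powr mult_pos_pos) auto
    also have "\<dots> = c powr (- (2 * \<rho>1)) * cont w powr (- (2 * \<rho>1))" by (rule powr_mult)
    finally have "c powr (2 * \<rho>1) * (1 / (c * cont w)) powr (2 * \<rho>1) = cont w powr (- 2 * \<rho>1)" using c by (simp add: powr_minus)
    also have "\<dots> \<le> cont w powr (- 2 * \<rho>)" using w \<rho> by (intro powr_mono) auto
    finally show "c powr (2 * \<rho>1) * (1 / (c * cont w)) powr (2 * \<rho>1) \<le> cont w powr (- 2 * \<rho>)" .
  qed
  finally have 1: "c powr (2 * \<rho>1) < wsum \<rho> T" by simp
  have "(2 * R + 2 * \<rho> * ln 12) / (g - R) < real n" using N n by linarith
  then have "2 * R + 2 * \<rho> * ln 12 < real n * (g - R)" using R(2) by (simp add: pos_divide_less_eq g_def)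
  then have "R * (real n + 2) + 2 * \<rho> * ln 12 < real n * g" by (simp add: algebra_simps)
  then have "exp (R * (real n + 2) + 2 * \<rho> * ln 12) < exp (real n * g)" by (subst exp_less_cancel_iff)
  moreover have "exp (real n * g) = c powr (2 * \<rho>1)" by (simp add: g_def c_def powr_def mult_ac)
  moreover have "exp (R * (real n + 2) + 2 * \<rho> * ln 12) = exp (R * (real n + 2)) * 12 powr (2 * \<rho>)" by (simp add: exp_add powr_def)
  ultimately have "exp (R * (real n + 2)) * 12 powr (2 * \<rho>) < wsum \<rho> T" using 1 by linarith
  then have "alphabet \<rho> R n T" using T \<rho> R by (intro alphabetI) auto
  then show ?thesis by blast
qed

lemma FG_dim_ge_general:
  assumes "\<rho> > 0" "\<beta> \<ge> 0" "\<And>i. \<kappa> i > 0" "\<And>i. \<nu> i > 0"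
    and "(\<lambda>i. \<nu> i / (1 + \<nu> i)) \<longlonglongrightarrow> \<beta>" "(\<lambda>i. \<beta> / (1 + \<beta> + \<kappa> i)) \<longlonglongrightarrow> \<alpha>"
    and state_words: "\<And>i. \<exists>M T. alphabet \<rho> (2 * \<rho> * ln golden * \<nu> i * (1 + \<kappa> i) / \<kappa> i) M T"
  shows "ereal \<rho> \<le> hausdorff_dim (F \<alpha> \<inter> G \<beta>)"
proof -
  obtain M T where MT: "\<And>i. alphabet \<rho> (2 * \<rho> * ln golden * \<nu> i * (1 + \<kappa> i) / \<kappa> i) (M i) (T i)" using state_words by metis
  interpret run_construction \<alpha> \<beta> \<rho> \<kappa> \<nu> T M
  proof
    fix i
    show "finite (T i)" "T i \<subseteq> words (M i)" "gap_weight \<rho> (T i) > 1" using MT[of i] by (auto simp: alphabet_def)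
    have "2 * \<rho> * ln golden * \<nu> i * (1 + \<kappa> i) / \<kappa> i < ln (gap_weight \<rho> (T i)) / (real (M i) + 2)"
      using MT[of i] by (simp add: alphabet_def)
    then show "2 * \<rho> * ln golden * \<nu> i * (1 + \<kappa> i) < \<kappa> i / (real (M i) + 2) * ln (gap_weight \<rho> (T i))"
      using assms(3)[of i] by (simp add: pos_divide_less_eq mult_ac)
  qed (use assms in auto)
  show ?thesis by (rule dim_FG_ge)
qed

lemma lim_inverse_Suc: "(\<lambda>i. 1 / (real i + 1)) \<longlonglongrightarrow> 0"
  using LIMSEQ_inverse_real_of_nat by (simp add: inverse_eq_divide add.commute)

text \<open>One alphabet of positive rate serves for all i, since runs whose relative length tends
  to 0 cost arbitrarily little.\<close>

lemma FG_dim_zero_ge: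
  assumes "0 < \<rho>" "\<rho> < 1" shows "ereal \<rho> \<le> hausdorff_dim (F 0 \<inter> G 0)"
proof -
  obtain M T where MT: "alphabet \<rho> 0 M T" using alphabet_one[of \<rho>] assms by auto
  define y where "y = ln (gap_weight \<rho> T) / (real M + 2)"
  have y: "y > 0" using MT by (simp add: alphabet_def y_def)
  \<comment> \<open>With \<kappa> = 1 the cost rate is 4 \<rho> \<nu> ln \<tau>; this
    \<open>x\<close> keeps it at most y/2 for all \<nu> \<le> x.\<close>
  define x where "x = y / (8 * \<rho> * ln golden)"
  have lg: "ln golden > 0" using golden_gt_1 by simp
  have x: "x > 0" using y assms lg by (simp add: x_def)
  define \<nu> where "\<nu> i = x * (1 / (real i + 1))" for i :: nat
  have \<nu>: "\<nu> i > 0" "\<nu> i \<le> x" for i using x by (auto simp: \<nu>_def divide_simps)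
  have "\<nu> \<longlonglongrightarrow> x * 0" unfolding \<nu>_def by (intro tendsto_intros lim_inverse_Suc)
  then have l: "(\<lambda>i. \<nu> i / (1 + \<nu> i)) \<longlonglongrightarrow> 0 / (1 + 0)" by (intro tendsto_intros) auto
  have "alphabet \<rho> (2 * \<rho> * ln golden * \<nu> i * (1 + 1) / 1) M T" for i
  proof -
    have "2 * \<rho> * ln golden * \<nu> i * (1 + 1) / 1 \<le> 2 * \<rho> * ln golden * x * 2" using \<nu>(2)[of i] assms lg by simp
    also have "\<dots> = y / 2" using assms lg by (simp add: x_def)
    finally show ?thesis using MT y unfolding alphabet_def y_def[symmetric] by auto
  qed
  then show ?thesis using assms l \<nu>(1) by (intro FG_dim_ge_general[of \<rho> 0 "\<lambda>_. 1" \<nu>]) auto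
qed

lemma ereal_le_from_below:
  fixes D :: ereal
  assumes "\<And>\<rho>. 0 < \<rho> \<Longrightarrow> \<rho> < x \<Longrightarrow> ereal \<rho> \<le> D" "0 < x" shows "ereal x \<le> D"
proof (rule ccontr)
  assume "\<not> ereal x \<le> D"
  then have "max 0 D < ereal x" using assms(2) by simp
  then obtain \<rho> where \<rho>: "max 0 D < ereal \<rho>" "ereal \<rho> < ereal x" using ereal_dense2 by blast
  then have "0 < \<rho>" "\<rho> < x" "D < ereal \<rho>" by auto
  then show False using assms(1)[of \<rho>] by simp
qed

lemma FG_dim_zero: "hausdorff_dim (F 0 \<inter> G 0) = 1"
proof (rule antisym)
  show "hausdorff_dim (F 0 \<inter> G 0) \<le> 1" by (rule hausdorff_dim_unit_interval_le) (auto simp: F_def)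
  have "ereal 1 \<le> hausdorff_dim (F 0 \<inter> G 0)" using FG_dim_zero_ge by (rule ereal_le_from_below) auto
  then show "1 \<le> hausdorff_dim (F 0 \<inter> G 0)" by (simp add: one_ereal_def)
qed

text \<open>In one stage the gap has length \<kappa> m and the run \<nu>(1+\<kappa>)m. For \<nu> =
  \<beta>/(1-\<beta>) and \<kappa> = \<beta>/\<alpha> - 1 - \<beta>, which realise \<beta> and
  \<alpha>, run and gap are in the ratio \<gamma> : (1-\<gamma>), as in the exponent of
  \<open>pre_s\<close>.\<close>

lemma ratio_identity:
  fixes \<alpha> \<beta> :: real
  assumes "0 < \<alpha>" "0 < \<beta>" "\<beta> < 1" "\<alpha> < \<beta> / (1 + \<beta>)" "\<gamma> = \<beta>\<^sup>2 * (1 - \<alpha>) / (\<beta> - \<alpha>)"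
  shows "\<beta> / (1 - \<beta>) * (1 + (\<beta> / \<alpha> - 1 - \<beta>)) / (\<beta> / \<alpha> - 1 - \<beta>) = \<gamma> / (1 - \<gamma>)"
proof -
  have h: "\<alpha> + \<alpha> * \<beta> < \<beta>" using assms by (simp add: pos_less_divide_eq algebra_simps)
  then have ab: "\<beta> - \<alpha> > 0" using assms mult_pos_pos[of \<alpha> \<beta>] by linarith
  have k: "\<beta> / \<alpha> - 1 - \<beta> = (\<beta> - \<alpha> - \<alpha> * \<beta>) / \<alpha>" using assms by (simp add: field_simps)
  have k1: "1 + (\<beta> / \<alpha> - 1 - \<beta>) = \<beta> * (1 - \<alpha>) / \<alpha>" using assms by (simp add: field_simps)
  have g: "1 - \<gamma> = (1 - \<beta>) * (\<beta> - \<alpha> - \<alpha> * \<beta>) / (\<beta> - \<alpha>)"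
    unfolding assms(5) using ab by (simp add: field_simps power2_eq_square)
  have "\<beta> / (1 - \<beta>) * (1 + (\<beta> / \<alpha> - 1 - \<beta>)) / (\<beta> / \<alpha> - 1 - \<beta>) = \<beta> / (1 - \<beta>) * (\<beta> * (1 - \<alpha>)) / (\<beta> - \<alpha> - \<alpha> * \<beta>)"
    unfolding k1 unfolding k using assms by simp
  also have "\<dots> = \<gamma> / (1 - \<gamma>)"
    unfolding g unfolding assms(5) using ab h assms by (simp add: power2_eq_square)
  finally show ?thesis .
qed

text \<open>Solves \<beta>/(1+\<beta>+\<kappa>) = \<alpha> up to a term 1/(i+1), which keeps
  \<kappa> positive at \<alpha> = \<beta>/(1+\<beta>). For \<alpha> = 0 it has to diverge, and it
  starts above \<open>K\<close> so that (1+\<kappa>)/\<kappa> is close to 1 from the first stage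
  on.\<close>

definition gap_ratio :: "real \<Rightarrow> real \<Rightarrow> nat \<Rightarrow> nat \<Rightarrow> real" where
  "gap_ratio \<alpha> \<beta> K i = (if \<alpha> = 0 then real i + real K + 1 else \<beta> / \<alpha> - 1 - \<beta> + 1 / (real i + 1))"

definition run_ratio :: "real \<Rightarrow> nat \<Rightarrow> real" where
  "run_ratio \<beta> i = (if \<beta> = 1 then real i + 1 else \<beta> / (1 - \<beta>))"

lemma gap_ratio_pos:
  assumes "0 \<le> \<alpha>" "0 < \<beta>" "\<alpha> \<le> \<beta> / (1 + \<beta>)" shows "gap_ratio \<alpha> \<beta> K i > 0" "\<alpha> \<noteq> 0 \<Longrightarrow> \<beta> / \<alpha> - 1 - \<beta> \<ge> 0"
proof -
  show k: "\<beta> / \<alpha> - 1 - \<beta> \<ge> 0" if "\<alpha> \<noteq> 0"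
  proof -
    have "\<alpha> * (1 + \<beta>) \<le> \<beta>" using assms by (simp add: pos_le_divide_eq)
    then have "1 + \<beta> \<le> \<beta> / \<alpha>" using assms that by (simp add: pos_le_divide_eq mult.commute)
    then show ?thesis by simp
  qed
  show "gap_ratio \<alpha> \<beta> K i > 0" using k by (auto simp: gap_ratio_def intro: add_nonneg_pos)
qed

lemma gap_ratio_lim:
  assumes "0 \<le> \<alpha>" "0 < \<beta>" shows "(\<lambda>i. \<beta> / (1 + \<beta> + gap_ratio \<alpha> \<beta> K i)) \<longlonglongrightarrow> \<alpha>"
proof (cases "\<alpha> = 0")
  case True
  have "(\<lambda>i. \<beta> / (1 + \<beta> + gap_ratio \<alpha> \<beta> K i)) \<longlonglongrightarrow> 0"
  proof (rule Lim_null_comparison[OF always_eventually])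
    show "\<forall>i. norm (\<beta> / (1 + \<beta> + gap_ratio \<alpha> \<beta> K i)) \<le> \<beta> * (1 / (real i + 1))"
    proof
      fix i
      have "\<beta> / (1 + \<beta> + gap_ratio \<alpha> \<beta> K i) \<le> \<beta> / (real i + 1)"
        using True assms(2) by (intro divide_left_mono mult_pos_pos) (auto simp: gap_ratio_def)
      moreover have "0 \<le> \<beta> / (1 + \<beta> + gap_ratio \<alpha> \<beta> K i)" using True assms(2) by (simp add: gap_ratio_def)
      ultimately show "norm (\<beta> / (1 + \<beta> + gap_ratio \<alpha> \<beta> K i)) \<le> \<beta> * (1 / (real i + 1))"
        by (simp only: real_norm_def abs_of_nonneg times_divide_eq_right mult_1_right)
    qed
    have "(\<lambda>i. \<beta> * (1 / (real i + 1))) \<longlonglongrightarrow> \<beta> * 0" by (intro tendsto_intros lim_inverse_Suc)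
    then show "(\<lambda>i. \<beta> * (1 / (real i + 1))) \<longlonglongrightarrow> 0" by simp
  qed
  then show ?thesis using True by simp
next
  case False
  have "(\<lambda>i. \<beta> / (\<beta> / \<alpha> + 1 / (real i + 1))) \<longlonglongrightarrow> \<beta> / (\<beta> / \<alpha> + 0)"
    using False assms by (intro tendsto_intros lim_inverse_Suc) auto
  moreover have "1 + \<beta> + gap_ratio \<alpha> \<beta> K i = \<beta> / \<alpha> + 1 / (real i + 1)" for i using False by (simp add: gap_ratio_def)
  ultimately show ?thesis using False assms by simp
qed

lemma run_ratio_pos: "0 < \<beta> \<Longrightarrow> \<beta> \<le> 1 \<Longrightarrow> run_ratio \<beta> i > 0"
  by (simp add: run_ratio_def)

lemma run_ratio_lim:
  assumes "0 < \<beta>" "\<beta> \<le> 1" shows "(\<lambda>i. run_ratio \<beta> i / (1 + run_ratio \<beta> i)) \<longlonglongrightarrow> \<beta>"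
proof (cases "\<beta> = 1")
  case True
  have "(\<lambda>i. 1 - 1 / (real (Suc i) + 1)) \<longlonglongrightarrow> 1 - 0" by (intro tendsto_intros LIMSEQ_Suc[OF lim_inverse_Suc])
  moreover have "run_ratio \<beta> i / (1 + run_ratio \<beta> i) = 1 - 1 / (real (Suc i) + 1)" for i using True by (simp add: run_ratio_def field_simps)
  ultimately show ?thesis using True by simp
next
  case False
  then have "run_ratio \<beta> i / (1 + run_ratio \<beta> i) = \<beta>" for i using assms by (simp add: run_ratio_def field_simps)
  then show ?thesis by simp
qed

text \<open>Below 1/2 alphabets of every rate exist, so the cost of the runs imposes no condition,
  and the limiting cases \<beta> = 1 and \<alpha> = \<beta>/(1+\<beta>) are included.\<close>

lemma FG_dim_ge_half:
  assumes "0 \<le> \<alpha>" "0 < \<beta>" "\<beta> \<le> 1" "\<alpha> \<le> \<beta> / (1 + \<beta>)"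
  shows "ereal (1 / 2) \<le> hausdorff_dim (F \<alpha> \<inter> G \<beta>)"
proof (rule ereal_le_from_below)
  fix \<rho> :: real assume "0 < \<rho>" "\<rho> < 1 / 2"
  then show "ereal \<rho> \<le> hausdorff_dim (F \<alpha> \<inter> G \<beta>)"
    using assms gap_ratio_pos(1)[OF assms(1,2,4)] gap_ratio_lim[OF assms(1,2)] run_ratio_pos[OF assms(2,3)] run_ratio_lim[OF assms(2,3)]
    by (intro FG_dim_ge_general[of \<rho> \<beta> "gap_ratio \<alpha> \<beta> 0" "run_ratio \<beta>"] alphabet_half) auto
qed simp

lemma FG_dim_ge:
  assumes \<alpha>: "0 \<le> \<alpha>" "0 < \<beta>" "\<beta> < 1" "\<alpha> < \<beta> / (1 + \<beta>)" and \<gamma>: "\<gamma> = \<beta>\<^sup>2 * (1 - \<alpha>) / (\<beta> - \<alpha>)" "0 < \<gamma>" "\<gamma> < 1"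
    and \<rho>: "0 < \<rho>" "\<rho> < \<rho>1" and inf: "\<exists>\<^sub>F n in sequentially. pre_s n \<gamma> golden > \<rho>1"
  shows "ereal \<rho> \<le> hausdorff_dim (F \<alpha> \<inter> G \<beta>)"
proof -
  have lg: "ln golden > 0" using golden_gt_1 by simp
  define g where "g = \<gamma> / (1 - \<gamma>)"
  have g: "g > 0" using \<gamma>(2,3) by (simp add: g_def)
  \<comment> \<open>Chosen for \<rho> (1+K)/K < \<rho>1: for \<alpha> = 0 the excess of
    (1+\<kappa>)/\<kappa> over 1 has to fit between \<rho> and \<rho>1.\<close>
  obtain K :: nat where K: "real K > \<rho> / (\<rho>1 - \<rho>)" using reals_Archimedean2 by blast
  define v where "v = \<beta> / (1 - \<beta>)"
  have v: "v > 0" using \<alpha> by (simp add: v_def)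
  have rate: "0 \<le> 2 * \<rho> * ln golden * run_ratio \<beta> i * (1 + gap_ratio \<alpha> \<beta> K i) / gap_ratio \<alpha> \<beta> K i \<and>
    2 * \<rho> * ln golden * run_ratio \<beta> i * (1 + gap_ratio \<alpha> \<beta> K i) / gap_ratio \<alpha> \<beta> K i < 2 * \<rho>1 * ln golden * g" for i
  proof -
    define k where "k = gap_ratio \<alpha> \<beta> K i"
    have k: "k > 0" unfolding k_def using gap_ratio_pos(1)[of \<alpha> \<beta>] \<alpha> by simp
    have nu: "run_ratio \<beta> i = v" using \<alpha> by (simp add: run_ratio_def v_def)
    have "\<rho> * (v * (1 + k) / k) < \<rho>1 * g"
    proof (cases "\<alpha> = 0")
      case True
      then have "\<gamma> = \<beta>" using \<gamma>(1) \<alpha> by (simp add: power2_eq_square)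
      then have gv: "g = v" by (simp add: g_def v_def)
      have "\<rho> / (\<rho>1 - \<rho>) < k" using K True by (simp add: k_def gap_ratio_def)
      then have "\<rho> < k * (\<rho>1 - \<rho>)" using \<rho> by (simp add: pos_divide_less_eq)
      then have "\<rho> * (1 + k) < \<rho>1 * k" by (simp add: algebra_simps)
      then have "\<rho> * (1 + k) / k < \<rho>1" using k by (simp add: pos_divide_less_eq)
      then have "v * (\<rho> * (1 + k) / k) < v * \<rho>1" using v by (rule mult_strict_left_mono)
      then show ?thesis unfolding gv by (simp add: mult_ac)
    next
      case False
      define q where "q = \<beta> / \<alpha> - 1 - \<beta>"
      have a0: "\<alpha> > 0" using False \<alpha> by simp
      have q: "q > 0"
      proof -
        have "\<alpha> * (1 + \<beta>) < \<beta>" using \<alpha> by (simp add: pos_less_divide_eq)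
        then have "1 + \<beta> < \<beta> / \<alpha>" using a0 by (simp add: pos_less_divide_eq mult.commute)
        then show ?thesis by (simp add: q_def)
      qed
      have qk: "q \<le> k" using False by (simp add: k_def gap_ratio_def q_def)
      have "(1 + k) / k \<le> (1 + q) / q" using q qk k by (simp add: divide_simps) (simp add: algebra_simps)
      then have "v * ((1 + k) / k) \<le> v * ((1 + q) / q)" using v by (intro mult_left_mono) auto
      also have "\<dots> = g" using ratio_identity[OF a0 \<alpha>(2-4) \<gamma>(1)] by (simp add: v_def q_def g_def)
      finally have "v * (1 + k) / k \<le> g" by simp
      then have "\<rho> * (v * (1 + k) / k) \<le> \<rho> * g" using \<rho> by (intro mult_left_mono) auto
      also have "\<dots> < \<rho>1 * g" using \<rho> g by (intro mult_strict_right_mono)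
      finally show ?thesis .
    qed
    then have "(2 * ln golden) * (\<rho> * (v * (1 + k) / k)) < (2 * ln golden) * (\<rho>1 * g)" using lg by (intro mult_strict_left_mono) auto
    moreover have "0 \<le> 2 * \<rho> * ln golden * v * (1 + k) / k" using k v lg \<rho> by simp
    ultimately show ?thesis unfolding nu k_def[symmetric] by (simp add: mult_ac)
  qed
  have "\<exists>M T. alphabet \<rho> (2 * \<rho> * ln golden * run_ratio \<beta> i * (1 + gap_ratio \<alpha> \<beta> K i) / gap_ratio \<alpha> \<beta> K i) M T" for i
    using rate[of i] \<rho> unfolding g_def by (intro alphabet_pre_s[OF \<gamma>(2,3) _ _ _ _ inf]) auto
  then show ?thesis
    using \<rho> \<alpha> gap_ratio_pos(1)[of \<alpha> \<beta> K] gap_ratio_lim[of \<alpha> \<beta> K] run_ratio_pos[of \<beta>] run_ratio_lim[of \<beta>]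
    by (intro FG_dim_ge_general[of \<rho> \<beta> "gap_ratio \<alpha> \<beta> K" "run_ratio \<beta>"]) auto
qed

text \<open>The upper bound gives d \<le> \<open>pre_s n\<close> for every n \<ge> 1. If
  \<open>pre_s n\<close> were at least some a > d infinitely often, the construction would give a
  dimension above d. So the limit exists and is d, which gives \<open>lim\<close> in
  \<open>s_dim\<close> its meaning.\<close>

lemma FG_dim_eq_s_dim:
  assumes \<alpha>: "0 \<le> \<alpha>" "0 < \<beta>" "\<beta> < 1" "\<alpha> < \<beta> / (1 + \<beta>)" and \<gamma>: "\<gamma> = \<beta>\<^sup>2 * (1 - \<alpha>) / (\<beta> - \<alpha>)" "0 < \<gamma>" "\<gamma> < 1"
  shows "hausdorff_dim (F \<alpha> \<inter> G \<beta>) = ereal (lim (\<lambda>n. pre_s n \<gamma> golden))"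
proof -
  define D where "D = hausdorff_dim (F \<alpha> \<inter> G \<beta>)"
  have "\<beta> / (1 + \<beta>) < \<beta>" using \<alpha> by (simp add: divide_simps)
  then have ab: "\<alpha> < \<beta>" using \<alpha> by linarith
  have c: "golden powr (real n * \<gamma> / (1 - \<gamma>)) > 1" if "n \<ge> 1" for n
    using that \<gamma>(2,3) golden_gt_1 by (intro gr_one_powr) auto
  have up: "D \<le> ereal \<rho>" if "n \<ge> 1" "\<rho> \<in> pre_s_set n (golden powr (real n * \<gamma> / (1 - \<gamma>)))" for n \<rho>
    unfolding D_def using FG_dim_le[OF \<alpha>(1) ab _ \<gamma> that] \<alpha> by simp
  obtain \<rho>0 where "\<rho>0 \<in> pre_s_set 1 (golden powr (real 1 * \<gamma> / (1 - \<gamma>)))" using pre_s_set_nonempty[OF c[of 1]] by auto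
  then have "D \<le> ereal \<rho>0" by (intro up[of 1]) auto
  moreover have D0: "D \<ge> 0" unfolding D_def by (rule hausdorff_dim_nonneg)
  ultimately obtain d where d: "D = ereal d" by (cases D) auto
  have d0: "d \<ge> 0" using D0 d by simp
  have ge: "d \<le> pre_s n \<gamma> golden" if n: "n \<ge> 1" for n
    unfolding pre_s_eq using pre_s_set_nonempty[OF c[OF n], of n] up[OF n] d by (intro cInf_greatest) auto
  have "(\<lambda>n. pre_s n \<gamma> golden) \<longlonglongrightarrow> d"
  proof (rule order_tendstoI)
    fix a assume "a < d"
    show "\<forall>\<^sub>F n in sequentially. a < pre_s n \<gamma> golden"
      using eventually_ge_at_top[of 1] by (rule eventually_mono) (use ge \<open>a < d\<close> in fastforce)
  next
    fix a assume a: "d < a"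
    show "\<forall>\<^sub>F n in sequentially. pre_s n \<gamma> golden < a"
    proof (rule ccontr)
      assume "\<not> ?thesis"
      then have "\<exists>\<^sub>F n in sequentially. a \<le> pre_s n \<gamma> golden" by (simp add: not_eventually not_less)
      define \<rho>1 where "\<rho>1 = (d + a) / 2"
      define \<rho> where "\<rho> = (d + \<rho>1) / 2"
      have r: "d < \<rho>" "\<rho> < \<rho>1" "\<rho>1 < a" using a by (auto simp: \<rho>1_def \<rho>_def)
      have "\<exists>\<^sub>F n in sequentially. pre_s n \<gamma> golden > \<rho>1"
        using \<open>\<exists>\<^sub>F n in sequentially. a \<le> pre_s n \<gamma> golden\<close> by (rule frequently_elim1) (use r in simp)
      then have "ereal \<rho> \<le> D" unfolding D_def using r d0 by (intro FG_dim_ge[OF \<alpha> \<gamma> _ r(2)]) auto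
      then show False using r d by simp
    qed
  qed
  then have "lim (\<lambda>n. pre_s n \<gamma> golden) = d" by (rule limI)
  then show ?thesis using d by (simp add: D_def)
qed

theorem theorem1p5:
  fixes \<alpha> \<beta> :: real
  assumes "\<alpha> \<in> {0..1}" and "\<beta> \<in> {0..1}" and "\<alpha> \<le> \<beta>"
  shows "hausdorff_dim (F \<alpha> \<inter> G \<beta>) =
    (if \<beta> = 0 then 1
     else if 0 \<le> \<alpha> \<and> \<alpha> \<le> \<beta> / (1 + \<beta>) \<and> \<beta> / (1 + \<beta>) < \<beta> \<and> \<beta> \<le> 1
       then ereal (s_dim (\<beta>^2 * (1 - \<alpha>) / (\<beta> - \<alpha>)) ((sqrt 5 + 1) / 2))
     else 0)"
proof (cases "\<beta> = 0")
  case True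
  then have "\<alpha> = 0" using assms by auto
  then show ?thesis using FG_dim_zero True by simp
next
  case False
  have \<beta>: "0 < \<beta>" "\<beta> \<le> 1" and \<alpha>: "0 \<le> \<alpha>" "\<alpha> \<le> 1" using False assms by auto
  have lt: "\<beta> / (1 + \<beta>) < \<beta>" using \<beta> by (simp add: divide_simps)
  show ?thesis
  proof (cases "\<alpha> \<le> \<beta> / (1 + \<beta>)")
    case le: True
    define \<gamma> where "\<gamma> = \<beta>\<^sup>2 * (1 - \<alpha>) / (\<beta> - \<alpha>)"
    have ab: "\<alpha> < \<beta>" using le lt by linarith
    have \<gamma>0: "\<gamma> > 0" unfolding \<gamma>_def using ab \<beta> by (intro divide_pos_pos mult_pos_pos) auto
    have le': "\<alpha> * (1 + \<beta>) \<le> \<beta>" using le \<beta> by (simp add: pos_le_divide_eq)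
    \<comment> \<open>This factorises the numerator of 1 - \<gamma>: it vanishes exactly for \<beta>
      = 1 or \<alpha> = \<beta>/(1+\<beta>), and is positive otherwise.\<close>
    have id: "\<beta> - \<alpha> - \<beta>\<^sup>2 * (1 - \<alpha>) = (1 - \<beta>) * (\<beta> - \<alpha> * (1 + \<beta>))" by (simp add: algebra_simps power2_eq_square)
    have "hausdorff_dim (F \<alpha> \<inter> G \<beta>) = ereal (s_dim \<gamma> golden)"
    proof (cases "\<beta> = 1 \<or> \<alpha> * (1 + \<beta>) = \<beta>")
      case True
      then have e: "\<beta>\<^sup>2 * (1 - \<alpha>) = \<beta> - \<alpha>" using id by auto
      have g1: "\<gamma> = 1" unfolding \<gamma>_def e using ab by simp
      have "hausdorff_dim (F \<alpha> \<inter> G \<beta>) = ereal (1 / 2)"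
        using FG_dim_le_half[OF \<alpha>(1) ab \<beta>(2)] FG_dim_ge_half[OF \<alpha>(1) \<beta> le] g1 by (intro antisym) (auto simp: \<gamma>_def)
      then show ?thesis using g1 by (simp add: s_dim_def)
    next
      case False
      then have b1: "\<beta> < 1" and a1: "\<alpha> * (1 + \<beta>) < \<beta>" using \<beta> le' by auto
      have "0 < (1 - \<beta>) * (\<beta> - \<alpha> * (1 + \<beta>))" using a1 b1 by (intro mult_pos_pos) auto
      then have \<gamma>1: "\<gamma> < 1" unfolding \<gamma>_def using id ab by (simp add: pos_divide_less_eq)
      have "\<alpha> < \<beta> / (1 + \<beta>)" using a1 \<beta> by (simp add: pos_less_divide_eq)
      from FG_dim_eq_s_dim[OF \<alpha>(1) \<beta>(1) b1 this \<gamma>_def \<gamma>0 \<gamma>1]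
      show ?thesis using \<gamma>0 \<gamma>1 by (simp add: s_dim_def)
    qed
    then show ?thesis using False le lt \<alpha> \<beta> by (simp add: \<gamma>_def golden_def)
  next
    case gt: False
    have "hausdorff_dim (F \<alpha> \<inter> G \<beta>) = 0" using gt \<beta> \<alpha> by (intro FG_dim_0) auto
    then show ?thesis using gt False by simp
  qed
qed

end
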